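(* Let $S \subset \mathbb{R}$ be the union of finitely many pairwise disjoint intervals. Suppose that there are two real numbers $\alpha, \beta$ such that the length of each of these intervals belongs to $\mathbb{Z}\alpha + \mathbb{Z}\beta$. Then there is a set $\Lambda \subset \mathbb{R}$ such that the exponential system $E(\Lambda)$ is a Riesz basis in $L^2(S)$.
   Context: $\mathbb{Z}\alpha + \mathbb{Z}\beta$ denotes the set of real numbers of the form $n\alpha + m\beta$ with $n, m \in \mathbb{Z}$; in particular the intervals are bounded. For $\Lambda \subset \mathbb{R}$, $E(\Lambda) = \{ x \mapsto e^{2\pi i \lambda x} : \lambda \in \Lambda \}$, regarded as a system of functions (indexed by $\Lambda$) in the space $L^2(S)$ of complex-valued square-integrable functions on $S$ with respect to Lebesgue measure. A Riesz basis of a Hilbert space has its usual meaning: the image of an orthonormal basis under a bounded invertible linear operator; equivalently, a complete system $\{e_\lambda\}$ for which there are constants $A, B > 0$ with $A \sum |c_\lambda|^2 \le \| \sum c_\lambda e_\lambda \|^2 \le B \sum |c_\lambda|^2$ for all finitely supported scalar sequences $(c_\lambda)$. *)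

theory Defs
  imports "HOL-Analysis.Analysis"
begin

text \<open>Functions are not identified almost everywhere, so \<^term>\<open>norm_L2\<close> is only a seminorm on
  \<^term>\<open>space_L2\<close>. All conditions below are expressed through this seminorm, hence depend on the
  functions only up to null sets.\<close>

definition space_L2 :: "real set \<Rightarrow> (real \<Rightarrow> complex) set" where
  "space_L2 S = {f \<in> borel_measurable (lebesgue_on S).
     integrable (lebesgue_on S) (\<lambda>x. (cmod (f x))\<^sup>2)}"

definition norm_L2 :: "real set \<Rightarrow> (real \<Rightarrow> complex) \<Rightarrow> real" where
  "norm_L2 S f = sqrt (LINT x|lebesgue_on S. (cmod (f x))\<^sup>2)"

definition complete_system_L2 :: "real set \<Rightarrow> 'i set \<Rightarrow> ('i \<Rightarrow> real \<Rightarrow> complex) \<Rightarrow> bool" where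
  "complete_system_L2 S I e \<longleftrightarrow>
     (\<forall>f\<in>space_L2 S. \<forall>\<epsilon>>0. \<exists>F c. finite F \<and> F \<subseteq> I \<and>
        norm_L2 S (\<lambda>x. f x - (\<Sum>i\<in>F. c i * e i x)) < \<epsilon>)"

definition riesz_basis_L2 :: "real set \<Rightarrow> 'i set \<Rightarrow> ('i \<Rightarrow> real \<Rightarrow> complex) \<Rightarrow> bool" where
  "riesz_basis_L2 S I e \<longleftrightarrow>
     (\<forall>i\<in>I. e i \<in> space_L2 S) \<and>
     complete_system_L2 S I e \<and>
     (\<exists>A B. A > 0 \<and> B > 0 \<and>
        (\<forall>F c. finite F \<longrightarrow> F \<subseteq> I \<longrightarrow>
           A * (\<Sum>i\<in>F. (cmod (c i))\<^sup>2) \<le> (norm_L2 S (\<lambda>x. \<Sum>i\<in>F. c i * e i x))\<^sup>2 \<and>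
           (norm_L2 S (\<lambda>x. \<Sum>i\<in>F. c i * e i x))\<^sup>2 \<le> B * (\<Sum>i\<in>F. (cmod (c i))\<^sup>2)))"

definition exponential :: "real \<Rightarrow> real \<Rightarrow> complex" where
  "exponential l x = exp (2 * of_real pi * \<i> * of_real l * of_real x)"

end

theory Submission
  imports Defs
begin

text \<open>The idea is the method of Kozma and Nitzan for combining Riesz bases. For \<open>A \<subseteq> [0,1)\<close> and a natural
  number \<open>N\<close>, let \<open>A\<^sub>n\<close> be the set of \<open>x\<close> for which more than \<open>n\<close> of the points \<open>(x + j) / N\<close>, \<open>j < N\<close>,
  lie in \<open>A\<close>. If every \<open>L\<^sup>2(A\<^sub>n)\<close>, \<open>n < N\<close>, has a Riesz basis of exponentials with integer frequencies
  \<open>\<Lambda>\<^sub>n\<close>, then the union of the sets \<open>N \<Lambda>\<^sub>n + n\<close> works for \<open>L\<^sup>2(A)\<close>, by Vandermonde arguments on the fibres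
  of \<open>t \<mapsto> N t\<close>.

  After an affine change of variable the indicator of the given set is a step function
  \<open>C + (\<Sum>u. \<lfloor>x - u\<rfloor>) - (\<Sum>d. \<lfloor>x - d\<rfloor>)\<close> with equally many up-jumps \<open>u\<close> and down-jumps \<open>d\<close>, all differences
  being irrational. Counting points in the fibres moves the jumps to \<open>N u\<close> and \<open>N d\<close>, and they are
  distributed among the sets \<open>A\<^sub>n\<close>. If there are at least two up-jumps, then for some \<open>N\<close> each \<open>A\<^sub>n\<close> has
  fewer of them: a set having all the jumps \<open>N u\<close>, \<open>N d\<close> has its Fourier coefficients at \<open>1\<close> and \<open>2\<close>
  determined by them, and averaging over \<open>N\<close> shows that these cannot always satisfy Bessel's
  inequality. If there is one up-jump, some \<open>N\<close> leaves only the empty set, the whole interval, and short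
  arcs. On a short arc of length \<open>c\<close>, the frequencies \<open>m / c\<close> of an orthogonal basis can be rounded to
  integers, as this is a small perturbation relative to the spacing.\<close>

subsection \<open>Energy of bounded Borel functions\<close>

text \<open>Integer frequencies serve twice. On a fibre, a frequency of residue \<open>n\<close>
  modulo \<open>N\<close> sees the fibre point only through the \<open>n\<close>-th power of an
  \<open>N\<close>-th root of unity, which is the Vandermonde structure. Parseval on the whole
  interval gives the upper Riesz bound with constant 1, so only density and the lower bound have to
  pass through the induction.

  Irrational differences of jumps survive multiplication by \<open>N\<close>, forbid two jumps at
  one point modulo 1, and make means over \<open>N\<close> computable: the squared jump sum at
  \<open>N\<close> has mean equal to the number of jumps. They cost nothing, since only countably
  many slopes of the affine map violate them.

  An indicator of mean \<open>a\<close> leaves at most \<open>a - a\<^sup>2 \<le> 1 / 4\<close> for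
  its nonzero Fourier coefficients; this is the origin of \<open>pi\<^sup>2 / 2\<close>, about 4.93.
  Two up-jumps mean four jumps, so the coefficient at 1 alone would only give the mean 4; the
  coefficient at 2, with weight 1/4, raises it to 5. With a single up-jump the mean is 5/2 and no
  contradiction arises, which is why that case is treated by short arcs.\<close>

definition bdd_borel :: "(real \<Rightarrow> complex) \<Rightarrow> bool" where
  "bdd_borel u \<longleftrightarrow> u \<in> borel_measurable borel \<and> (\<exists>B. \<forall>x. cmod (u x) \<le> B)"

definition unit_borel :: "real set \<Rightarrow> bool" where
  "unit_borel A \<longleftrightarrow> A \<in> sets borel \<and> A \<subseteq> {0..<1}"

text \<open>The squared L2 seminorm on \<open>A\<close>, kept squared to avoid roots. Borel
  functions and \<open>lborel\<close> keep it an ordinary set integral; the Lebesgue seminorm enters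
  only in the last subsection.\<close>

definition energy :: "real set \<Rightarrow> (real \<Rightarrow> complex) \<Rightarrow> real" where
  "energy A u = (LINT x:A|lborel. (cmod (u x))\<^sup>2)"

definition ee :: "real \<Rightarrow> complex" where
  "ee t = cis (2 * pi * t)"

text \<open>Coefficients are indexed by \<open>i\<close> and not by the frequency
  \<open>\<nu> i\<close>, so that integer frequencies and their perturbations can share one family
  of coefficients.\<close>

definition trig :: "('i \<Rightarrow> real) \<Rightarrow> 'i set \<Rightarrow> ('i \<Rightarrow> complex) \<Rightarrow> real \<Rightarrow> complex" where
  "trig \<nu> F c x = (\<Sum>i\<in>F. c i * ee (\<nu> i * x))"

definition approximable :: "real set \<Rightarrow> ('i \<Rightarrow> real) \<Rightarrow> 'i set \<Rightarrow> (real \<Rightarrow> complex) \<Rightarrow> bool" where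
  "approximable A \<nu> I u \<longleftrightarrow>
     (\<forall>\<epsilon>>0. \<exists>F c. finite F \<and> F \<subseteq> I \<and> energy A (\<lambda>x. u x - trig \<nu> F c x) < \<epsilon>)"

text \<open>The upper Riesz bound is absent because integer frequencies satisfy it with constant 1
  on every Borel subset of the unit interval (\<open>energy_trig_of_int_le\<close>). Density is
  asked for bounded Borel functions only, since these are dense in \<open>space_L2\<close>.\<close>

definition int_riesz :: "real set \<Rightarrow> bool" where
  "int_riesz A \<longleftrightarrow> (\<exists>\<Lambda> :: int set.
     (\<forall>u. bdd_borel u \<longrightarrow> approximable A of_int \<Lambda> u) \<and>
     (\<exists>a>0. \<forall>F c. finite F \<longrightarrow> F \<subseteq> \<Lambda> \<longrightarrow>
        a * (\<Sum>k\<in>F. (cmod (c k))\<^sup>2) \<le> energy A (trig of_int F c)))"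

section \<open>Characters of the circle and closure properties of bounded Borel functions\<close>

lemma ee_add: "ee (s + t) = ee s * ee t"
  by (simp add: ee_def cis_mult distrib_left)

lemma ee_0 [simp]: "ee 0 = 1"
  by (simp add: ee_def)

lemma ee_of_int [simp]: "ee (of_int k) = 1"
  unfolding ee_def by (simp add: cis_multiple_2pi)

lemma norm_ee [simp]: "cmod (ee t) = 1"
  by (simp add: ee_def)

lemma ee_uminus: "ee (- t) = cnj (ee t)"
  by (simp add: ee_def cis_cnj)

lemma ee_mult_of_nat: "ee (of_nat n * t) = ee t ^ n"
  by (induction n) (simp_all add: distrib_right ee_add)

lemma ee_eq_1_iff: "ee t = 1 \<longleftrightarrow> t \<in> \<int>"
proof
  assume "ee t = 1"
  then have "cos (2 * pi * t) = 1" by (simp add: ee_def complex_eq_iff)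
  then obtain n :: int where "2 * pi * t = of_int n * 2 * pi"
    using cos_one_2pi_int by blast
  then have "t = of_int n" by (simp add: field_simps)
  then show "t \<in> \<int>" by simp
qed (auto elim!: Ints_cases)

lemma continuous_on_ee [continuous_intros]:
  "continuous_on S f \<Longrightarrow> continuous_on S (\<lambda>x. ee (f x))"
  unfolding ee_def cis_conv_exp by (intro continuous_intros)

lemma borel_measurable_ee [measurable]: "ee \<in> borel_measurable borel"
  by (intro borel_measurable_continuous_onI continuous_intros)

lemma borel_measurable_trig [measurable]: "trig \<nu> F c \<in> borel_measurable borel"
  unfolding trig_def by measurable

lemma norm_trig_le: "cmod (trig \<nu> F c x) \<le> (\<Sum>i\<in>F. cmod (c i))"
  unfolding trig_def by (rule order_trans[OF norm_sum]) (simp add: norm_mult)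

lemma bdd_borelI: "u \<in> borel_measurable borel \<Longrightarrow> (\<And>x. cmod (u x) \<le> B) \<Longrightarrow> bdd_borel u"
  unfolding bdd_borel_def by blast

lemma bdd_borel_measurable [measurable_dest]: "bdd_borel u \<Longrightarrow> u \<in> borel_measurable borel"
  by (simp add: bdd_borel_def)

lemma bdd_borelE:
  assumes "bdd_borel u"
  obtains B where "0 < B" "\<And>x. cmod (u x) \<le> B"
proof -
  obtain B where B: "\<And>x. cmod (u x) \<le> B" using assms by (auto simp: bdd_borel_def)
  have "cmod (u x) \<le> max 1 B" for x using B[of x] by linarith
  then show ?thesis using that[of "max 1 B"] by simp
qed

lemma bdd_borel_trig: "bdd_borel (trig \<nu> F c)"
  by (rule bdd_borelI[OF _ norm_trig_le]) measurable

lemma bdd_borel_const: "bdd_borel (\<lambda>x. c)"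
  by (rule bdd_borelI[of _ "cmod c"]) auto

lemma bdd_borel_add:
  assumes "bdd_borel u" "bdd_borel v" shows "bdd_borel (\<lambda>x. u x + v x)"
proof -
  obtain B C where "\<And>x. cmod (u x) \<le> B" "\<And>x. cmod (v x) \<le> C"
    using assms bdd_borelE by metis
  then have "cmod (u x + v x) \<le> B + C" for x
    by (meson add_mono norm_triangle_le)
  then show ?thesis
    using assms[THEN bdd_borel_measurable] by (intro bdd_borelI) measurable
qed

lemma bdd_borel_mult:
  assumes "bdd_borel u" "bdd_borel v" shows "bdd_borel (\<lambda>x. u x * v x)"
proof -
  obtain B C where "\<And>x. cmod (u x) \<le> B" "\<And>x. cmod (v x) \<le> C" "B > 0"
    using assms bdd_borelE by metis
  then have "cmod (u x * v x) \<le> B * C" for x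
    by (simp add: norm_mult mult_mono)
  then show ?thesis
    using assms[THEN bdd_borel_measurable] by (intro bdd_borelI) measurable
qed

lemma bdd_borel_diff:
  assumes "bdd_borel u" "bdd_borel v" shows "bdd_borel (\<lambda>x. u x - v x)"
  using bdd_borel_add[OF assms(1) bdd_borel_mult[OF bdd_borel_const[of "-1"] assms(2)]] by simp

lemma bdd_borel_sum: "(\<And>i. i \<in> F \<Longrightarrow> bdd_borel (u i)) \<Longrightarrow> bdd_borel (\<lambda>x. \<Sum>i\<in>F. u i x)"
  by (induction F rule: infinite_finite_induct) (auto intro: bdd_borel_const bdd_borel_add)

lemma bdd_borel_compose:
  assumes "bdd_borel u" "g \<in> borel_measurable borel" shows "bdd_borel (\<lambda>x. u (g x))"
proof -
  obtain B where "\<And>x. cmod (u x) \<le> B" using assms bdd_borelE by metis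
  then show ?thesis using assms by (intro bdd_borelI[of _ B]) (auto intro: measurable_compose)
qed

lemma bdd_borel_ee: "f \<in> borel_measurable borel \<Longrightarrow> bdd_borel (\<lambda>x. ee (f x))"
  by (rule bdd_borelI[of _ 1]) (auto intro: measurable_compose)

lemma bdd_borel_indicator:
  assumes "A \<in> sets borel" shows "bdd_borel (\<lambda>x. of_real (indicator A x))"
  using assms by (intro bdd_borelI[of _ 1]) (auto simp: indicator_def)

lemma bdd_borel_if:
  assumes "A \<in> sets borel" "bdd_borel u" "bdd_borel v"
  shows "bdd_borel (\<lambda>x. if x \<in> A then u x else v x)"
proof -
  have "(\<lambda>x. if x \<in> A then u x else v x) =
    (\<lambda>x. of_real (indicator A x) * u x + of_real (indicator (- A) x) * v x)"
    by (auto simp: indicator_def)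
  moreover have "bdd_borel \<dots>"
    using assms by (intro bdd_borel_add bdd_borel_mult bdd_borel_indicator) auto
  ultimately show ?thesis by simp
qed

section \<open>Energy as a squared seminorm, and approximability in it\<close>

lemma unit_borel_unit [simp]: "unit_borel {0..<1}"
  by (simp add: unit_borel_def)

lemma unit_borelD [measurable_dest]: "unit_borel A \<Longrightarrow> A \<in> sets borel"
  by (simp add: unit_borel_def)

lemma unit_borel_subset: "unit_borel A \<Longrightarrow> A \<subseteq> {0..<1}"
  by (simp add: unit_borel_def)

lemma set_integrable_unit_borel:
  fixes g :: "real \<Rightarrow> 'b::{banach,second_countable_topology}"
  assumes "unit_borel A" "g \<in> borel_measurable borel" "\<And>x. x \<in> A \<Longrightarrow> norm (g x) \<le> B"
  shows "set_integrable lborel A g"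
proof -
  have "set_integrable lborel A (\<lambda>_. B)"
  proof -
    have "emeasure lborel A \<le> emeasure lborel {0..<1::real}"
      using assms(1) by (intro emeasure_mono) (auto simp: unit_borel_def)
    then have "emeasure lborel A < \<infinity>" by (auto intro: order_le_less_trans)
    then show ?thesis
      unfolding set_integrable_def using assms(1) by (simp add: unit_borel_def)
  qed
  then show ?thesis
    unfolding set_integrable_def
    by (rule Bochner_Integration.integrable_bound)
      (use assms in \<open>auto simp: unit_borel_def indicator_def intro!: AE_I2 dest: assms(3)\<close>)
qed

lemma set_integrable_energy:
  assumes "unit_borel A" "bdd_borel u"
  shows "set_integrable lborel A (\<lambda>x. (cmod (u x))\<^sup>2)"
proof -
  obtain B where B: "\<And>x. cmod (u x) \<le> B" using assms bdd_borelE by metis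
  show ?thesis
    using assms B by (intro set_integrable_unit_borel[where B="B\<^sup>2"]) (auto intro!: power_mono)
qed

lemma energy_nonneg: "0 \<le> energy A u"
  unfolding energy_def set_lebesgue_integral_def by (intro integral_nonneg_AE) auto

lemma energy_cong: "(\<And>x. x \<in> A \<Longrightarrow> cmod (u x) = cmod (v x)) \<Longrightarrow> energy A u = energy A v"
  unfolding energy_def set_lebesgue_integral_def
  by (intro Bochner_Integration.integral_cong) (auto simp: indicator_def)

lemma energy_mono:
  assumes "unit_borel A" "bdd_borel u" "bdd_borel v" "\<And>x. x \<in> A \<Longrightarrow> cmod (u x) \<le> cmod (v x)"
  shows "energy A u \<le> energy A v"
  unfolding energy_def using assms
  by (intro set_integral_mono set_integrable_energy) (auto intro: power_mono)

lemma energy_subset: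
  assumes "unit_borel A" "unit_borel B" "A \<subseteq> B" "bdd_borel u"
  shows "energy A u \<le> energy B u"
  unfolding energy_def set_lebesgue_integral_def
  using set_integrable_energy[OF assms(1,4)] set_integrable_energy[OF assms(2,4)] assms(3)
  by (intro integral_mono) (auto simp: set_integrable_def indicator_def)

lemma energy_le_unit:
  assumes "unit_borel A" "bdd_borel u" shows "energy A u \<le> energy {0..<1} u"
  using assms energy_subset unit_borel_subset unit_borel_unit by blast

lemma norm_add_sq_le:
  assumes "\<eta> > 0"
  shows "(cmod (a + b))\<^sup>2 \<le> (1 + \<eta>) * (cmod a)\<^sup>2 + (1 + 1 / \<eta>) * (cmod b)\<^sup>2"
proof -
  have "(cmod (a + b))\<^sup>2 \<le> (cmod a + cmod b)\<^sup>2"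
    by (intro power_mono norm_triangle_ineq) auto
  moreover have "2 * cmod a * cmod b \<le> \<eta> * (cmod a)\<^sup>2 + (1 / \<eta>) * (cmod b)\<^sup>2"
  proof -
    have "0 \<le> (sqrt \<eta> * cmod a - cmod b / sqrt \<eta>)\<^sup>2" by simp
    then show ?thesis using assms by (simp add: power2_diff power_mult_distrib power_divide)
  qed
  ultimately show ?thesis by (simp add: power2_sum algebra_simps)
qed

lemma energy_add_eps:
  assumes "unit_borel A" "bdd_borel u" "bdd_borel v" "\<eta> > 0"
  shows "energy A (\<lambda>x. u x + v x) \<le> (1 + \<eta>) * energy A u + (1 + 1 / \<eta>) * energy A v"
proof -
  note i = set_integrable_energy[OF assms(1)]
  have "energy A (\<lambda>x. u x + v x) \<le>
      (LINT x:A|lborel. (1 + \<eta>) * (cmod (u x))\<^sup>2 + (1 + 1 / \<eta>) * (cmod (v x))\<^sup>2)"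
    unfolding energy_def using assms
    by (intro set_integral_mono set_integral_add i bdd_borel_add set_integrable_mult_right norm_add_sq_le)
  also have "\<dots> = (1 + \<eta>) * energy A u + (1 + 1 / \<eta>) * energy A v"
    unfolding energy_def using assms i
    by (subst set_integral_add) (auto intro: set_integrable_mult_right)
  finally show ?thesis .
qed

lemma energy_add:
  assumes "unit_borel A" "bdd_borel u" "bdd_borel v"
  shows "energy A (\<lambda>x. u x + v x) \<le> 2 * energy A u + 2 * energy A v"
  using energy_add_eps[OF assms, of 1] by simp

lemma set_integral_finite_sum:
  fixes f :: "'i \<Rightarrow> 'a \<Rightarrow> 'b::{banach,second_countable_topology}"
  assumes "\<And>i. i \<in> F \<Longrightarrow> set_integrable M A (f i)"
  shows "set_integrable M A (\<lambda>x. \<Sum>i\<in>F. f i x)"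
    and "(LINT x:A|M. \<Sum>i\<in>F. f i x) = (\<Sum>i\<in>F. LINT x:A|M. f i x)"
  using assms unfolding set_integrable_def set_lebesgue_integral_def
  by (auto simp: scaleR_sum_right)

lemma trig_add:
  assumes "finite F" "finite G"
  shows "trig \<nu> F c x + trig \<nu> G d x =
    trig \<nu> (F \<union> G) (\<lambda>i. (if i \<in> F then c i else 0) + (if i \<in> G then d i else 0)) x"
proof -
  have "trig \<nu> F c x = (\<Sum>i\<in>F \<union> G. (if i \<in> F then c i else 0) * ee (\<nu> i * x))"
    unfolding trig_def using assms by (intro sum.mono_neutral_cong_left) auto
  moreover have "trig \<nu> G d x = (\<Sum>i\<in>F \<union> G. (if i \<in> G then d i else 0) * ee (\<nu> i * x))"
    unfolding trig_def using assms by (intro sum.mono_neutral_cong_left) auto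
  ultimately show ?thesis
    by (simp add: trig_def sum.distrib[symmetric] distrib_right)
qed

lemma approximable_trig:
  assumes "finite F" "F \<subseteq> I" shows "approximable A \<nu> I (trig \<nu> F c)"
  unfolding approximable_def
proof (intro allI impI)
  fix \<epsilon> :: real assume "\<epsilon> > 0"
  then show "\<exists>G d. finite G \<and> G \<subseteq> I \<and> energy A (\<lambda>x. trig \<nu> F c x - trig \<nu> G d x) < \<epsilon>"
    using assms by (intro exI[of _ F] exI[of _ c]) (simp add: energy_def)
qed

text \<open>Approximability is closed under limits in energy: two errors below
  \<open>\<epsilon> / 4\<close>, each doubled by \<open>energy_add\<close>, stay below
  \<open>\<epsilon>\<close>.\<close>

lemma approximable_limit:
  assumes A: "unit_borel A" and u: "bdd_borel u"
    and "\<And>\<epsilon>. \<epsilon> > 0 \<Longrightarrow> \<exists>v. bdd_borel v \<and> approximable A \<nu> I v \<and> energy A (\<lambda>x. u x - v x) < \<epsilon>"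
  shows "approximable A \<nu> I u"
  unfolding approximable_def
proof (intro allI impI)
  fix \<epsilon> :: real assume e: "\<epsilon> > 0"
  obtain v where v: "bdd_borel v" "approximable A \<nu> I v" "energy A (\<lambda>x. u x - v x) < \<epsilon> / 4"
    using assms(3)[of "\<epsilon> / 4"] e by auto
  obtain F c where F: "finite F" "F \<subseteq> I" "energy A (\<lambda>x. v x - trig \<nu> F c x) < \<epsilon> / 4"
    using v(2) e unfolding approximable_def by (meson zero_less_divide_iff zero_less_numeral)
  have "energy A (\<lambda>x. (u x - v x) + (v x - trig \<nu> F c x)) < \<epsilon>"
    using energy_add[OF A bdd_borel_diff[OF u v(1)] bdd_borel_diff[OF v(1) bdd_borel_trig, of \<nu> F c]]
      F v by linarith
  then show "\<exists>F c. finite F \<and> F \<subseteq> I \<and> energy A (\<lambda>x. u x - trig \<nu> F c x) < \<epsilon>"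
    using F by auto
qed

lemma approximable_add:
  assumes A: "unit_borel A" and uv: "bdd_borel u" "bdd_borel v"
    and "approximable A \<nu> I u" "approximable A \<nu> I v"
  shows "approximable A \<nu> I (\<lambda>x. u x + v x)"
  unfolding approximable_def
proof (intro allI impI)
  fix \<epsilon> :: real assume e: "\<epsilon> > 0"
  obtain F c where F: "finite F" "F \<subseteq> I" "energy A (\<lambda>x. u x - trig \<nu> F c x) < \<epsilon> / 4"
    using assms(4) e unfolding approximable_def by (meson zero_less_divide_iff zero_less_numeral)
  obtain G d where G: "finite G" "G \<subseteq> I" "energy A (\<lambda>x. v x - trig \<nu> G d x) < \<epsilon> / 4"
    using assms(5) e unfolding approximable_def by (meson zero_less_divide_iff zero_less_numeral)
  have "energy A (\<lambda>x. (u x - trig \<nu> F c x) + (v x - trig \<nu> G d x)) < \<epsilon>"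
    using energy_add[OF A bdd_borel_diff[OF uv(1) bdd_borel_trig, of \<nu> F c]
        bdd_borel_diff[OF uv(2) bdd_borel_trig, of \<nu> G d]] F G by linarith
  moreover have "(u x - trig \<nu> F c x) + (v x - trig \<nu> G d x) = u x + v x -
    trig \<nu> (F \<union> G) (\<lambda>i. (if i \<in> F then c i else 0) + (if i \<in> G then d i else 0)) x" for x
    using trig_add[OF F(1) G(1), of \<nu> c x d] by (simp add: algebra_simps)
  ultimately show "\<exists>H h. finite H \<and> H \<subseteq> I \<and> energy A (\<lambda>x. u x + v x - trig \<nu> H h x) < \<epsilon>"
    using F G by (intro exI[of _ "F \<union> G"] exI) auto
qed

lemma approximable_cong:
  assumes "\<And>x. x \<in> A \<Longrightarrow> u x = v x"
  shows "approximable A \<nu> I u \<longleftrightarrow> approximable A \<nu> I v"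
proof -
  have "energy A (\<lambda>x. u x - w x) = energy A (\<lambda>x. v x - w x)" for w
    using assms by (intro energy_cong) auto
  then show ?thesis by (simp add: approximable_def)
qed

section \<open>Changes of variable on the circle: folding, rotation and dilation\<close>

lemma set_integral_unit_fold:
  fixes g :: "real \<Rightarrow> real"
  assumes g: "g \<in> borel_measurable borel" "\<And>x. \<bar>g x\<bar> \<le> B" and N: "N > 0"
  shows "(LINT t:{0..<1}|lborel. g t) =
    (\<Sum>j<N. LINT x:{0..<1}|lborel. g ((x + real j) / real N)) / real N"
proof -
  \<comment> \<open>A point \<open>t\<close> of the unit interval lies in exactly one piece
    \<open>[j / N, (j + 1) / N)\<close>, the one with \<open>j = \<lfloor>N * t\<rfloor>\<close>; a
    point outside lies in none of them.\<close>
  have split: "indicator {0..<1} t = (\<Sum>j<N. indicator {0..<1} (real N * t - real j) :: real)" for t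
  proof (cases "t \<in> {0..<1}")
    case True
    define k where "k = nat \<lfloor>real N * t\<rfloor>"
    have k: "real k = of_int \<lfloor>real N * t\<rfloor>" using True by (simp add: k_def)
    have "real N * t < real N" using True N by simp
    then have kN: "k < N" using k by linarith
    have "indicator {0..<1} (real N * t - real j) = (if j = k then 1 else 0 :: real)" for j
    proof -
      have "j = k \<longleftrightarrow> real N * t - real j \<in> {0..<1}"
        using k by (auto simp: le_floor_iff floor_less_iff) linarith+
      then show ?thesis by (simp add: indicator_def)
    qed
    then show ?thesis using True kN by simp
  next
    case False
    have "real N * t - real j \<notin> {0..<1}" if "j < N" for j
    proof
      assume *: "real N * t - real j \<in> {0..<1}"
      have "0 \<le> real N * t" using * by auto
      then have "0 \<le> t" using N by (simp add: zero_le_mult_iff)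
      have "real j + 1 \<le> real N" using that by linarith
      moreover have "real N * t < real j + 1" using * by simp
      ultimately have "real N * t < real N" by linarith
      then have "t < 1" using N by simp
      with False \<open>0 \<le> t\<close> show False by auto
    qed
    then show ?thesis using False by simp
  qed
  have int: "integrable lborel (\<lambda>t. indicator {0..<1} (real N * t - real j) * g t)" for j
  proof -
    have "integrable lborel (\<lambda>x. indicator {0..<1} x * g ((x + real j) / real N))"
      using set_integrable_unit_borel[of "{0..<1}" "\<lambda>x. g ((x + real j) / real N)" B] g
      by (simp add: set_integrable_def)
    from lborel_integrable_real_affine[OF this, of "real N" "- real j"]
    show ?thesis using N by (simp add: algebra_simps)
  qed
  have each: "(\<integral>t. indicator {0..<1} (real N * t - real j) * g t \<partial>lborel) =
     (LINT x:{0..<1}|lborel. g ((x + real j) / real N)) / real N" for j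
    using N by (subst lborel_integral_real_affine[of "1 / real N" _ "real j / real N"])
      (simp_all add: set_lebesgue_integral_def field_simps)
  have "(LINT t:{0..<1}|lborel. g t) = (\<integral>t. (\<Sum>j<N. indicator {0..<1} (real N * t - real j) * g t) \<partial>lborel)"
    unfolding set_lebesgue_integral_def by (subst split) (simp add: sum_distrib_right)
  also have "\<dots> = (\<Sum>j<N. \<integral>t. indicator {0..<1} (real N * t - real j) * g t \<partial>lborel)"
    by (intro Bochner_Integration.integral_sum int)
  finally show ?thesis by (simp add: each sum_divide_distrib)
qed

text \<open>Only \<open>w = frac v\<close> matters. The interval is cut at \<open>1 - w\<close>,
  beyond which \<open>x + w\<close> has passed 1 and must be reduced.\<close>

lemma set_integral_unit_translate:
  fixes g :: "real \<Rightarrow> real"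
  assumes g: "g \<in> borel_measurable borel" "\<And>x. \<bar>g x\<bar> \<le> B"
  shows "(LINT x:{0..<1}|lborel. g (frac (x + v))) = (LINT x:{0..<1}|lborel. g x)"
proof -
  define w where "w = frac v"
  have w: "0 \<le> w" "w < 1" by (simp_all add: w_def frac_ge_0 frac_lt_1)
  have fr: "frac (x + v) = frac (x + w)" for x
  proof -
    have *: "x + w = x + v - of_int \<lfloor>v\<rfloor>" by (simp add: w_def frac_def)
    show ?thesis unfolding * by (simp add: frac_def)
  qed
  have split: "indicator {0..<1} x * g (frac (x + v)) =
     indicator {w..<1} (x + w) * g (x + w) + indicator {0..<w} (x + w - 1) * g (x + w - 1)" for x
  proof -
    consider "x < 0 \<or> x \<ge> 1" | "0 \<le> x" "x < 1 - w" | "1 - w \<le> x" "x < 1" by linarith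
    then show ?thesis
    proof cases
      case 2
      then have "frac (x + w) = x + w" using w by (simp add: frac_eq)
      then show ?thesis using 2 w fr by (auto simp: indicator_def)
    next
      case 3
      then have "frac (x + w) = frac (x + w - 1)"
        using frac_1_eq[of "x + w - 1"] by simp
      also have "\<dots> = x + w - 1" using w 3 by (subst frac_eq) auto
      finally show ?thesis using 3 w fr by (auto simp: indicator_def)
    qed (use w in \<open>auto simp: indicator_def\<close>)
  qed
  have i: "integrable lborel (\<lambda>x. indicator {a..<b} x * g x)" if "0 \<le> a" "b \<le> 1" for a b
    using set_integrable_unit_borel[of "{a..<b}" g B] g that
    by (auto simp: set_integrable_def unit_borel_def)
  have i1: "integrable lborel (\<lambda>x. indicator {w..<1} (x + w) * g (x + w))"
    using lborel_integrable_real_affine[OF i[of w 1], of 1 w] w by (simp add: add.commute)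
  have i2: "integrable lborel (\<lambda>x. indicator {0..<w} (x + w - 1) * g (x + w - 1))"
    using lborel_integrable_real_affine[OF i[of 0 w], of 1 "w - 1"] w by (simp add: algebra_simps)
  have "(LINT x:{0..<1}|lborel. g (frac (x + v))) =
    (\<integral>x. indicator {w..<1} (x + w) * g (x + w) \<partial>lborel) +
    (\<integral>x. indicator {0..<w} (x + w - 1) * g (x + w - 1) \<partial>lborel)"
    unfolding set_lebesgue_integral_def using i1 i2 by (simp add: split)
  also have "\<dots> = (\<integral>x. indicator {w..<1} x * g x \<partial>lborel) + (\<integral>x. indicator {0..<w} x * g x \<partial>lborel)"
    by (subst (3) lborel_integral_real_affine[of 1 _ w], simp,
        subst (4) lborel_integral_real_affine[of 1 _ "w - 1"], simp) (simp add: algebra_simps)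
  also have "\<dots> = (\<integral>x. indicator {w..<1} x * g x + indicator {0..<w} x * g x \<partial>lborel)"
    using i w by simp
  also have "\<dots> = (LINT x:{0..<1}|lborel. g x)"
    unfolding set_lebesgue_integral_def using w
    by (intro Bochner_Integration.integral_cong) (auto simp: indicator_def)
  finally show ?thesis .
qed

lemma energy_unit_scale:
  assumes u: "bdd_borel u" and c: "0 < c" "c \<le> 1"
  shows "energy {0..<c} u = c * energy {0..<1} (\<lambda>s. u (c * s))"
proof -
  have "energy {0..<c} u = \<bar>c\<bar> *\<^sub>R (\<integral>x. indicator {0..<c} (0 + c * x) *\<^sub>R (cmod (u (0 + c * x)))\<^sup>2 \<partial>lborel)"
    unfolding energy_def set_lebesgue_integral_def using c
    by (intro lborel_integral_real_affine) auto
  also have "\<dots> = c * energy {0..<1} (\<lambda>s. u (c * s))"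
    unfolding energy_def set_lebesgue_integral_def using c
    by (auto simp: indicator_def zero_le_mult_iff intro!: Bochner_Integration.integral_cong)
  finally show ?thesis .
qed

text \<open>A rotation moves the arc to the initial segment \<open>[0, c)\<close>, even if the arc
  wraps around 0, and a dilation stretches that segment to the unit interval.\<close>

lemma energy_arc:
  assumes u: "bdd_borel u" and c: "0 < c" "c \<le> 1"
  shows "energy {x\<in>{0..<1}. frac (x - v) < c} u =
    c * energy {0..<1} (\<lambda>s. u (frac (c * s + v)))"
proof -
  obtain B where B: "\<And>x. cmod (u x) \<le> B" "B > 0" using u bdd_borelE by metis
  note [measurable] = bdd_borel_measurable[OF u]
  define g where "g y = indicator {..<c} y * (cmod (u (frac (y + v))))\<^sup>2" for y :: real
  have gm: "g \<in> borel_measurable borel" unfolding g_def frac_def by measurable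
  have gB: "\<bar>g y\<bar> \<le> B\<^sup>2" for y
    using B power_mono[OF B(1)[of "frac (y + v)"], of 2] by (auto simp: g_def indicator_def)
  have fr: "frac (frac (x - v) + v) = x" if "x \<in> {0..<1}" for x
  proof -
    have "frac (x - v) + v = x + of_int (- \<lfloor>x - v\<rfloor>)" by (simp add: frac_def)
    then have "frac (frac (x - v) + v) = frac x" by (simp add: frac_def)
    then show ?thesis using that by (simp add: frac_eq)
  qed
  have "energy {x\<in>{0..<1}. frac (x - v) < c} u = (LINT x:{0..<1}|lborel. g (frac (x + (- v))))"
    unfolding energy_def set_lebesgue_integral_def g_def using fr
    by (auto simp: indicator_def intro!: Bochner_Integration.integral_cong)
  also have "\<dots> = (LINT x:{0..<1}|lborel. g x)"
    by (rule set_integral_unit_translate[OF gm gB])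
  also have "\<dots> = energy {0..<c} (\<lambda>x. u (frac (x + v)))"
    unfolding energy_def set_lebesgue_integral_def g_def using c
    by (auto simp: indicator_def intro!: Bochner_Integration.integral_cong)
  also have "\<dots> = c * energy {0..<1} (\<lambda>s. u (frac (c * s + v)))"
    by (rule energy_unit_scale[OF bdd_borel_compose[OF u] c]) (unfold frac_def, measurable)
  finally show ?thesis .
qed

lemma energy_fold:
  assumes A: "unit_borel A" and u: "bdd_borel u" and N: "N > 0"
  shows "energy A u = (\<Sum>j<N. energy {x\<in>{0..<1}. (x + real j) / real N \<in> A}
    (\<lambda>x. u ((x + real j) / real N))) / real N"
proof -
  obtain B where B: "\<And>x. cmod (u x) \<le> B" "B > 0" using u bdd_borelE by metis
  note [measurable] = bdd_borel_measurable[OF u] unit_borelD[OF A]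
  define g where "g y = indicator A y * (cmod (u y))\<^sup>2" for y :: real
  have gm: "g \<in> borel_measurable borel" unfolding g_def by measurable
  have gB: "\<bar>g y\<bar> \<le> B\<^sup>2" for y
    using B power_mono[OF B(1)[of y], of 2] by (auto simp: g_def indicator_def)
  have "energy A u = (LINT x:{0..<1}|lborel. g x)"
    unfolding energy_def set_lebesgue_integral_def g_def using unit_borel_subset[OF A]
    by (auto simp: indicator_def intro!: Bochner_Integration.integral_cong)
  also have "\<dots> = (\<Sum>j<N. LINT x:{0..<1}|lborel. g ((x + real j) / real N)) / real N"
    by (rule set_integral_unit_fold[OF gm gB N])
  also have "(\<lambda>j. LINT x:{0..<1}|lborel. g ((x + real j) / real N)) =
     (\<lambda>j. energy {x\<in>{0..<1}. (x + real j) / real N \<in> A} (\<lambda>x. u ((x + real j) / real N)))"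
    unfolding energy_def set_lebesgue_integral_def g_def
    by (auto simp: indicator_def intro!: Bochner_Integration.integral_cong)
  finally show ?thesis .
qed

lemma integral_ee:
  assumes "0 \<le> w" "w \<le> 1" "l \<noteq> 0"
  shows "(LINT x:{w..<1}|lborel. ee (l * x)) = (ee l - ee (l * w)) / (2 * pi * \<i> * l)"
proof -
  have "(LINT x:{w..<1}|lborel. ee (l * x)) = (LINT x:{w..1}|lborel. ee (l * x))"
    by (rule set_integral_discrete_difference[where X="{1}"]) auto
  also have "\<dots> = ee (l * 1) / (2 * pi * \<i> * l) - ee (l * w) / (2 * pi * \<i> * l)"
    unfolding set_lebesgue_integral_def
  proof (rule integral_FTC_atLeastAtMost)
    fix x
    have "((\<lambda>z. exp (\<i> * (2 * of_real pi * of_real l * z)) / (2 * pi * \<i> * l)) has_field_derivative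
      exp (\<i> * (2 * of_real pi * of_real l * of_real x)) * (\<i> * (2 * of_real pi * of_real l)) / (2 * pi * \<i> * l))
      (at (of_real x))"
      using assms(3) by (auto intro!: derivative_eq_intros simp: field_simps)
    from has_vector_derivative_real_field[OF this]
    have "((\<lambda>x. ee (l * x) / (2 * pi * \<i> * l)) has_vector_derivative
      ee (l * x) * (\<i> * (2 * of_real pi * of_real l)) / (2 * pi * \<i> * l)) (at x within {w..1})"
      by (simp add: ee_def cis_conv_exp mult.assoc)
    then show "((\<lambda>x. ee (l * x) / (2 * pi * \<i> * l)) has_vector_derivative ee (l * x)) (at x within {w..1})"
      using assms by (simp add: scaleR_conv_of_real field_simps)
  qed (use assms in \<open>auto intro!: continuous_intros\<close>)
  finally show ?thesis by (simp add: diff_divide_distrib)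
qed

lemma integral_ee_unit:
  "(LINT x:{0..<1}|lborel. ee (of_int k * x)) = (if k = 0 then 1 else 0)"
  using integral_ee[of 0 "of_int k"] by (auto simp: set_lebesgue_integral_def)

subsection \<open>Fourier series on the unit interval\<close>

lemma set_integrable_bdd_borel: "unit_borel A \<Longrightarrow> bdd_borel u \<Longrightarrow> set_integrable lborel A u"
  by (metis bdd_borel_measurable bdd_borel_def set_integrable_unit_borel)

lemma ee_diff: "ee (s - t) = ee s * cnj (ee t)"
  using ee_add[of s "- t"] by (simp add: ee_uminus)

definition fcoeff :: "(real \<Rightarrow> complex) \<Rightarrow> int \<Rightarrow> complex" where
  "fcoeff u k = (LINT x:{0..<1}|lborel. u x * ee (- of_int k * x))"

text \<open>Parseval for finite sums: expanding the square leaves the integrals of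
  \<open>ee ((k - l) * x)\<close>, which vanish off the diagonal.\<close>

lemma energy_trig_of_int:
  assumes F: "finite F"
  shows "energy {0..<1} (trig of_int F c) = (\<Sum>k\<in>F. (cmod (c k))\<^sup>2)"
proof -
  note i = set_integrable_bdd_borel[OF unit_borel_unit]
  note b = bdd_borel_mult bdd_borel_const bdd_borel_ee bdd_borel_sum
  have sq: "complex_of_real ((cmod (trig of_int F c x))\<^sup>2) =
    (\<Sum>k\<in>F. \<Sum>l\<in>F. c k * cnj (c l) * ee (of_int (k - l) * x))" for x
    unfolding complex_norm_square trig_def
    by (simp add: sum_product right_diff_distrib left_diff_distrib ee_diff ac_simps)
  have "complex_of_real (energy {0..<1} (trig of_int F c)) =
    (LINT x:{0..<1}|lborel. complex_of_real ((cmod (trig of_int F c x))\<^sup>2))"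
    by (simp only: energy_def set_integral_complex_of_real)
  also have "\<dots> = (\<Sum>k\<in>F. \<Sum>l\<in>F. LINT x:{0..<1}|lborel. c k * cnj (c l) * ee (of_int (k - l) * x))"
    unfolding sq
    by (subst set_integral_finite_sum(2), (rule i b; measurable)+,
        intro sum.cong refl, subst set_integral_finite_sum(2)) (rule refl | (intro i b; measurable))+
  also have "\<dots> = (\<Sum>k\<in>F. \<Sum>l\<in>F. c k * cnj (c l) * (if k - l = 0 then 1 else 0))"
    by (simp only: set_integral_mult_right integral_ee_unit)
  also have "\<dots> = (\<Sum>k\<in>F. c k * cnj (c k))"
    using F by (intro sum.cong) (simp_all add: if_distrib sum.delta cong: if_cong)
  also have "\<dots> = of_real (\<Sum>k\<in>F. (cmod (c k))\<^sup>2)"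
    by (simp add: complex_norm_square del: of_real_power)
  finally show ?thesis by (simp only: of_real_eq_iff)
qed

lemma energy_trig_of_int_le:
  assumes "finite F" "unit_borel A"
  shows "energy A (trig of_int F c) \<le> (\<Sum>k\<in>F. (cmod (c k))\<^sup>2)"
  using energy_le_unit[OF assms(2) bdd_borel_trig, of of_int F c]
  by (simp add: energy_trig_of_int[OF assms(1)])

text \<open>The energy of \<open>u\<close> minus its Fourier partial sum is nonnegative. Expanded,
  the cross term subtracts twice the coefficient sum, and the energy of the partial sum adds it
  once.\<close>

lemma bessel_inequality:
  assumes u: "bdd_borel u" and F: "finite F"
  shows "(\<Sum>k\<in>F. (cmod (fcoeff u k))\<^sup>2) \<le> energy {0..<1} u"
proof -
  note i = set_integrable_bdd_borel[OF unit_borel_unit]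
  note b = bdd_borel_mult bdd_borel_const bdd_borel_ee bdd_borel_sum u
  let ?t = "trig of_int F (fcoeff u)"
  let ?w = "\<lambda>x. \<Sum>k\<in>F. cnj (fcoeff u k) * (u x * ee (- of_int k * x))"
  have w: "?w x = u x * cnj (?t x)" for x
    by (simp add: trig_def sum_distrib_left ee_uminus ac_simps)
  have bw: "bdd_borel ?w" by (intro b; measurable)
  have pt: "(cmod (u x - ?t x))\<^sup>2 = (cmod (u x))\<^sup>2 + (cmod (?t x))\<^sup>2 - 2 * Re (?w x)" for x
    unfolding w by (simp only: cmod_power2) (simp add: power2_eq_square algebra_simps)
  have "(LINT x:{0..<1}|lborel. ?w x) = (\<Sum>k\<in>F. LINT x:{0..<1}|lborel. cnj (fcoeff u k) * (u x * ee (- of_int k * x)))"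
    by (intro set_integral_finite_sum(2)) (intro i b; measurable)
  also have "\<dots> = (\<Sum>k\<in>F. cnj (fcoeff u k) * fcoeff u k)"
    unfolding fcoeff_def by simp
  also have "\<dots> = of_real (\<Sum>k\<in>F. (cmod (fcoeff u k))\<^sup>2)"
    by (simp add: complex_norm_square mult.commute del: of_real_power)
  finally have iw: "(LINT x:{0..<1}|lborel. ?w x) = of_real (\<Sum>k\<in>F. (cmod (fcoeff u k))\<^sup>2)" .
  have Rw: "(LINT x:{0..<1}|lborel. Re (?w x)) = Re (LINT x:{0..<1}|lborel. ?w x)"
    and iRw: "set_integrable lborel {0..<1} (\<lambda>x. Re (?w x))"
  proof -
    have "integrable lborel (\<lambda>x. indicator {0..<1} x *\<^sub>R ?w x)"
      using i[OF bw] by (simp add: set_integrable_def)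
    from integral_bounded_linear[OF bounded_linear_Re this] integrable_bounded_linear[OF bounded_linear_Re this]
    show "(LINT x:{0..<1}|lborel. Re (?w x)) = Re (LINT x:{0..<1}|lborel. ?w x)"
      "set_integrable lborel {0..<1} (\<lambda>x. Re (?w x))"
      unfolding set_lebesgue_integral_def set_integrable_def by simp_all
  qed
  have "0 \<le> energy {0..<1} (\<lambda>x. u x - ?t x)" by (rule energy_nonneg)
  also have "\<dots> = (LINT x:{0..<1}|lborel. (cmod (u x))\<^sup>2 + (cmod (?t x))\<^sup>2) -
      (LINT x:{0..<1}|lborel. 2 * Re (?w x))"
    unfolding energy_def pt
    by (intro set_integral_diff(2) set_integral_add(1) set_integrable_energy unit_borel_unit u
        bdd_borel_trig set_integrable_mult_right iRw)
  also have "\<dots> = energy {0..<1} u + energy {0..<1} ?t - 2 * (\<Sum>k\<in>F. (cmod (fcoeff u k))\<^sup>2)"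
  proof -
    have "(LINT x:{0..<1}|lborel. (cmod (u x))\<^sup>2 + (cmod (?t x))\<^sup>2) =
      energy {0..<1} u + energy {0..<1} ?t"
      unfolding energy_def
      by (intro set_integral_add(2) set_integrable_energy unit_borel_unit u bdd_borel_trig)
    moreover have "(LINT x:{0..<1}|lborel. 2 * Re (?w x)) = 2 * (\<Sum>k\<in>F. (cmod (fcoeff u k))\<^sup>2)"
      by (simp only: set_integral_mult_right Rw iw Re_complex_of_real)
    ultimately show ?thesis by simp
  qed
  finally show ?thesis by (simp add: energy_trig_of_int[OF F])
qed

section \<open>Density of trigonometric polynomials\<close>

definition trig_poly :: "(real \<Rightarrow> complex) \<Rightarrow> bool" where
  "trig_poly g \<longleftrightarrow> (\<exists>F c. finite (F :: int set) \<and> g = trig of_int F c)"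

lemma trig_poly_ee: "trig_poly (\<lambda>x. a * ee (of_int k * x))"
  unfolding trig_poly_def by (intro exI[of _ "{k}"] exI[of _ "\<lambda>_. a"]) (auto simp: trig_def)

lemma trig_poly_const: "trig_poly (\<lambda>x. a)"
  using trig_poly_ee[of a 0] by simp

lemma trig_poly_add: "trig_poly f \<Longrightarrow> trig_poly g \<Longrightarrow> trig_poly (\<lambda>x. f x + g x)"
  unfolding trig_poly_def by (elim exE conjE) (simp add: trig_add, metis finite_UnI)

lemma trig_poly_sum: "(\<And>i. i \<in> F \<Longrightarrow> trig_poly (f i)) \<Longrightarrow> trig_poly (\<lambda>x. \<Sum>i\<in>F. f i x)"
  by (induction F rule: infinite_finite_induct) (auto intro: trig_poly_add trig_poly_const)

lemma trig_poly_mult: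
  assumes "trig_poly f" "trig_poly g" shows "trig_poly (\<lambda>x. f x * g x)"
proof -
  obtain F c G d where FG: "f = trig of_int (F :: int set) c" "g = trig of_int (G :: int set) d"
    using assms unfolding trig_poly_def by blast
  have "(\<lambda>x. f x * g x) = (\<lambda>x. \<Sum>k\<in>F. \<Sum>l\<in>G. (c k * d l) * ee (of_int (k + l) * x))"
    by (simp add: FG trig_def sum_product distrib_left distrib_right ee_add ac_simps)
  then show ?thesis by (simp only: trig_poly_sum trig_poly_ee)
qed

text \<open>In the induction over polynomial functions only a real-linear functional of
  \<open>ee x\<close> needs work: it combines the real and imaginary parts, hence
  \<open>ee x\<close> and \<open>ee (- x)\<close>.\<close>

lemma trig_poly_real_polynomial:
  assumes "real_polynomial_function p"
  shows "trig_poly (\<lambda>x. of_real (p (ee x)))"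
  using assms
proof (induction p rule: real_polynomial_function.induct)
  case (linear f)
  then interpret bounded_linear f .
  have f: "f z = Re z * f 1 + Im z * f \<i>" for z
  proof -
    have "z = Re z *\<^sub>R 1 + Im z *\<^sub>R \<i>"
      by (simp add: complex_eq_iff)
    then have "f z = f (Re z *\<^sub>R 1 + Im z *\<^sub>R \<i>)" by (rule arg_cong)
    then show ?thesis by (simp only: add scaleR real_scaleR_def)
  qed
  have "of_real (f (ee x)) = (of_real (f 1) / 2 + of_real (f \<i>) / (2 * \<i>)) * ee (of_int 1 * x) +
      (of_real (f 1) / 2 - of_real (f \<i>) / (2 * \<i>)) * ee (of_int (- 1) * x)" for x
    by (subst f) (simp add: ee_uminus complex_eq_iff field_simps)
  then show ?case by (simp only: trig_poly_add trig_poly_ee)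
qed (auto intro: trig_poly_const trig_poly_add trig_poly_mult)

text \<open>A continuous function with equal end values descends to the unit circle, where
  Stone-Weierstrass applies, and real polynomials on the circle pull back to trigonometric
  polynomials.\<close>

lemma continuous_trig_poly_dense:
  fixes h :: "real \<Rightarrow> complex"
  assumes h: "continuous_on {0..1} h" "h 0 = h 1" and e: "e > 0"
  obtains g where "trig_poly g" "\<And>x. x \<in> {0..1} \<Longrightarrow> cmod (h x - g x) < e"
proof -
  \<comment> \<open>The choice of preimage is harmless: only 0 and 1 are identified by
    \<open>ee\<close> on \<open>{0..1}\<close>, and \<open>h 0 = h 1\<close>.\<close>
  define H where "H z = h (SOME t. t \<in> {0..1} \<and> ee t = z)" for z
  have H: "H (ee t) = h t" if t: "t \<in> {0..1}" for t
  proof -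
    define s where "s = (SOME s. s \<in> {0..1} \<and> ee s = ee t)"
    have s: "s \<in> {0..1} \<and> ee s = ee t" unfolding s_def by (rule someI[of _ t]) (use t in auto)
    have "ee (s - t) = ee s * ee (- t)" using ee_add[of s "- t"] by simp
    also have "\<dots> = ee (t + (- t))" using s by (simp only: ee_add)
    finally have "ee (s - t) = 1" by simp
    then obtain k :: int where k: "s - t = of_int k" unfolding ee_eq_1_iff by (auto elim: Ints_cases)
    have "of_int k \<le> (1 :: real)" "- 1 \<le> (of_int k :: real)" using k s t by auto
    then have "k \<le> 1" "- 1 \<le> k" by linarith+
    then consider "k = 0" | "k = 1" | "k = - 1" by linarith
    then have "h s = h t"
    proof cases
      case 2
      then have "s = 1" "t = 0" using k s t by auto
      then show ?thesis using h by simp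
    next
      case 3
      then have "s = 0" "t = 1" using k s t by auto
      then show ?thesis using h by simp
    qed (use k in simp)
    then show ?thesis by (simp add: H_def s_def)
  qed
  have img: "ee ` {0..1} = sphere 0 1"
  proof
    show "sphere 0 1 \<subseteq> ee ` {0..1}"
    proof
      fix z :: complex assume "z \<in> sphere 0 1"
      then have "cmod z = 1" by simp
      then obtain t where t: "0 \<le> t" "t < 2 * pi" "z = Complex (cos t) (sin t)"
        by (rule complex_unimodular_polar)
      then have "z = ee (t / (2 * pi))" by (simp add: ee_def complex_eq_iff)
      moreover have "t / (2 * pi) \<in> {0..1}" using t by (auto simp: field_simps)
      ultimately show "z \<in> ee ` {0..1}" by blast
    qed
  qed (auto simp: dist_norm)
  \<comment> \<open>\<open>ee\<close> maps a compact interval onto the circle and is therefore a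
    quotient map, so continuity of \<open>H\<close> can be tested on \<open>h\<close>.\<close>
  have "continuous_on (sphere 0 1) H"
  proof (subst continuous_on_open_gen[where T=UNIV], simp, intro allI impI)
    fix U :: "complex set" assume U: "openin (top_of_set UNIV) U"
    have "openin (top_of_set {0..1}) ({0..1} \<inter> ee -` (sphere 0 1 \<inter> H -` U))"
    proof -
      have "{0..1} \<inter> ee -` (sphere 0 1 \<inter> H -` U) = {0..1} \<inter> h -` U"
        using H by (auto simp: dist_norm)
      then show ?thesis
        using h(1) U by (simp add: continuous_on_open_gen[where T=UNIV])
    qed
    then show "openin (top_of_set (sphere 0 1)) (sphere 0 1 \<inter> H -` U)"
      by (subst (asm) Abstract_Topology_2.continuous_imp_quotient_map[OF _ img])
        (auto intro!: continuous_intros)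
  qed
  then obtain p where p: "polynomial_function p" "\<forall>z\<in>sphere 0 1. norm (H z - p z) < e"
    using Stone_Weierstrass_polynomial_function[of "sphere 0 1" H e] e by auto
  have "trig_poly (\<lambda>x. of_real ((Re \<circ> p) (ee x)) + \<i> * of_real ((Im \<circ> p) (ee x)))"
    using p(1) unfolding polynomial_function_def
    by (intro trig_poly_add trig_poly_mult trig_poly_const trig_poly_real_polynomial)
      (blast intro: bounded_linear_Re bounded_linear_Im)+
  moreover have "(\<lambda>x. of_real ((Re \<circ> p) (ee x)) + \<i> * of_real ((Im \<circ> p) (ee x))) = (\<lambda>x. p (ee x))"
    by (simp add: complex_eq_iff fun_eq_iff)
  moreover have "cmod (h x - p (ee x)) < e" if "x \<in> {0..1}" for x
    using p(2) H[OF that] by (metis dist_0_norm mem_sphere norm_ee)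
  ultimately show ?thesis using that by metis
qed

lemma continuous_approximable:
  fixes h :: "real \<Rightarrow> complex"
  assumes h: "continuous_on {0..1} h" "h 0 = h 1" "bdd_borel h"
  shows "approximable {0..<1} of_int (UNIV :: int set) h"
  unfolding approximable_def
proof (intro allI impI)
  fix e :: real assume e: "e > 0"
  obtain g where g: "trig_poly g" "\<And>x. x \<in> {0..1} \<Longrightarrow> cmod (h x - g x) < sqrt (e / 2)"
    using continuous_trig_poly_dense[OF h(1,2), of "sqrt (e / 2)"] e by auto
  obtain F c where F: "finite (F :: int set)" "g = trig of_int F c" using g(1) by (auto simp: trig_poly_def)
  have "energy {0..<1} (\<lambda>x. h x - trig of_int F c x) \<le> energy {0..<1} (\<lambda>x. of_real (sqrt (e / 2)))"
    using e F g(2) by (intro energy_mono bdd_borel_diff h bdd_borel_trig bdd_borel_const unit_borel_unit)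
      (auto intro: less_imp_le)
  also have "\<dots> = e / 2" using e by (simp add: energy_def set_lebesgue_integral_def)
  finally show "\<exists>F c. finite F \<and> F \<subseteq> (UNIV :: int set) \<and> energy {0..<1} (\<lambda>x. h x - trig of_int F c x) < e"
    using e F by (intro exI[of _ F] exI[of _ c]) auto
qed

text \<open>Measurability provides continuous functions converging to \<open>u\<close> almost
  everywhere. Once made uniformly bounded and equal at the two ends, they converge in energy by
  dominated convergence and are themselves approximable uniformly.\<close>

theorem trig_dense:
  assumes u: "bdd_borel u"
  shows "approximable {0..<1} of_int (UNIV :: int set) u"
proof (rule approximable_limit[OF unit_borel_unit u])
  fix e :: real assume e: "e > 0"
  obtain B where B: "\<And>x. cmod (u x) \<le> B" "B > 0" using u bdd_borelE by metis
  note [measurable] = bdd_borel_measurable[OF u]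
  have "u \<in> borel_measurable lebesgue" by (intro measurable_completion) simp
  then have "u measurable_on UNIV" by (intro lebesgue_measurable_imp_measurable_on) auto
  then obtain Z g where Z: "negligible Z" and gc: "\<And>n. continuous_on UNIV (g n)"
    and glim: "\<And>x. x \<notin> Z \<Longrightarrow> (\<lambda>n. g n x) \<longlonglongrightarrow> u x"
    unfolding measurable_on_def by auto
  \<comment> \<open>The radial retraction onto the disc of radius \<open>B\<close>: continuous,
    bounded by \<open>B\<close>, and the identity on the values of \<open>u\<close>.\<close>
  define tr where "tr z = of_real (B / max B (cmod z)) * z" for z
  have trB: "cmod (tr z) \<le> B" for z
  proof -
    have "B * cmod z \<le> B * max B (cmod z)" using B by (intro mult_left_mono) auto
    moreover have "max B (cmod z) > 0" using B by simp
    ultimately show ?thesis unfolding tr_def norm_mult norm_of_real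
      using B by (simp add: abs_of_pos pos_divide_le_eq del: max_less_iff_conj)
  qed
  have trc: "continuous_on S (\<lambda>x. tr (f x))" if "continuous_on S f" for S :: "real set" and f
    unfolding tr_def using B that by (intro continuous_intros) auto
  have tru: "tr (u x) = u x" for x using B(1)[of x] B(2) by (simp add: tr_def max_def)
  have tr_isCont: "isCont tr z" for z
    unfolding tr_def using B by (intro continuous_intros) auto
  \<comment> \<open>The real factor vanishes at 0 and 1, which yields equal end values, and is
    eventually 1 at every interior point.\<close>
  define h where "h n x = of_real (max 0 (min 1 (real n * (x * (1 - x))))) * tr (g n x)" for n x
  have hc: "continuous_on S (h n)" for S n
    unfolding h_def using gc by (intro continuous_intros trc) (auto intro: continuous_on_subset)
  have hB: "cmod (h n x) \<le> B" for n x
    using trB[of "g n x"] mult_mono[of "max 0 (min 1 (real n * (x * (1 - x))))" 1 "cmod (tr (g n x))" B]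
    by (auto simp: h_def norm_mult)
  have hb: "bdd_borel (h n)" for n
    using hB by (intro bdd_borelI borel_measurable_continuous_onI hc)
  have hlim: "(\<lambda>n. h n x) \<longlonglongrightarrow> u x" if "x \<notin> Z" "0 < x" "x < 1" for x
  proof -
    have "(\<lambda>n. tr (g n x)) \<longlonglongrightarrow> tr (u x)"
      by (rule isCont_tendsto_compose[OF tr_isCont glim[OF that(1)]])
    moreover have "(\<lambda>n. complex_of_real (max 0 (min 1 (real n * (x * (1 - x)))))) \<longlonglongrightarrow> 1"
    proof (rule tendsto_eventually)
      obtain m where "1 / (x * (1 - x)) \<le> real m" using real_arch_simple by blast
      then have "1 \<le> real n * (x * (1 - x))" if "n \<ge> m" for n
      proof -
        have "1 / (x * (1 - x)) \<le> real n" using \<open>1 / (x * (1 - x)) \<le> real m\<close> that by linarith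
        moreover have "x * (1 - x) > 0" using \<open>0 < x\<close> \<open>x < 1\<close> by simp
        ultimately show ?thesis by (simp only: pos_divide_le_eq)
      qed
      then show "\<forall>\<^sub>F n in sequentially. complex_of_real (max 0 (min 1 (real n * (x * (1 - x))))) = 1"
        by (intro eventually_sequentiallyI[of m]) auto
    qed
    ultimately have "(\<lambda>n. h n x) \<longlonglongrightarrow> 1 * tr (u x)"
      unfolding h_def by (intro tendsto_mult)
    then show ?thesis by (simp add: tru)
  qed
  have "(\<lambda>n. energy {0..<1} (\<lambda>x. u x - h n x)) \<longlonglongrightarrow> (LINT x|(lborel :: real measure). (0 :: real))"
    unfolding energy_def set_lebesgue_integral_def
  proof (rule integral_dominated_convergence[where w="\<lambda>x :: real. indicator {0..<1} x * (2 * B)\<^sup>2"])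
    show "integrable lborel (\<lambda>x :: real. indicator {0..<1} x * (2 * B)\<^sup>2 :: real)"
    proof -
      have "set_integrable lborel {0..<1 :: real} (\<lambda>_. (2 * B)\<^sup>2)"
        by (rule set_integrable_unit_borel[OF unit_borel_unit, where B="(2 * B)\<^sup>2"]) auto
      then show ?thesis by (simp only: set_integrable_def real_scaleR_def)
    qed
    show "(\<lambda>x. indicator {0..<1} x *\<^sub>R (cmod (u x - h n x))\<^sup>2) \<in> borel_measurable lborel" for n
      using bdd_borel_measurable[OF hb[of n]] by measurable
    show "AE x in lborel. norm (indicator {0..<1} x *\<^sub>R (cmod (u x - h n x))\<^sup>2) \<le> indicator {0..<1} x * (2 * B)\<^sup>2" for n
    proof (rule AE_I2)
      fix x
      have "cmod (u x - h n x) \<le> 2 * B" using norm_triangle_ineq4[of "u x" "h n x"] B(1)[of x] hB[of n x] by linarith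
      then have "(cmod (u x - h n x))\<^sup>2 \<le> (2 * B)\<^sup>2" by (intro power_mono) auto
      then show "norm (indicator {0..<1} x *\<^sub>R (cmod (u x - h n x))\<^sup>2) \<le> indicator {0..<1} x * (2 * B)\<^sup>2"
        by (simp add: indicator_def)
    qed
    have "AE x in lebesgue. x \<notin> Z" using Z by (intro AE_not_in) (simp add: negligible_iff_null_sets)
    then have "AE x in lborel. x \<notin> Z" by (simp add: AE_completion_iff)
    then show "AE x in lborel. (\<lambda>n. indicator {0..<1} x *\<^sub>R (cmod (u x - h n x))\<^sup>2) \<longlonglongrightarrow> 0"
      using AE_lborel_singleton[of 0]
    proof eventually_elim
      case (elim x)
      show ?case
      proof (cases "x \<in> {0..<1}")
        case True
        then have "(\<lambda>n. (cmod (u x - h n x))\<^sup>2) \<longlonglongrightarrow> (cmod (u x - u x))\<^sup>2"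
          using elim by (intro tendsto_intros hlim) auto
        then show ?thesis using True by simp
      qed simp
    qed
  qed simp
  then have "(\<lambda>n. energy {0..<1} (\<lambda>x. u x - h n x)) \<longlonglongrightarrow> 0" by simp
  then have "\<forall>\<^sub>F n in sequentially. energy {0..<1} (\<lambda>x. u x - h n x) < e"
    using e by (rule order_tendstoD)
  then obtain n where "energy {0..<1} (\<lambda>x. u x - h n x) < e" by (auto simp: eventually_sequentially)
  moreover have "approximable {0..<1} of_int (UNIV :: int set) (h n)"
    by (rule continuous_approximable[OF hc _ hb]) (simp add: h_def)
  ultimately show "\<exists>v. bdd_borel v \<and> approximable {0..<1} of_int (UNIV :: int set) v \<and> energy {0..<1} (\<lambda>x. u x - v x) < e"
    using hb by blast
qed

subsection \<open>Combining Riesz bases along fibres\<close>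

text \<open>The weights are those of the divided difference at the points of \<open>Z\<close>.\<close>

lemma vandermonde_weights:
  fixes Z :: "complex set"
  assumes "finite Z" "Z \<noteq> {}"
  shows "\<exists>w. \<forall>k<card Z. (\<Sum>z\<in>Z. w z * z ^ k) = (if Suc k = card Z then 1 else 0)"
  using assms
proof (induction Z rule: finite_ne_induct)
  case (singleton a)
  then show ?case by (intro exI[of _ "\<lambda>_. 1"]) auto
next
  case (insert a Z)
  then obtain w where w: "\<And>k. k < card Z \<Longrightarrow> (\<Sum>z\<in>Z. w z * z ^ k) = (if Suc k = card Z then 1 else 0)"
    by blast
  \<comment> \<open>The weight at \<open>a\<close> makes the total weight 0, so that only
    \<open>z ^ k - a ^ k\<close> contributes; its factor \<open>z - a\<close> cancels the
    denominator and leaves moments of \<open>w\<close> of order below \<open>k\<close>.\<close>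
  define w' where "w' z = (if z = a then - (\<Sum>z\<in>Z. w z / (z - a)) else w z / (z - a))" for z
  have "(\<Sum>z\<in>insert a Z. w' z * z ^ k) = (if Suc k = card (insert a Z) then 1 else 0)"
    if k: "k < card (insert a Z)" for k
  proof -
    have "(\<Sum>z\<in>insert a Z. w' z * z ^ k) = w' a * a ^ k + (\<Sum>z\<in>Z. w z / (z - a) * z ^ k)"
    proof -
      have "(\<Sum>z\<in>Z. w' z * z ^ k) = (\<Sum>z\<in>Z. w z / (z - a) * z ^ k)"
        using insert.hyps by (intro sum.cong refl) (auto simp: w'_def)
      then show ?thesis using insert.hyps(1,3) by (subst sum.insert) auto
    qed
    also have "\<dots> = (\<Sum>z\<in>Z. w z / (z - a) * (z ^ k - a ^ k))"
      by (simp add: w'_def right_diff_distrib sum_subtractf sum_distrib_right)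
    also have "\<dots> = (\<Sum>z\<in>Z. \<Sum>i<k. a ^ (k - Suc i) * (w z * z ^ i))"
    proof (rule sum.cong[OF refl])
      fix z assume "z \<in> Z"
      then have "z - a \<noteq> 0" using insert by auto
      then show "w z / (z - a) * (z ^ k - a ^ k) = (\<Sum>i<k. a ^ (k - Suc i) * (w z * z ^ i))"
        by (simp add: power_diff_sumr2 sum_distrib_left ac_simps)
    qed
    also have "\<dots> = (\<Sum>i<k. a ^ (k - Suc i) * (\<Sum>z\<in>Z. w z * z ^ i))"
      by (subst sum.swap) (simp add: sum_distrib_left)
    also have "\<dots> = (\<Sum>i<k. a ^ (k - Suc i) * (if Suc i = card Z then 1 else 0))"
      using k insert by (intro sum.cong) (auto simp: w)
    also have "\<dots> = (\<Sum>i<k. if i = card Z - 1 then (if k = card Z then 1 else 0) else 0)"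
      using k insert card_gt_0_iff[of Z] by (intro sum.cong) auto
    also have "\<dots> = (if Suc k = card (insert a Z) then 1 else 0)"
      using k insert card_gt_0_iff[of Z] by auto
    finally show ?thesis .
  qed
  then show ?case by blast
qed

text \<open>Some monic polynomial of degree \<open>n\<close> vanishes on a set of at most
  \<open>n\<close> points, and solving it for \<open>z ^ n\<close> gives the coefficients.\<close>

lemma power_interpolation:
  fixes Z :: "complex set"
  assumes "finite Z" "card Z \<le> n"
  shows "\<exists>v. \<forall>z\<in>Z. z ^ n = (\<Sum>k<n. v k * z ^ k)"
  using assms
proof (induction Z arbitrary: n rule: finite_induct)
  case (insert a Z)
  then obtain m where n: "n = Suc m" "card Z \<le> m" by (cases n) auto
  obtain v where v: "\<And>z. z \<in> Z \<Longrightarrow> z ^ m = (\<Sum>k<m. v k * z ^ k)" using insert.IH[OF n(2)] by blast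
  \<comment> \<open>The coefficients of
    \<open>a * z ^ m + (z - a) * (\<Sum>k<m. v k * z ^ k)\<close>. This equals
    \<open>z ^ Suc m\<close> at \<open>a\<close> trivially and on \<open>Z\<close> by the choice of
    \<open>v\<close>.\<close>
  define v' where "v' k = (if k = m then a else 0) + (if k = 0 then 0 else v (k - 1)) - (if k < m then a * v k else 0)" for k
  have "z ^ n = (\<Sum>k<n. v' k * z ^ k)" if "z \<in> insert a Z" for z
  proof -
    have "(\<Sum>k<n. v' k * z ^ k) = (\<Sum>k<n. (if k = m then a else 0) * z ^ k)
      + (\<Sum>k<n. (if k = 0 then 0 else v (k - 1)) * z ^ k) - (\<Sum>k<n. (if k < m then a * v k else 0) * z ^ k)"
      by (simp add: v'_def ring_distribs sum.distrib sum_subtractf)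
    also have "(\<Sum>k<n. (if k = m then a else 0) * z ^ k) = a * z ^ m"
      by (simp add: n if_distrib[of "\<lambda>x. x * _"] cong: if_cong)
    also have "(\<Sum>k<n. (if k = 0 then 0 else v (k - 1)) * z ^ k) = z * (\<Sum>k<m. v k * z ^ k)"
      unfolding n by (subst sum.lessThan_Suc_shift) (simp add: sum_distrib_left ac_simps)
    also have "(\<Sum>k<n. (if k < m then a * v k else 0) * z ^ k) = a * (\<Sum>k<m. v k * z ^ k)"
      unfolding n by (simp add: sum_distrib_left ac_simps)
    finally have "(\<Sum>k<n. v' k * z ^ k) = a * z ^ m + (z - a) * (\<Sum>k<m. v k * z ^ k)"
      by (simp add: algebra_simps)
    moreover have "(z - a) * (\<Sum>k<m. v k * z ^ k) = (z - a) * z ^ m"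
      using that v by auto
    ultimately show ?thesis by (simp add: n algebra_simps)
  qed
  then show ?case by blast
qed auto

text \<open>More than \<open>n\<close> nodes admit weights that kill the powers below
  \<open>n\<close> and normalise the \<open>n\<close>-th, so \<open>h n\<close> is a combination of
  values at the nodes and of later coefficients. The constant must not depend on \<open>J\<close> or
  \<open>h\<close>, because the estimate will be integrated over points whose fibres meet the set in
  different ways.\<close>

lemma vandermonde_bound:
  fixes z :: "nat \<Rightarrow> complex"
  assumes inj: "inj_on z {..<N}" and z: "\<And>j. cmod (z j) = 1"
  obtains K where "K \<ge> 0" "\<And>n J h. n < N \<Longrightarrow> J \<subseteq> {..<N} \<Longrightarrow> n < card J \<Longrightarrow>
    (cmod (h n))\<^sup>2 \<le> K * ((\<Sum>j\<in>J. (cmod (\<Sum>m<N. z j ^ m * h m))\<^sup>2) + (\<Sum>m\<in>{n<..<N}. (cmod (h m))\<^sup>2))"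
proof -
  let ?P = "\<lambda>n J K. \<forall>h. (cmod (h n))\<^sup>2 \<le>
    K * ((\<Sum>j\<in>J. (cmod (\<Sum>m<N. z j ^ m * h m))\<^sup>2) + (\<Sum>m\<in>{n<..<N}. (cmod (h m))\<^sup>2))"
  have one: "\<exists>K\<ge>0. ?P n J K" if n: "n < N" and J: "J \<subseteq> {..<N}" "n < card J" for n J
  proof -
    have finJ: "finite J" using J finite_subset by blast
    \<comment> \<open>Exactly \<open>n + 1\<close> nodes are kept, so that the power normalised by
      the weights is the \<open>n\<close>-th and not a higher one.\<close>
    obtain I where I: "I \<subseteq> J" "card I = Suc n"
      using J(2) obtain_subset_with_card_n[of "Suc n" J] by auto
    have finI: "finite I" and injI: "inj_on z I"
      using I J finJ finite_subset inj inj_on_subset by (blast, meson subset_trans inj inj_on_subset)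
    have cI: "card (z ` I) = Suc n" using I injI by (simp add: card_image)
    then have "z ` I \<noteq> {}" by auto
    from vandermonde_weights[OF _ this] finI cI obtain w where
      w: "\<And>k. k \<le> n \<Longrightarrow> (\<Sum>y\<in>z ` I. w y * y ^ k) = (if k = n then 1 else 0)"
      by (auto simp: less_Suc_eq_le)
    have w: "(\<Sum>j\<in>I. w (z j) * z j ^ k) = (if k = n then 1 else 0)" if "k \<le> n" for k
      using w[OF that] injI by (simp add: sum.reindex)
    define W where "W = (\<Sum>j\<in>I. cmod (w (z j)))"
    have W: "W \<ge> 0" unfolding W_def by (intro sum_nonneg) auto
    have wW: "cmod (w (z j)) \<le> W" if "j \<in> I" for j
      unfolding W_def using that finI by (intro member_le_sum) auto
    have "(cmod (h n))\<^sup>2 \<le> (2 * real N * W\<^sup>2) * ((\<Sum>j\<in>J. (cmod (\<Sum>m<N. z j ^ m * h m))\<^sup>2) + (\<Sum>m\<in>{n<..<N}. (cmod (h m))\<^sup>2))" for h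
    proof -
      define f where "f j = (\<Sum>m<N. z j ^ m * h m)" for j
      have fs: "f j = (\<Sum>m\<le>n. z j ^ m * h m) + (\<Sum>m\<in>{n<..<N}. z j ^ m * h m)" for j
      proof -
        have "{..<N} = {..n} \<union> {n<..<N}" using n by auto
        then show ?thesis unfolding f_def by (simp add: sum.union_disjoint disjoint_iff)
      qed
      have "(\<Sum>j\<in>I. w (z j) * f j) = (\<Sum>j\<in>I. w (z j) * (\<Sum>m\<le>n. z j ^ m * h m))
          + (\<Sum>j\<in>I. w (z j) * (\<Sum>m\<in>{n<..<N}. z j ^ m * h m))"
        by (simp add: fs distrib_left sum.distrib)
      also have "(\<Sum>j\<in>I. w (z j) * (\<Sum>m\<le>n. z j ^ m * h m)) = (\<Sum>m\<le>n. (\<Sum>j\<in>I. w (z j) * z j ^ m) * h m)"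
        by (simp add: sum_distrib_left sum_distrib_right sum.swap[of _ I] ac_simps)
      also have "\<dots> = (\<Sum>m\<le>n. if m = n then h m else 0)"
        by (intro sum.cong) (auto simp: w)
      also have "\<dots> = h n" by simp
      also have "(\<Sum>j\<in>I. w (z j) * (\<Sum>m\<in>{n<..<N}. z j ^ m * h m)) = (\<Sum>m\<in>{n<..<N}. (\<Sum>j\<in>I. w (z j) * z j ^ m) * h m)"
        by (simp add: sum_distrib_left sum_distrib_right sum.swap[of _ I] ac_simps)
      finally have hn: "h n = (\<Sum>j\<in>I. w (z j) * f j) + (\<Sum>m\<in>{n<..<N}. - (\<Sum>j\<in>I. w (z j) * z j ^ m) * h m)"
        by (simp add: sum_negf)
      have c2: "cmod (\<Sum>j\<in>I. w (z j) * z j ^ m) \<le> W" for m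
        unfolding W_def by (rule order_trans[OF norm_sum]) (simp add: norm_mult norm_power z)
      have cs: "(\<Sum>i\<in>S. cmod (a i))\<^sup>2 \<le> real (card S) * (\<Sum>i\<in>S. (cmod (a i))\<^sup>2)" for S :: "nat set" and a
        using Cauchy_Schwarz_ineq_sum[of "\<lambda>_. 1" "\<lambda>i. cmod (a i)" S] by simp
      have "cmod (h n) \<le> W * (\<Sum>j\<in>I. cmod (f j)) + W * (\<Sum>m\<in>{n<..<N}. cmod (h m))"
        unfolding sum_distrib_left
        by (subst hn, intro order_trans[OF norm_triangle_ineq] add_mono order_trans[OF norm_sum] sum_mono)
          (auto simp: norm_mult intro!: mult_right_mono wW c2)
      then have "(cmod (h n))\<^sup>2 \<le> (W * (\<Sum>j\<in>I. cmod (f j)) + W * (\<Sum>m\<in>{n<..<N}. cmod (h m)))\<^sup>2"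
        by (intro power_mono) auto
      also have "\<dots> \<le> 2 * (W * (\<Sum>j\<in>I. cmod (f j)))\<^sup>2 + 2 * (W * (\<Sum>m\<in>{n<..<N}. cmod (h m)))\<^sup>2"
        using sum_squares_bound[of "W * (\<Sum>j\<in>I. cmod (f j))" "W * (\<Sum>m\<in>{n<..<N}. cmod (h m))"]
        by (simp add: power2_sum)
      also have "\<dots> = 2 * W\<^sup>2 * ((\<Sum>j\<in>I. cmod (f j))\<^sup>2 + (\<Sum>m\<in>{n<..<N}. cmod (h m))\<^sup>2)"
        by (simp add: power_mult_distrib algebra_simps)
      also have "\<dots> \<le> 2 * W\<^sup>2 * (real N * (\<Sum>j\<in>J. (cmod (f j))\<^sup>2) + real N * (\<Sum>m\<in>{n<..<N}. (cmod (h m))\<^sup>2))"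
      proof (intro mult_left_mono add_mono)
        have "real (card I) * (\<Sum>j\<in>I. (cmod (f j))\<^sup>2) \<le> real N * (\<Sum>j\<in>J. (cmod (f j))\<^sup>2)"
          using I n finJ by (intro mult_mono sum_mono2 sum_nonneg) auto
        then show "(\<Sum>j\<in>I. cmod (f j))\<^sup>2 \<le> real N * (\<Sum>j\<in>J. (cmod (f j))\<^sup>2)" using cs[of f I] by linarith
        have "real (card {n<..<N}) * (\<Sum>j\<in>{n<..<N}. (cmod (h j))\<^sup>2) \<le> real N * (\<Sum>j\<in>{n<..<N}. (cmod (h j))\<^sup>2)"
          by (intro mult_right_mono sum_nonneg) auto
        then show "(\<Sum>m\<in>{n<..<N}. cmod (h m))\<^sup>2 \<le> real N * (\<Sum>m\<in>{n<..<N}. (cmod (h m))\<^sup>2)"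
          using cs[of h "{n<..<N}"] by linarith
      qed auto
      finally show ?thesis by (simp add: f_def algebra_simps)
    qed
    then show ?thesis by (intro exI[of _ "2 * real N * W\<^sup>2"]) auto
  qed
  define K where "K n J = (SOME K. K \<ge> 0 \<and> ?P n J K)" for n J
  have K: "K n J \<ge> 0 \<and> ?P n J (K n J)" if "n < N" "J \<subseteq> {..<N}" "n < card J" for n J
    unfolding K_def by (rule someI_ex) (use one[OF that] in blast)
  \<comment> \<open>Only finitely many pairs occur, so the sum of their constants serves all of
    them.\<close>
  define T where "T = {(n, J). n < N \<and> J \<subseteq> {..<N} \<and> n < card J}"
  have "finite T" by (rule finite_subset[of _ "{..<N} \<times> Pow {..<N}"]) (auto simp: T_def)
  define M where "M = (\<Sum>(n, J)\<in>T. K n J)"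
  show ?thesis
  proof
    show "M \<ge> 0" unfolding M_def by (intro sum_nonneg) (use K in \<open>auto simp: T_def\<close>)
    fix n J and h :: "nat \<Rightarrow> complex" assume *: "n < N" "J \<subseteq> {..<N}" "n < card J"
    let ?R = "(\<Sum>j\<in>J. (cmod (\<Sum>m<N. z j ^ m * h m))\<^sup>2) + (\<Sum>m\<in>{n<..<N}. (cmod (h m))\<^sup>2)"
    have "K n J \<le> M"
      unfolding M_def using \<open>finite T\<close> * K
      by (intro member_le_sum[of "(n, J)" T "\<lambda>(n, J). K n J", simplified]) (auto simp: T_def)
    then have "K n J * ?R \<le> M * ?R" by (intro mult_right_mono add_nonneg_nonneg sum_nonneg) auto
    moreover have "(cmod (h n))\<^sup>2 \<le> K n J * ?R" using K[OF *] by blast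
    ultimately show "(cmod (h n))\<^sup>2 \<le> M * ?R" by linarith
  qed
qed

text \<open>Each \<open>e n\<close> is controlled by terms of larger index, so the induction
  descends from \<open>N\<close>, losing a factor \<open>1 + M\<close> per step.\<close>

lemma discrete_gronwall:
  fixes e :: "nat \<Rightarrow> real"
  assumes "M \<ge> 0" and "\<And>n. n < N \<Longrightarrow> e n \<le> M * (E + (\<Sum>m\<in>{n<..<N}. e m))"
  shows "n \<le> N \<Longrightarrow> E + (\<Sum>m\<in>{n..<N}. e m) \<le> (1 + M) ^ (N - n) * E"
proof (induction n rule: inc_induct)
  case (step n)
  have s: "{n<..<N} = {Suc n..<N}" by auto
  have "E + (\<Sum>m\<in>{n..<N}. e m) = e n + (E + (\<Sum>m\<in>{Suc n..<N}. e m))"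
    using step by (simp add: sum.atLeast_Suc_lessThan)
  also have "\<dots> \<le> (1 + M) * (E + (\<Sum>m\<in>{Suc n..<N}. e m))"
    using assms(2)[of n] step unfolding s by (simp add: algebra_simps)
  also have "\<dots> \<le> (1 + M) * ((1 + M) ^ (N - Suc n) * E)"
    using step assms(1) by (intro mult_left_mono) auto
  also have "\<dots> = (1 + M) ^ Suc (N - Suc n) * E" by simp
  also have "Suc (N - Suc n) = N - n" using step by simp
  finally show ?case .
qed auto

section \<open>Fibres of multiplication by N and the layers of a set\<close>

locale folding =
  fixes A :: "real set" and N :: nat
  assumes unit_borel_A: "unit_borel A" and N_pos: "N > 0"
begin

definition hits :: "real \<Rightarrow> nat set" where
  "hits x = {j. j < N \<and> (x + real j) / real N \<in> A}"

definition layer :: "nat \<Rightarrow> real set" where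
  "layer n = {x\<in>{0..<1}. n < card (hits x)}"

definition zeta :: "nat \<Rightarrow> complex" where
  "zeta j = ee (real j / real N)"

lemma hits_subset: "hits x \<subseteq> {..<N}"
  by (auto simp: hits_def)

lemma hits_eq_borel: "{x. hits x = I} \<in> sets borel"
proof (cases "I \<subseteq> {..<N}")
  case True
  note [measurable] = unit_borelD[OF unit_borel_A]
  have "{x. hits x = I} = {x. \<forall>j\<in>{..<N}. (x + real j) / real N \<in> A \<longleftrightarrow> j \<in> I}"
    using True by (auto simp: hits_def)
  also have "\<dots> \<in> sets borel" by measurable
  finally show ?thesis .
next
  case False
  then have "{x. hits x = I} = {}" using hits_subset by auto
  then show ?thesis by simp
qed

lemma unit_borel_layer: "unit_borel (layer n)"
proof -
  have "layer n = {0..<1} \<inter> (\<Union>I\<in>{I\<in>Pow {..<N}. n < card I}. {x. hits x = I})"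
    using hits_subset by (auto simp: layer_def)
  also have "\<dots> \<in> sets borel"
    by (intro sets.Int sets.finite_UN hits_eq_borel) auto
  finally show ?thesis by (auto simp: unit_borel_def layer_def)
qed

lemma unit_borel_fibre: "unit_borel {x\<in>{0..<1}. (x + real j) / real N \<in> A}"
proof -
  note [measurable] = unit_borelD[OF unit_borel_A]
  have "{x\<in>{0..<1}. (x + real j) / real N \<in> A} \<in> sets borel" by measurable
  then show ?thesis by (auto simp: unit_borel_def)
qed

text \<open>\<open>hits\<close> has finitely many values, each taken on a Borel set. Hence
  coefficients chosen arbitrarily for each possible set of fibre points still give a bounded Borel
  function of \<open>x\<close>.\<close>

lemma bdd_borel_hits: "bdd_borel (\<lambda>x. v (hits x))"
proof (rule bdd_borelI)
  have "(\<lambda>x. v (hits x)) = (\<lambda>x. \<Sum>I\<in>Pow {..<N}. if x \<in> {x. hits x = I} then v I else 0)"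
  proof
    fix x
    have "(\<Sum>I\<in>Pow {..<N}. if x \<in> {x. hits x = I} then v I else 0) = (\<Sum>I\<in>Pow {..<N}. if I = hits x then v I else 0)"
      by (intro sum.cong) auto
    then show "v (hits x) = (\<Sum>I\<in>Pow {..<N}. if x \<in> {x. hits x = I} then v I else 0)"
      using hits_subset by simp
  qed
  also have "\<dots> \<in> borel_measurable borel"
    by (intro borel_measurable_sum measurable_If_set) (use hits_eq_borel in auto)
  finally show "(\<lambda>x. v (hits x)) \<in> borel_measurable borel" .
  show "cmod (v (hits x)) \<le> (\<Sum>I\<in>Pow {..<N}. cmod (v I))" for x
    using hits_subset by (intro member_le_sum) auto
qed

lemma norm_zeta: "cmod (zeta j) = 1"
  by (simp add: zeta_def)

lemma ee_div_eq_1_iff: "ee (of_int k / real N) = 1 \<longleftrightarrow> int N dvd k"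
proof
  assume "ee (of_int k / real N) = 1"
  then obtain m :: int where "of_int k / real N = of_int m"
    unfolding ee_eq_1_iff by (auto elim: Ints_cases)
  then have "of_int k = (of_int (m * int N) :: real)" using N_pos by (simp add: field_simps)
  then show "int N dvd k" by (simp only: of_int_eq_iff) simp
next
  assume "int N dvd k"
  then obtain m where "k = int N * m" by blast
  then show "ee (of_int k / real N) = 1" using N_pos by simp
qed

lemma inj_zeta: "inj_on zeta {..<N}"
proof (rule inj_onI)
  fix i j assume ij: "i \<in> {..<N}" "j \<in> {..<N}" "zeta i = zeta j"
  have "ee (of_int (int i - int j) / real N) = zeta i * cnj (zeta j)"
    by (simp add: zeta_def diff_divide_distrib ee_diff)
  also have "\<dots> = 1" using ij by (simp add: zeta_def complex_norm_square[symmetric])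
  finally have "int N dvd int i - int j" by (simp only: ee_div_eq_1_iff)
  moreover have "\<bar>int i - int j\<bar> < int N" using ij by auto
  ultimately show "i = j" using zdvd_not_zless[of "\<bar>int i - int j\<bar>" "int N"] by force
qed

definition frequencies :: "(nat \<Rightarrow> int set) \<Rightarrow> int set" where
  "frequencies L = (\<Union>n<N. (\<lambda>l. int N * l + int n) ` L n)"

text \<open>The integer \<open>l * j\<close> drops out of the exponent, so the fibre index
  \<open>j\<close> enters only through \<open>zeta j ^ n\<close>: on a fibre, the residue class
  \<open>n\<close> contributes a single monomial in the node \<open>zeta j\<close>.\<close>

lemma ee_fibre: "ee (of_int (int N * l + int n) * ((x + real j) / real N)) =
  ee (real n * x / real N) * (zeta j ^ n * ee (of_int l * x))"
proof -
  have "of_int (int N * l + int n) * ((x + real j) / real N) =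
    real n * x / real N + (real n * (real j / real N) + (of_int l * x + of_int (l * int j)))"
    using N_pos by (simp add: field_simps)
  then show ?thesis by (simp only: ee_add ee_mult_of_nat ee_of_int zeta_def mult_1_right)
qed

lemma fibre_cases:
  assumes "t \<in> {0..<1}"
  obtains j where "j < N" "t = (frac (real N * t) + real j) / real N"
proof
  have p: "0 \<le> real N * t" using assms by simp
  have k: "real (nat \<lfloor>real N * t\<rfloor>) = of_int \<lfloor>real N * t\<rfloor>" using p by simp
  have "real N * t < real N" using assms N_pos by simp
  then show "nat \<lfloor>real N * t\<rfloor> < N" using k by linarith
  show "t = (frac (real N * t) + real (nat \<lfloor>real N * t\<rfloor>)) / real N"
    using N_pos k by (simp add: frac_def)
qed

lemma frac_fibre: "x \<in> {0..<1} \<Longrightarrow> frac (real N * ((x + real j) / real N)) = x"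
  using N_pos by (simp add: frac_eq frac_unique_iff)

text \<open>The map \<open>t \<mapsto> frac (N * t)\<close> preserves Lebesgue measure on the unit
  interval; restricting to \<open>A\<close> can only lose energy.\<close>

lemma energy_frac_le:
  assumes u: "bdd_borel u" and B: "unit_borel B"
  shows "energy A (\<lambda>t. if frac (real N * t) \<in> B then u (frac (real N * t)) else 0) \<le> energy B u"
proof -
  define w where "w x = (if x \<in> B then u x else 0)" for x
  have w: "bdd_borel w" unfolding w_def
    using unit_borelD[OF B] u by (intro bdd_borel_if bdd_borel_const)
  have wB: "energy {0..<1} w = energy B u"
    unfolding energy_def set_lebesgue_integral_def w_def using unit_borel_subset[OF B]
    by (intro Bochner_Integration.integral_cong) (auto simp: indicator_def)
  have m: "(\<lambda>t. frac (real N * t)) \<in> borel_measurable borel" unfolding frac_def by measurable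
  have "energy A (\<lambda>t. w (frac (real N * t))) \<le> energy {0..<1} (\<lambda>t. w (frac (real N * t)))"
    by (intro energy_le_unit unit_borel_A bdd_borel_compose[OF w m])
  also have "\<dots> = (\<Sum>j<N. energy {x\<in>{0..<1}. (x + real j) / real N \<in> {0..<1}}
      (\<lambda>x. w (frac (real N * ((x + real j) / real N))))) / real N"
    by (intro energy_fold unit_borel_unit bdd_borel_compose[OF w m] N_pos)
  also have "\<dots> = (\<Sum>j<N. energy {0..<1} w) / real N"
  proof (intro arg_cong[where f="\<lambda>s. s / real N"] sum.cong refl)
    fix j assume "j \<in> {..<N}"
    then have "{x\<in>{0..<1}. (x + real j) / real N \<in> {0..<1}} = {0..<1}"
    proof -
      have "(x + real j) / real N \<in> {0..<1}" if "x \<in> {0..<1}" for x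
      proof -
        have "x + real j < real N" using that \<open>j \<in> {..<N}\<close> by auto
        then show ?thesis using that N_pos by simp
      qed
      then show ?thesis by blast
    qed
    then show "energy {x\<in>{0..<1}. (x + real j) / real N \<in> {0..<1}}
      (\<lambda>x. w (frac (real N * ((x + real j) / real N)))) = energy {0..<1} w"
      by (simp only:) (rule energy_cong, simp only: frac_fibre)
  qed
  also have "\<dots> = energy B u" using N_pos wB by simp
  finally show ?thesis by (simp add: w_def)
qed

text \<open>On \<open>layer n\<close> the Vandermonde estimate bounds the part \<open>h n\<close> of
  residue \<open>n\<close> by the values of the sum at fibre points in \<open>A\<close> and by the
  parts of larger residue. The lower bound for \<open>L n\<close> carries this control from the
  layer to the whole interval, and only then can the estimates for different \<open>n\<close> be
  chained by \<open>discrete_gronwall\<close>.\<close>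

lemma lower_bound:
  assumes L: "\<And>n. n < N \<Longrightarrow> \<exists>a>0. \<forall>F c. finite F \<longrightarrow> F \<subseteq> L n \<longrightarrow>
     a * (\<Sum>k\<in>F. (cmod (c k))\<^sup>2) \<le> energy (layer n) (trig of_int F c)"
  shows "\<exists>a>0. \<forall>F c. finite F \<longrightarrow> F \<subseteq> frequencies L \<longrightarrow>
     a * (\<Sum>k\<in>F. (cmod (c k))\<^sup>2) \<le> energy A (trig of_int F c)"
proof -
  have "\<forall>n. \<exists>a. n < N \<longrightarrow> a > 0 \<and> (\<forall>F c. finite F \<longrightarrow> F \<subseteq> L n \<longrightarrow>
     a * (\<Sum>k\<in>F. (cmod (c k))\<^sup>2) \<le> energy (layer n) (trig of_int F c))"
  proof
    fix n
    show "\<exists>a. n < N \<longrightarrow> a > 0 \<and> (\<forall>F c. finite F \<longrightarrow> F \<subseteq> L n \<longrightarrow>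
     a * (\<Sum>k\<in>F. (cmod (c k))\<^sup>2) \<le> energy (layer n) (trig of_int F c))"
      using L[of n] by (cases "n < N") (simp, rule exI[of _ 0], simp)
  qed
  from choice[OF this] obtain a where "\<forall>n. n < N \<longrightarrow> a n > 0 \<and> (\<forall>F c. finite F \<longrightarrow> F \<subseteq> L n \<longrightarrow>
     a n * (\<Sum>k\<in>F. (cmod (c k))\<^sup>2) \<le> energy (layer n) (trig of_int F c))" ..
  then have a: "\<And>n. n < N \<Longrightarrow> a n > 0" and aL: "\<And>n F c. n < N \<Longrightarrow> finite F \<Longrightarrow> F \<subseteq> L n \<Longrightarrow>
     a n * (\<Sum>k\<in>F. (cmod (c k))\<^sup>2) \<le> energy (layer n) (trig of_int F c)"
    by simp_all
  obtain K where K: "K \<ge> 0" "\<And>n I h. n < N \<Longrightarrow> I \<subseteq> {..<N} \<Longrightarrow> n < card I \<Longrightarrow>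
    (cmod (h n))\<^sup>2 \<le> K * ((\<Sum>j\<in>I. (cmod (\<Sum>m<N. zeta j ^ m * h m))\<^sup>2) + (\<Sum>m\<in>{n<..<N}. (cmod (h m))\<^sup>2))"
    by (rule vandermonde_bound[OF inj_zeta norm_zeta], rule that)
  define M where "M = (\<Sum>n<N. K / a n)"
  have M0: "M \<ge> 0" unfolding M_def using a K by (intro sum_nonneg) (auto simp: less_imp_le)
  have KM: "K / a n \<le> M" if "n < N" for n
    unfolding M_def using that a K by (intro member_le_sum) (auto simp: less_imp_le)
  define D where "D = (1 + M) ^ N * real N"
  have D: "D > 0" using M0 N_pos by (simp add: D_def)
  have main: "(\<Sum>k\<in>F. (cmod (c k))\<^sup>2) \<le> D * energy A (trig of_int F c)"
    if F: "finite F" "F \<subseteq> frequencies L" for F c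
  proof -
    define G where "G n = {l\<in>L n. int N * l + int n \<in> F}" for n
    define d where "d n l = c (int N * l + int n)" for n l
    define f where "f = trig (of_int :: int \<Rightarrow> real) F c"
    \<comment> \<open>Including the phase \<open>ee (n * x / N)\<close> makes the fibre values pure
      Vandermonde sums; having modulus 1, it does not change any energy.\<close>
    define h where "h n x = ee (real n * x / real N) * trig of_int (G n) (d n) x" for n x
    have inj: "inj_on (\<lambda>l. int N * l + int n) S" for n S using N_pos by (auto simp: inj_on_def)
    have finG: "finite (G n)" for n
      by (rule finite_imageD[OF finite_subset[OF _ F(1)] inj[of n]]) (auto simp: G_def)
    have res: "m = n" if "m < N" "n < N" "int N * l + int m = int N * l' + int n" for m n l l'
    proof -
      have "(int N * l + int m) mod int N = (int N * l' + int n) mod int N" using that(3) by simp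
      then show ?thesis using that(1,2) by simp
    qed
    have Fsum: "(\<Sum>k\<in>F. \<phi> k) = (\<Sum>n<N. \<Sum>l\<in>G n. \<phi> (int N * l + int n))"
      for \<phi> :: "int \<Rightarrow> 'z::comm_monoid_add"
    proof -
      have FU: "F = (\<Union>n<N. (\<lambda>l. int N * l + int n) ` G n)"
        using F(2) unfolding frequencies_def G_def by blast
      have "(\<Sum>k\<in>F. \<phi> k) = (\<Sum>n<N. \<Sum>k\<in>(\<lambda>l. int N * l + int n) ` G n. \<phi> k)"
        by (subst FU, rule sum.UNION_disjoint) (auto simp: finG dest: res)
      then show ?thesis by (simp add: sum.reindex[OF inj] o_def)
    qed
    have bh: "bdd_borel (h n)" for n
      unfolding h_def by (intro bdd_borel_mult bdd_borel_ee bdd_borel_trig) measurable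
    have bf: "bdd_borel f" unfolding f_def by (rule bdd_borel_trig)
    have ff: "f ((x + real j) / real N) = (\<Sum>m<N. zeta j ^ m * h m x)" for x j
      unfolding f_def trig_def Fsum h_def d_def sum_distrib_left
      by (intro sum.cong refl) (subst ee_fibre, simp only: ac_simps)
    have hg: "energy S (h n) = energy S (trig of_int (G n) (d n))" for S n
      by (rule energy_cong) (simp add: h_def norm_mult)
    have he: "energy {0..<1} (h n) = (\<Sum>l\<in>G n. (cmod (d n l))\<^sup>2)" for n
      by (simp add: hg energy_trig_of_int finG)
    have step: "energy {0..<1} (h n) \<le> M * (real N * energy A f + (\<Sum>m\<in>{n<..<N}. energy {0..<1} (h m)))"
      if n: "n < N" for n
    proof -
      let ?\<Omega> = "\<lambda>j. {x\<in>{0..<1}. (x + real j) / real N \<in> A}"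
      let ?g = "\<lambda>j x. f ((x + real j) / real N)"
      have bg: "bdd_borel (?g j)" for j by (rule bdd_borel_compose[OF bf]) measurable
      have i1: "integrable lborel (\<lambda>x. indicator (?\<Omega> j) x * (cmod (?g j x))\<^sup>2)" for j
        using set_integrable_energy[OF unit_borel_fibre bg, of j j] by (simp add: set_integrable_def)
      have i2: "integrable lborel (\<lambda>x. indicator S x * (cmod (h m x))\<^sup>2)" if "unit_borel S" for m S
        using set_integrable_energy[OF that bh] by (simp add: set_integrable_def)
      have "energy (layer n) (h n) \<le> (\<integral>x. K * ((\<Sum>j<N. indicator (?\<Omega> j) x * (cmod (?g j x))\<^sup>2) +
          (\<Sum>m\<in>{n<..<N}. indicator {0..<1} x * (cmod (h m x))\<^sup>2)) \<partial>lborel)"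
        unfolding energy_def set_lebesgue_integral_def
      proof (rule integral_mono)
        show "integrable lborel (\<lambda>x. indicator (layer n) x *\<^sub>R (cmod (h n x))\<^sup>2)"
          using i2[OF unit_borel_layer] by simp
        show "integrable lborel (\<lambda>x. K * ((\<Sum>j<N. indicator (?\<Omega> j) x * (cmod (?g j x))\<^sup>2) +
          (\<Sum>m\<in>{n<..<N}. indicator {0..<1} x * (cmod (h m x))\<^sup>2)))"
          by (intro integrable_mult_right Bochner_Integration.integrable_add Bochner_Integration.integrable_sum i1 i2 unit_borel_unit)
        fix x :: real
        let ?R = "(\<Sum>j<N. indicator (?\<Omega> j) x * (cmod (?g j x))\<^sup>2) +
          (\<Sum>m\<in>{n<..<N}. indicator {0..<1} x * (cmod (h m x))\<^sup>2)"
        have R0: "?R \<ge> 0" by (intro add_nonneg_nonneg sum_nonneg) auto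
        show "indicator (layer n) x *\<^sub>R (cmod (h n x))\<^sup>2 \<le> K * ?R"
        proof (cases "x \<in> layer n")
          case True
          then have x: "x \<in> {0..<1}" "n < card (hits x)" by (auto simp: layer_def)
          have "(\<Sum>j<N. indicator (?\<Omega> j) x * (cmod (?g j x))\<^sup>2) = (\<Sum>j\<in>hits x. (cmod (\<Sum>m<N. zeta j ^ m * h m x))\<^sup>2)"
          proof (rule sum.mono_neutral_cong_right)
            show "\<forall>i\<in>{..<N} - hits x. indicator (?\<Omega> i) x * (cmod (?g i x))\<^sup>2 = 0"
              by (auto simp: hits_def)
          qed (use x hits_subset in \<open>auto simp: hits_def ff\<close>)
          then show ?thesis using K(2)[OF n hits_subset x(2), of "\<lambda>m. h m x"] x True by simp
        next
          case False
          then show ?thesis using K(1) R0 by (simp add: mult_nonneg_nonneg)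
        qed
      qed
      also have "\<dots> = K * ((\<Sum>j<N. energy (?\<Omega> j) (?g j)) + (\<Sum>m\<in>{n<..<N}. energy {0..<1} (h m)))"
        unfolding energy_def set_lebesgue_integral_def
        by (simp only: integral_mult_right_zero real_scaleR_def
            Bochner_Integration.integral_add[OF Bochner_Integration.integrable_sum[OF i1]
              Bochner_Integration.integrable_sum[OF i2[OF unit_borel_unit]]]
            Bochner_Integration.integral_sum[OF i1]
            Bochner_Integration.integral_sum[OF i2[OF unit_borel_unit]])
      also have "(\<Sum>j<N. energy (?\<Omega> j) (?g j)) = real N * energy A f"
        using energy_fold[OF unit_borel_A bf N_pos] N_pos by simp
      finally have 1: "energy (layer n) (h n) \<le> K * (real N * energy A f + (\<Sum>m\<in>{n<..<N}. energy {0..<1} (h m)))" .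
      \<comment> \<open>By Parseval the energy over the whole interval is the coefficient sum, which
        the hypothesis on \<open>L n\<close> bounds by the energy over the layer.\<close>
      have "a n * energy {0..<1} (h n) \<le> energy (layer n) (h n)"
        unfolding he unfolding hg by (rule aL[OF n finG]) (auto simp: G_def)
      with 1 have "energy {0..<1} (h n) \<le> K / a n * (real N * energy A f + (\<Sum>m\<in>{n<..<N}. energy {0..<1} (h m)))"
        using a[OF n] by (simp add: field_simps)
      also have "\<dots> \<le> M * (real N * energy A f + (\<Sum>m\<in>{n<..<N}. energy {0..<1} (h m)))"
        using KM[OF n] by (intro mult_right_mono add_nonneg_nonneg mult_nonneg_nonneg sum_nonneg energy_nonneg) auto
      finally show ?thesis .
    qed
    have "real N * energy A f + (\<Sum>m\<in>{0..<N}. energy {0..<1} (h m)) \<le> (1 + M) ^ (N - 0) * (real N * energy A f)"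
      by (rule discrete_gronwall[OF M0 step]) auto
    moreover have "(\<Sum>k\<in>F. (cmod (c k))\<^sup>2) = (\<Sum>m\<in>{0..<N}. energy {0..<1} (h m))"
      by (simp add: Fsum he d_def lessThan_atLeast0)
    moreover have "0 \<le> real N * energy A f" by (simp add: energy_nonneg)
    ultimately show ?thesis by (simp add: D_def f_def)
  qed
  show ?thesis
    using main D by (intro exI[of _ "1 / D"]) (simp add: field_simps)
qed

end

context folding
begin

lemma frac_measurable: "(\<lambda>t. frac (real N * t)) \<in> borel_measurable borel"
  unfolding frac_def by measurable

text \<open>A point outside \<open>layer n\<close> has at most \<open>n\<close> preimages in \<open>A\<close>, and there \<open>z ^ n\<close> is a combination of
  lower powers. So the last term only has to be approximated on the layer: elsewhere the error is
  absorbed into the terms with smaller index.\<close>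

lemma density_step:
  assumes L: "\<And>n u. n < N \<Longrightarrow> bdd_borel u \<Longrightarrow> approximable (layer n) of_int (L n) u"
    and n: "n \<le> N" and u: "\<And>k. bdd_borel (u k)"
  shows "approximable A of_int (frequencies L) (\<lambda>t. \<Sum>k<n. ee (real k * t) * u k (frac (real N * t)))"
  using n u
proof (induction n arbitrary: u)
  case 0
  show ?case
    using approximable_trig[of "{}" "frequencies L" A of_int "\<lambda>_. 0"] by (simp add: trig_def[abs_def])
next
  case (Suc n)
  then have n: "n < N" by simp
  note b = bdd_borel_mult bdd_borel_ee bdd_borel_add bdd_borel_diff bdd_borel_trig bdd_borel_sum bdd_borel_const
  let ?f = "\<lambda>t. \<Sum>k<Suc n. ee (real k * t) * u k (frac (real N * t))"
  have bfr: "bdd_borel (\<lambda>t. v (frac (real N * t)))" if "bdd_borel v" for v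
    by (rule bdd_borel_compose[OF that frac_measurable])
  show ?case
  proof (rule approximable_limit[OF unit_borel_A])
    show "bdd_borel ?f" by (intro b bfr Suc.prems) measurable
    fix e :: real assume e: "e > 0"
    have "approximable (layer n) of_int (L n) (u n)" by (rule L[OF n Suc.prems(2)])
    from this[unfolded approximable_def, rule_format, OF e] obtain F c where
      F: "finite F" "F \<subseteq> L n" "energy (layer n) (\<lambda>x. u n x - trig of_int F c x) < e"
      by blast
    define r where "r x = u n x - trig of_int F c x" for x
    have br: "bdd_borel r" unfolding r_def by (intro b Suc.prems)
    have "\<exists>v. \<forall>z\<in>zeta ` I. z ^ n = (\<Sum>k<n. v k * z ^ k)" if "I \<subseteq> {..<N}" "card I \<le> n" for I
      using that finite_subset[OF that(1)] card_image_le[of I zeta]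
      by (intro power_interpolation) auto
    then have "\<forall>I. \<exists>v. I \<subseteq> {..<N} \<longrightarrow> card I \<le> n \<longrightarrow> (\<forall>z\<in>zeta ` I. z ^ n = (\<Sum>k<n. v k * z ^ k))"
      by blast
    from choice[OF this] obtain v where
      v: "\<forall>I. I \<subseteq> {..<N} \<longrightarrow> card I \<le> n \<longrightarrow> (\<forall>z\<in>zeta ` I. z ^ n = (\<Sum>k<n. v I k * z ^ k))" ..
    \<comment> \<open>Off the layer, the remainder \<open>ee (n * t) * r x\<close> is expressed by
      lower powers through interpolation at the nodes of \<open>hits x\<close>. The phase with
      \<open>n - k\<close> turns \<open>ee (k * x / N)\<close> into
      \<open>ee (n * x / N)\<close>.\<close>
    define u' where "u' k x = u k x +
      (if x \<in> layer n then 0 else r x * (v (hits x) k * ee ((real n - real k) * x / real N)))" for k x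
    have bu': "bdd_borel (u' k)" for k
      unfolding u'_def
      by (intro b bdd_borel_if Suc.prems br bdd_borel_hits unit_borelD unit_borel_layer; measurable)
    define w where "w t = (\<Sum>k<n. ee (real k * t) * u' k (frac (real N * t)))" for t
    \<comment> \<open>The approximation found on the layer, lifted to the residue class
      \<open>n\<close>: the frequency \<open>l\<close> becomes \<open>N * l + n\<close>.\<close>
    define p where "p = trig of_int ((\<lambda>l. int N * l + int n) ` F) (\<lambda>k. c ((k - int n) div int N))"
    have inj: "inj_on (\<lambda>l. int N * l + int n) F" using N_pos by (auto simp: inj_on_def)
    have bw: "bdd_borel w" unfolding w_def by (intro b bfr bu') measurable
    have bp: "bdd_borel p" unfolding p_def by (rule bdd_borel_trig)
    have "approximable A of_int (frequencies L) w"
      unfolding w_def by (rule Suc.IH) (use n bu' in auto)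
    moreover have "approximable A of_int (frequencies L) p"
      unfolding p_def using F n by (intro approximable_trig) (auto simp: frequencies_def)
    ultimately have ap: "approximable A of_int (frequencies L) (\<lambda>t. w t + p t)"
      by (intro approximable_add unit_borel_A bw bp)
    have p: "p ((x + real j) / real N) = ee (real n * x / real N) * zeta j ^ n * trig of_int F c x" for x j
      unfolding p_def trig_def sum.reindex[OF inj] o_def sum_distrib_left
      using N_pos by (intro sum.cong refl) (subst ee_fibre, simp)
    have eqn: "cmod (?f t - (w t + p t)) =
      cmod (if frac (real N * t) \<in> layer n then r (frac (real N * t)) else 0)" if "t \<in> A" for t
    proof -
      have t: "t \<in> {0..<1}" using that unit_borel_subset[OF unit_borel_A] by auto
      obtain j where j: "j < N" "t = (frac (real N * t) + real j) / real N" by (rule fibre_cases[OF t])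
      define x where "x = frac (real N * t)"
      have x: "x \<in> {0..<1}" by (simp add: x_def frac_lt_1)
      have tx: "t = (x + real j) / real N" using j by (simp add: x_def)
      have ek: "ee (real k * t) = ee (real k * x / real N) * zeta j ^ k" for k
        using ee_fibre[of 0 k x j] by (simp add: tx)
      have pt: "p t = ee (real n * t) * trig of_int F c x"
        unfolding ek using p[of x j] by (simp add: tx)
      have "?f t = (\<Sum>k<n. ee (real k * t) * u k x) + ee (real n * t) * u n x" by (simp add: x_def)
      then have 1: "?f t - (w t + p t) = (\<Sum>k<n. ee (real k * t) * (u k x - u' k x)) + ee (real n * t) * r x"
        by (simp add: w_def pt r_def x_def[symmetric] right_diff_distrib sum_subtractf)
      show ?thesis
      proof (cases "x \<in> layer n")
        case True
        then show ?thesis unfolding 1 by (simp add: u'_def x_def[symmetric] norm_mult)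
      next
        case False
        have jhits: "j \<in> hits x" using that j tx by (auto simp: hits_def)
        have "card (hits x) \<le> n" using False x by (auto simp: layer_def)
        then have vI: "zeta j ^ n = (\<Sum>k<n. v (hits x) k * zeta j ^ k)" using v hits_subset jhits by blast
        have "(\<Sum>k<n. ee (real k * t) * (u k x - u' k x)) =
          - (\<Sum>k<n. r x * (ee (real n * x / real N) * (v (hits x) k * zeta j ^ k)))"
          unfolding sum_negf[symmetric]
        proof (intro sum.cong refl)
          fix k
          have "ee (real n * x / real N) = ee (real k * x / real N) * ee ((real n - real k) * x / real N)"
            unfolding ee_add[symmetric]
            by (intro arg_cong[where f=ee]) (simp add: add_divide_distrib[symmetric] left_diff_distrib)
          then show "ee (real k * t) * (u k x - u' k x) = - (r x * (ee (real n * x / real N) * (v (hits x) k * zeta j ^ k)))"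
            using False by (simp add: u'_def ek)
        qed
        also have "\<dots> = - (r x * (ee (real n * x / real N) * zeta j ^ n))"
          by (simp only: vI sum_distrib_left)
        also have "\<dots> = - (ee (real n * t) * r x)"
          by (simp only: ek, simp only: ac_simps)
        finally show ?thesis unfolding 1 using False by (simp add: x_def[symmetric])
      qed
    qed
    have "energy A (\<lambda>t. ?f t - (w t + p t)) = energy A (\<lambda>t. if frac (real N * t) \<in> layer n then r (frac (real N * t)) else 0)"
      by (rule energy_cong) (rule eqn)
    also have "\<dots> \<le> energy (layer n) r"
      by (rule energy_frac_le[OF br unit_borel_layer])
    also have "\<dots> < e" using F(3) by (simp only: r_def[abs_def])
    finally have "energy A (\<lambda>t. ?f t - (w t + p t)) < e" .
    moreover have "bdd_borel (\<lambda>t. w t + p t)" by (intro b bw bp)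
    ultimately show "\<exists>v. bdd_borel v \<and> approximable A of_int (frequencies L) v \<and> energy A (\<lambda>t. ?f t - v t) < e"
      using ap by (intro exI[of _ "\<lambda>t. w t + p t"] conjI)
  qed
qed

text \<open>Orthogonality of the characters of the cyclic group of order \<open>N\<close>: for
  distinct indices the ratio is a nontrivial \<open>N\<close>-th root of unity and its geometric sum
  vanishes.\<close>

lemma zeta_character_sum:
  assumes "i < N" "j < N"
  shows "(\<Sum>k<N. (zeta i * cnj (zeta j)) ^ k) = (if i = j then of_nat N else 0)"
proof (cases "i = j")
  case True
  then show ?thesis by (simp add: complex_norm_square[symmetric] norm_zeta)
next
  case False
  define q where "q = zeta i * cnj (zeta j)"
  have q: "q = ee (of_int (int i - int j) / real N)"
    by (simp add: q_def zeta_def diff_divide_distrib ee_diff)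
  have "q \<noteq> 1"
  proof
    assume "q = 1"
    then have "int N dvd int i - int j" unfolding q by (simp only: ee_div_eq_1_iff)
    moreover have "\<bar>int i - int j\<bar> < int N" "int i - int j \<noteq> 0" using assms False by auto
    ultimately show False using zdvd_not_zless[of "\<bar>int i - int j\<bar>" "int N"] by force
  qed
  moreover have "q ^ N = 1"
    unfolding q ee_mult_of_nat[symmetric] using N_pos ee_of_int[of "int i - int j"] by simp
  ultimately show ?thesis
    using False by (simp add: q_def[symmetric] geometric_sum)
qed

text \<open>\<open>g k\<close> collects the \<open>k\<close>-th discrete Fourier coefficient of
  \<open>u\<close> along the fibres. Fourier inversion on each fibre writes \<open>u\<close> as the
  full sum over \<open>k < N\<close>, the case \<open>n = N\<close> of
  \<open>density_step\<close>.\<close>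

lemma density:
  assumes L: "\<And>n u. n < N \<Longrightarrow> bdd_borel u \<Longrightarrow> approximable (layer n) of_int (L n) u"
    and u: "bdd_borel u"
  shows "approximable A of_int (frequencies L) u"
proof -
  define g where "g k x = (\<Sum>j<N. u ((x + real j) / real N) * ee (- real k * ((x + real j) / real N))) / of_nat N" for k x
  have g': "g k = (\<lambda>x. (\<Sum>j<N. u ((x + real j) / real N) * ee (- real k * ((x + real j) / real N))) * (1 / of_nat N))" for k
    by (simp add: g_def fun_eq_iff)
  have bg: "bdd_borel (g k)" for k
    unfolding g' by (intro bdd_borel_mult bdd_borel_sum bdd_borel_const bdd_borel_ee bdd_borel_compose[OF u]; measurable)
  have ek: "ee (real k * ((x + real j) / real N)) = ee (real k * x / real N) * zeta j ^ k" for k j x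
    using ee_fibre[of 0 k x j] by simp
  have "(\<Sum>k<N. ee (real k * t) * g k (frac (real N * t))) = u t" if t: "t \<in> A" for t
  proof -
    have t: "t \<in> {0..<1}" using that unit_borel_subset[OF unit_borel_A] by auto
    obtain i where i: "i < N" "t = (frac (real N * t) + real i) / real N" by (rule fibre_cases[OF t])
    define x where "x = frac (real N * t)"
    have tx: "t = (x + real i) / real N" using i by (simp add: x_def)
    have "ee (real k * t) * g k x = (\<Sum>j<N. u ((x + real j) / real N) * (zeta i * cnj (zeta j)) ^ k) / of_nat N" for k
    proof -
      have "ee (real k * t) * ee (- real k * ((x + real j) / real N)) = (zeta i * cnj (zeta j)) ^ k" for j
      proof -
        have "ee (- real k * ((x + real j) / real N)) = cnj (ee (real k * ((x + real j) / real N)))"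
          by (simp only: ee_uminus[symmetric] mult_minus_left)
        then have "ee (real k * t) * ee (- real k * ((x + real j) / real N)) =
          ee (real k * x / real N) * zeta i ^ k * cnj (ee (real k * x / real N) * zeta j ^ k)"
          by (simp only: tx ek)
        also have "\<dots> = (ee (real k * x / real N) * cnj (ee (real k * x / real N))) * (zeta i * cnj (zeta j)) ^ k"
          unfolding complex_cnj_mult complex_cnj_power power_mult_distrib by (simp only: ac_simps)
        also have "ee (real k * x / real N) * cnj (ee (real k * x / real N)) = 1"
          by (simp add: complex_norm_square[symmetric])
        finally show ?thesis by simp
      qed
      then show ?thesis
        unfolding g_def times_divide_eq_right sum_distrib_left
        by (simp only: mult.left_commute[of "ee (real k * t)"])
    qed
    then have "(\<Sum>k<N. ee (real k * t) * g k x) =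
      (\<Sum>k<N. \<Sum>j<N. u ((x + real j) / real N) * (zeta i * cnj (zeta j)) ^ k) / of_nat N"
      by (simp add: sum_divide_distrib)
    also have "\<dots> = (\<Sum>j<N. u ((x + real j) / real N) * (\<Sum>k<N. (zeta i * cnj (zeta j)) ^ k)) / of_nat N"
      by (subst sum.swap) (simp add: sum_distrib_left)
    also have "\<dots> = (\<Sum>j<N. if j = i then u ((x + real j) / real N) * of_nat N else 0) / of_nat N"
      using i by (intro arg_cong[where f="\<lambda>s. s / of_nat N"] sum.cong) (auto simp: zeta_character_sum)
    also have "\<dots> = u t" using i N_pos by (simp add: tx)
    finally show ?thesis by (simp add: x_def)
  qed
  then have "approximable A of_int (frequencies L) (\<lambda>t. \<Sum>k<N. ee (real k * t) * g k (frac (real N * t)))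
      \<longleftrightarrow> approximable A of_int (frequencies L) u"
    by (rule approximable_cong)
  moreover have "approximable A of_int (frequencies L) (\<lambda>t. \<Sum>k<N. ee (real k * t) * g k (frac (real N * t)))"
    by (rule density_step[OF L order_refl bg])
  ultimately show ?thesis by simp
qed

theorem int_riesz_folding:
  assumes "\<And>n. n < N \<Longrightarrow> int_riesz (layer n)"
  shows "int_riesz A"
proof -
  have "\<forall>n. \<exists>\<Lambda> :: int set. n < N \<longrightarrow> (\<forall>u. bdd_borel u \<longrightarrow> approximable (layer n) of_int \<Lambda> u) \<and>
     (\<exists>a>0. \<forall>F c. finite F \<longrightarrow> F \<subseteq> \<Lambda> \<longrightarrow>
        a * (\<Sum>k\<in>F. (cmod (c k))\<^sup>2) \<le> energy (layer n) (trig of_int F c))"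
  proof
    fix n
    show "\<exists>\<Lambda> :: int set. n < N \<longrightarrow> (\<forall>u. bdd_borel u \<longrightarrow> approximable (layer n) of_int \<Lambda> u) \<and>
     (\<exists>a>0. \<forall>F c. finite F \<longrightarrow> F \<subseteq> \<Lambda> \<longrightarrow>
        a * (\<Sum>k\<in>F. (cmod (c k))\<^sup>2) \<le> energy (layer n) (trig of_int F c))"
      using assms[of n] unfolding int_riesz_def by (cases "n < N") simp_all
  qed
  from choice[OF this] obtain L :: "nat \<Rightarrow> int set" where L: "\<forall>n. n < N \<longrightarrow> (\<forall>u. bdd_borel u \<longrightarrow> approximable (layer n) of_int (L n) u) \<and>
     (\<exists>a>0. \<forall>F c. finite F \<longrightarrow> F \<subseteq> L n \<longrightarrow>
        a * (\<Sum>k\<in>F. (cmod (c k))\<^sup>2) \<le> energy (layer n) (trig of_int F c))" ..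
  have "\<forall>u. bdd_borel u \<longrightarrow> approximable A of_int (frequencies L) u"
    by (intro allI impI density) (use L in simp)
  moreover have "\<exists>a>0. \<forall>F c. finite F \<longrightarrow> F \<subseteq> frequencies L \<longrightarrow>
        a * (\<Sum>k\<in>F. (cmod (c k))\<^sup>2) \<le> energy A (trig of_int F c)"
    by (rule lower_bound) (use L in simp)
  ultimately show ?thesis
    unfolding int_riesz_def by (intro exI[of _ "frequencies L"] conjI)
qed

end

subsection \<open>Short arcs\<close>

text \<open>Taylor expansion of \<open>ee ((\<nu> m - m) * x)\<close> turns the difference into a series of powers of \<open>x\<close> times
  trigonometric polynomials with integer frequencies, whose energies are known exactly.\<close>

lemma trig_perturbation:
  fixes \<nu> :: "int \<Rightarrow> real"
  assumes \<nu>: "\<And>m. \<bar>\<nu> m - of_int m\<bar> \<le> 1 / 40" and F: "finite F"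
  shows "energy {0..<1} (\<lambda>x. trig \<nu> F c x - trig of_int F c x) \<le> (\<Sum>m\<in>F. (cmod (c m))\<^sup>2) / 10"
proof -
  define C where "C = (\<Sum>m\<in>F. (cmod (c m))\<^sup>2)"
  define C1 where "C1 = (\<Sum>m\<in>F. cmod (c m))"
  have p25: "((1 / 5) ^ k)\<^sup>2 = (1 / 25 :: real) ^ k" for k
    by (simp add: power2_eq_square power_mult_distrib[symmetric])
  have C: "C \<ge> 0" "C1 \<ge> 0" by (auto simp: C_def C1_def intro: sum_nonneg)
  define z where "z m = \<i> * of_real (2 * pi * (\<nu> m - of_int m))" for m
  have z: "cmod (z m) \<le> 1 / 5" for m
  proof -
    have "cmod (z m) = 2 * pi * \<bar>\<nu> m - of_int m\<bar>"
      unfolding z_def norm_mult norm_of_real by (simp add: abs_mult)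
    also have "\<dots> \<le> 2 * 4 * (1 / 40)"
      using \<nu>[of m] pi_less_4 by (intro mult_mono) auto
    finally show ?thesis by simp
  qed
  \<comment> \<open>Cut off outside the unit interval, because \<open>bdd_borel\<close> asks for
    bounds on the whole line; inside it \<open>s x = x\<close>.\<close>
  define s where "s x = (if x \<in> {0..<1} then x else 0)" for x :: real
  have s: "0 \<le> s x" "s x \<le> 1" for x by (auto simp: s_def)
  have sm: "s \<in> borel_measurable borel" unfolding s_def by measurable
  have e: "exp (z m * of_real (s x)) = ee ((\<nu> m - of_int m) * s x)" for m x
    by (simp add: ee_def cis_conv_exp z_def ac_simps)
  define P where "P K m x = (\<Sum>k\<le>K. (z m * of_real (s x)) ^ k / fact k)" for K m and x :: real
  define D where "D K x = (\<Sum>m\<in>F. c m * ee (of_int m * x) * (exp (z m * of_real (s x)) - P K m x))" for K x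
  define a where "a k x = of_real (s x ^ k / fact k) * trig of_int F (\<lambda>m. c m * z m ^ k) x" for k x
  have s1: "\<bar>s x ^ k / fact k\<bar> \<le> 1" for x k
    using s(1)[of x] order_trans[OF power_le_one[OF s(1,2), of x k] fact_ge_1[of k]] by simp
  have ba: "bdd_borel (a k)" for k
    unfolding a_def
  proof (intro bdd_borel_mult bdd_borel_trig bdd_borelI)
    show "cmod (complex_of_real (s x ^ k / fact k)) \<le> 1" for x
      unfolding norm_of_real by (rule s1)
    show "(\<lambda>x. complex_of_real (s x ^ k / fact k)) \<in> borel_measurable borel"
      using sm by measurable
  qed
  have DS: "D (Suc K) x = D K x - a (Suc K) x" for K x
    unfolding D_def P_def a_def trig_def sum_distrib_left sum_subtractf[symmetric]
    by (intro sum.cong refl) (simp add: algebra_simps power_mult_distrib)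
  have bD: "bdd_borel (D K)" for K
  proof (induction K)
    case 0
    have "D 0 = (\<lambda>x. \<Sum>m\<in>F. c m * ee (of_int m * x) * (ee ((\<nu> m - of_int m) * s x) - 1))"
      unfolding D_def e by (simp add: P_def)
    then show ?case
      using sm by (simp only:) (intro bdd_borel_sum bdd_borel_mult bdd_borel_diff bdd_borel_const bdd_borel_ee; measurable)
  next
    case (Suc K)
    have "D (Suc K) = (\<lambda>x. D K x - a (Suc K) x)" by (rule ext) (rule DS)
    then show ?case by (simp only: bdd_borel_diff[OF Suc ba])
  qed
  have ea: "energy {0..<1} (a k) \<le> (1 / 25) ^ k * C" for k
  proof -
    have "energy {0..<1} (a k) \<le> energy {0..<1} (trig of_int F (\<lambda>m. c m * z m ^ k))"
    proof (rule energy_mono[OF unit_borel_unit ba bdd_borel_trig])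
      fix x
      show "cmod (a k x) \<le> cmod (trig of_int F (\<lambda>m. c m * z m ^ k) x)"
        unfolding a_def norm_mult norm_of_real using s1[of x k] by (rule mult_left_le_one_le[rotated 2]) auto
    qed
    also have "\<dots> = (\<Sum>m\<in>F. (cmod (c m * z m ^ k))\<^sup>2)" by (rule energy_trig_of_int[OF F])
    also have "\<dots> \<le> (\<Sum>m\<in>F. (1 / 25) ^ k * (cmod (c m))\<^sup>2)"
    proof (rule sum_mono)
      fix m
      have "((cmod (z m)) ^ k)\<^sup>2 \<le> ((1 / 5) ^ k)\<^sup>2" using z by (intro power_mono) auto
      also have "\<dots> = (1 / 25) ^ k" by (rule p25)
      finally show "(cmod (c m * z m ^ k))\<^sup>2 \<le> (1 / 25) ^ k * (cmod (c m))\<^sup>2"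
        by (simp add: norm_mult norm_power power_mult_distrib mult.commute mult_left_mono)
    qed
    finally show ?thesis by (simp add: C_def sum_distrib_left)
  qed
  \<comment> \<open>Peeling off one Taylor term by \<open>energy_add\<close> doubles what remains.
    Since \<open>2 * pi / 40 \<le> 1 / 5\<close>, the \<open>k\<close>-th term has energy at most
    \<open>(1 / 25) ^ k * C\<close>, so the doubled bounds \<open>(2 / 25) ^ k\<close> are still
    summable.\<close>
  have iter: "energy {0..<1} (D 0) \<le> (\<Sum>k\<in>{1..K}. (2 / 25) ^ k) * C + 2 ^ K * energy {0..<1} (D K)" for K
  proof (induction K)
    case (Suc K)
    have "D K = (\<lambda>x. a (Suc K) x + D (Suc K) x)" by (simp add: DS fun_eq_iff)
    then have "energy {0..<1} (D K) \<le> 2 * energy {0..<1} (a (Suc K)) + 2 * energy {0..<1} (D (Suc K))"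
      using energy_add[OF unit_borel_unit ba[of "Suc K"] bD[of "Suc K"]] by simp
    also have "\<dots> \<le> 2 * ((1 / 25) ^ Suc K * C) + 2 * energy {0..<1} (D (Suc K))"
      using ea[of "Suc K"] by linarith
    finally have "2 ^ K * energy {0..<1} (D K) \<le> 2 ^ K * (2 * ((1 / 25) ^ Suc K * C) + 2 * energy {0..<1} (D (Suc K)))"
      by (rule mult_left_mono) simp
    also have "\<dots> = (2 / 25) ^ Suc K * C + 2 ^ Suc K * energy {0..<1} (D (Suc K))"
      by (simp add: algebra_simps power_divide)
    finally show ?case using Suc by (simp add: distrib_right)
  qed simp
  \<comment> \<open>\<open>2 / 23\<close> is the value of the full series,
    \<open>(2 / 25) / (1 - 2 / 25)\<close>, and it is below the required
    \<open>1 / 10\<close>.\<close>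
  have geo: "(\<Sum>k\<in>{1..K}. (2 / 25 :: real) ^ k) \<le> 2 / 23" for K
  proof -
    have "(\<Sum>k\<in>{1..K}. (2 / 25 :: real) ^ k) = 2 / 23 - 2 / 23 * (2 / 25) ^ K"
    proof (induction K)
      case (Suc K)
      have "(\<Sum>k\<in>{1..Suc K}. (2 / 25 :: real) ^ k) = (\<Sum>k\<in>{1..K}. (2 / 25) ^ k) + 2 / 25 * (2 / 25) ^ K"
        by simp
      then show ?case unfolding Suc.IH power_Suc by linarith
    qed simp
    then show ?thesis by simp
  qed
  \<comment> \<open>This crude bound depends on \<open>F\<close> through \<open>C1\<close>, but
    \<open>F\<close> is fixed while \<open>K\<close> grows, and even after multiplication by
    \<open>2 ^ K\<close> it tends to 0.\<close>
  have eD: "energy {0..<1} (D K) \<le> (3 * C1)\<^sup>2 * (1 / 25) ^ K" for K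
  proof -
    have "cmod (D K x) \<le> 3 * C1 * (1 / 5) ^ K" for x
    proof -
      have "cmod (D K x) \<le> (\<Sum>m\<in>F. cmod (c m) * (3 * (1 / 5) ^ K))"
        unfolding D_def
      proof (rule sum_norm_le)
        fix m
        let ?w = "z m * of_real (s x)"
        have w: "cmod ?w \<le> 1 / 5"
          using mult_mono[OF z[of m] s(2)[of x]] s(1)[of x] by (simp add: norm_mult)
        have "cmod (exp ?w - P K m x) \<le> exp \<bar>Re ?w\<bar> * cmod ?w ^ Suc K / fact K"
          unfolding P_def by (rule Taylor_exp)
        also have "Re ?w = 0" by (simp add: z_def)
        also have "exp \<bar>0 :: real\<bar> * cmod ?w ^ Suc K / fact K \<le> cmod ?w ^ Suc K"
          using mult_left_mono[OF fact_ge_1[of K], of "cmod ?w ^ Suc K"] by (simp add: divide_le_eq)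
        also have "\<dots> \<le> (1 / 5) ^ Suc K" using w by (intro power_mono) auto
        also have "\<dots> \<le> 3 * (1 / 5) ^ K" by simp
        finally show "cmod (c m * ee (of_int m * x) * (exp ?w - P K m x)) \<le> cmod (c m) * (3 * (1 / 5) ^ K)"
          by (simp add: norm_mult mult_left_mono)
      qed
      then show ?thesis by (simp add: C1_def sum_distrib_right sum_distrib_left ac_simps)
    qed
    then have "energy {0..<1} (D K) \<le> energy {0..<1} (\<lambda>x. of_real (3 * C1 * (1 / 5) ^ K))"
      using C by (intro energy_mono unit_borel_unit bD bdd_borel_const) (simp only: norm_of_real, simp)
    also have "\<dots> = (3 * C1 * (1 / 5) ^ K)\<^sup>2"
      unfolding energy_def set_lebesgue_integral_def norm_of_real by simp
    also have "\<dots> = (3 * C1)\<^sup>2 * (1 / 25) ^ K"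
      by (simp only: power_mult_distrib p25)
    finally show ?thesis .
  qed
  have bound: "energy {0..<1} (D 0) \<le> 2 / 23 * C + (3 * C1)\<^sup>2 * (2 / 25) ^ K" for K
  proof -
    have "(\<Sum>k\<in>{1..K}. (2 / 25) ^ k) * C \<le> 2 / 23 * C" by (rule mult_right_mono[OF geo C(1)])
    moreover have "2 ^ K * energy {0..<1} (D K) \<le> 2 ^ K * ((3 * C1)\<^sup>2 * (1 / 25) ^ K)"
      using eD by (intro mult_left_mono) auto
    moreover have "2 ^ K * ((3 * C1)\<^sup>2 * (1 / 25) ^ K) = (3 * C1)\<^sup>2 * (2 / 25) ^ K"
      by (simp add: power_divide)
    ultimately show ?thesis using iter[of K] by linarith
  qed
  have "(\<lambda>K. 2 / 23 * C + (3 * C1)\<^sup>2 * (2 / 25) ^ K) \<longlonglongrightarrow> 2 / 23 * C + (3 * C1)\<^sup>2 * 0"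
    by (intro tendsto_intros LIMSEQ_power_zero) simp
  then have "energy {0..<1} (D 0) \<le> 2 / 23 * C + (3 * C1)\<^sup>2 * 0"
    by (rule LIMSEQ_le_const) (use bound in auto)
  also have "\<dots> \<le> C / 10" using C by simp
  also have "energy {0..<1} (D 0) = energy {0..<1} (\<lambda>x. trig \<nu> F c x - trig of_int F c x)"
  proof (rule energy_cong)
    fix x :: real assume x: "x \<in> {0..<1}"
    have "ee (of_int m * x) * (ee ((\<nu> m - of_int m) * x) - 1) = ee (\<nu> m * x) - ee (of_int m * x)" for m
      by (simp add: right_diff_distrib ee_add[symmetric]) (simp add: algebra_simps)
    then show "cmod (D 0 x) = cmod (trig \<nu> F c x - trig of_int F c x)"
      using x unfolding D_def e by (simp add: P_def s_def trig_def sum_subtractf[symmetric] right_diff_distrib[symmetric] mult.assoc)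
  qed
  finally show ?thesis by (simp add: C_def)
qed

text \<open>With \<open>C\<close> the coefficient sum and \<open>E\<close> the perturbed energy,
  Parseval and \<open>trig_perturbation\<close> give \<open>C \<le> 2 * C / 10 + 2 * E\<close>, that
  is \<open>E \<ge> 2 * C / 5\<close>.\<close>

lemma perturbed_trig_lower:
  fixes \<nu> :: "int \<Rightarrow> real"
  assumes \<nu>: "\<And>m. \<bar>\<nu> m - of_int m\<bar> \<le> 1 / 40" and F: "finite F"
  shows "(\<Sum>m\<in>F. (cmod (c m))\<^sup>2) / 4 \<le> energy {0..<1} (trig \<nu> F c)"
proof -
  have "energy {0..<1} (\<lambda>x. - (trig \<nu> F c x - trig of_int F c x) + trig \<nu> F c x) \<le>
    2 * energy {0..<1} (\<lambda>x. - (trig \<nu> F c x - trig of_int F c x)) + 2 * energy {0..<1} (trig \<nu> F c)"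
    using bdd_borel_mult[OF bdd_borel_const[of "-1"] bdd_borel_diff[OF bdd_borel_trig bdd_borel_trig]]
    by (intro energy_add unit_borel_unit bdd_borel_trig) simp
  moreover have "energy {0..<1} (\<lambda>x. - (trig \<nu> F c x - trig of_int F c x)) =
    energy {0..<1} (\<lambda>x. trig \<nu> F c x - trig of_int F c x)"
    by (rule energy_cong) (rule norm_minus_cancel)
  moreover have "energy {0..<1} (\<lambda>x. - (trig \<nu> F c x - trig of_int F c x) + trig \<nu> F c x) = energy {0..<1} (trig of_int F c)"
    by (rule energy_cong) simp
  ultimately show ?thesis
    using trig_perturbation[OF \<nu> F, of c] energy_trig_of_int[OF F, of c]
      sum_nonneg[of F "\<lambda>m. (cmod (c m))\<^sup>2"] by simp
qed

text \<open>Approximate with integer frequencies, then replace these by the perturbed ones: at most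
  half of the energy bound is left. Repeating this on the remainder gives geometric decay, as in a
  Neumann series.\<close>

lemma perturbed_trig_dense:
  fixes \<nu> :: "int \<Rightarrow> real"
  assumes \<nu>: "\<And>m. \<bar>\<nu> m - of_int m\<bar> \<le> 1 / 40" and u: "bdd_borel u"
  shows "approximable {0..<1} \<nu> UNIV u"
proof -
  \<comment> \<open>With tolerance \<open>B / 24\<close> the coefficient sum is at most
    \<open>25 * B / 12\<close>, and the final error is at most
    \<open>2 * (B / 24) + 2 * (25 * B / 12) / 10 = B / 2\<close>.\<close>
  have half: "\<exists>F c. finite F \<and> energy {0..<1} (\<lambda>x. v x - trig \<nu> F c x) \<le> B / 2"
    if v: "bdd_borel v" "energy {0..<1} v \<le> B" and B: "B > 0" for v B
  proof -
    have "approximable {0..<1} of_int (UNIV :: int set) v" by (rule trig_dense[OF v(1)])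
    moreover have "B / 24 > 0" using B by simp
    ultimately obtain F c where F: "finite (F :: int set)" "energy {0..<1} (\<lambda>x. v x - trig of_int F c x) < B / 24"
      unfolding approximable_def by blast
    let ?p = "trig (of_int :: int \<Rightarrow> real) F c"
    let ?q = "trig \<nu> F c"
    note b = bdd_borel_diff bdd_borel_trig v(1)
    have n: "energy {0..<1} (\<lambda>x. f x - g x) = energy {0..<1} (\<lambda>x. g x - f x)" for f g
      by (rule energy_cong) (rule norm_minus_commute)
    have "energy {0..<1} (\<lambda>x. v x + (?p x - v x)) \<le> 2 * energy {0..<1} v + 2 * energy {0..<1} (\<lambda>x. ?p x - v x)"
      by (intro energy_add unit_borel_unit b)
    then have p: "(\<Sum>m\<in>F. (cmod (c m))\<^sup>2) \<le> 2 * B + 2 * (B / 24)"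
      using v(2) F n[of ?p v] by (simp add: energy_trig_of_int)
    have "energy {0..<1} (\<lambda>x. (v x - ?p x) + (?p x - ?q x)) \<le>
      2 * energy {0..<1} (\<lambda>x. v x - ?p x) + 2 * energy {0..<1} (\<lambda>x. ?p x - ?q x)"
      by (intro energy_add unit_borel_unit b)
    also have "\<dots> \<le> B / 2"
      using p F(2) n[of ?p ?q] trig_perturbation[OF \<nu> F(1), of c] B by simp
    finally show ?thesis using F(1) by (intro exI[of _ F] exI[of _ c]) simp
  qed
  define B where "B = energy {0..<1} u + 1"
  have B: "B > 0" using energy_nonneg[of "{0..<1}" u] by (simp add: B_def)
  have iter: "\<exists>F c. finite F \<and> energy {0..<1} (\<lambda>x. u x - trig \<nu> F c x) \<le> B / 2 ^ n" for n
  proof (induction n)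
    case 0
    show ?case by (intro exI[of _ "{}"] exI) (simp add: trig_def B_def)
  next
    case (Suc n)
    then obtain F c where F: "finite F" "energy {0..<1} (\<lambda>x. u x - trig \<nu> F c x) \<le> B / 2 ^ n" by blast
    have "bdd_borel (\<lambda>x. u x - trig \<nu> F c x)" by (intro bdd_borel_diff u bdd_borel_trig)
    from half[OF this F(2)] obtain G d where
      G: "finite G" "energy {0..<1} (\<lambda>x. u x - trig \<nu> F c x - trig \<nu> G d x) \<le> B / 2 ^ n / 2"
      using B by auto
    define h where "h i = (if i \<in> F then c i else 0) + (if i \<in> G then d i else 0)" for i
    have h: "u x - trig \<nu> F c x - trig \<nu> G d x = u x - trig \<nu> (F \<union> G) h x" for x
      unfolding diff_diff_eq h_def trig_add[OF F(1) G(1)] ..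
    have "energy {0..<1} (\<lambda>x. u x - trig \<nu> (F \<union> G) h x) \<le> B / 2 ^ Suc n"
      using G(2) unfolding h by (simp add: mult.commute)
    then show ?case using F(1) G(1) by (intro exI[of _ "F \<union> G"] exI[of _ h]) simp
  qed
  show ?thesis unfolding approximable_def
  proof (intro allI impI)
    fix e :: real assume e: "e > 0"
    obtain n where "B / e < 2 ^ n" using real_arch_pow[of 2 "B / e"] by auto
    then have "B / 2 ^ n < e" using e by (simp add: field_simps)
    with iter[of n] show "\<exists>F c. finite F \<and> F \<subseteq> UNIV \<and> energy {0..<1} (\<lambda>x. u x - trig \<nu> F c x) < e"
      by (meson le_less_trans subset_UNIV)
  qed
qed

text \<open>Rescaling the arc to the unit interval multiplies frequencies by \<open>c\<close>, so
  rounding \<open>m / c\<close> to an integer displaces the rescaled frequency from \<open>m\<close>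
  by at most \<open>c / 2\<close>. The restriction \<open>c \<le> 1 / 20\<close> makes this the
  \<open>1 / 40\<close> of \<open>trig_perturbation\<close>.\<close>

theorem int_riesz_arc:
  assumes c: "0 < c" "c \<le> 1 / 20"
  shows "int_riesz {x\<in>{0..<1}. frac (x - v) < c}"
proof -
  define A where "A = {x\<in>{0..<1}. frac (x - v) < c}"
  define \<kappa> where "\<kappa> m = round (of_int m / c)" for m :: int
  define \<nu> where "\<nu> m = of_int (\<kappa> m) * c" for m
  have \<nu>: "\<bar>\<nu> m - of_int m\<bar> \<le> 1 / 40" for m
  proof -
    have "\<bar>of_int (\<kappa> m) - of_int m / c\<bar> \<le> 1 / 2"
      unfolding \<kappa>_def by (rule of_int_round_abs_le)
    then have "\<bar>of_int (\<kappa> m) - of_int m / c\<bar> * c \<le> 1 / 2 * (1 / 20)"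
      using c by (intro mult_mono) auto
    also have "\<bar>of_int (\<kappa> m) - of_int m / c\<bar> * c = \<bar>(of_int (\<kappa> m) - of_int m / c) * c\<bar>"
      using c by (simp add: abs_mult)
    also have "(of_int (\<kappa> m) - of_int m / c) * c = \<nu> m - of_int m"
      using c by (simp add: \<nu>_def left_diff_distrib)
    finally show ?thesis by simp
  qed
  have inj: "inj \<kappa>"
  proof (rule injI)
    fix m n assume "\<kappa> m = \<kappa> n"
    then have "\<nu> m = \<nu> n" by (simp add: \<nu>_def)
    then have "\<bar>of_int m - of_int n\<bar> < (1 :: real)" using \<nu>[of m] \<nu>[of n] by linarith
    then show "m = n" by linarith
  qed
  have fr: "ee (of_int k * frac (c * s + v)) = ee (of_int k * v) * ee (of_int k * c * s)" for k s
  proof -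
    have "of_int k * frac (c * s + v) = of_int k * v + of_int k * c * s + of_int (- k * \<lfloor>c * s + v\<rfloor>)"
      by (simp add: frac_def algebra_simps)
    then show ?thesis by (simp only: ee_add ee_of_int mult_1_right)
  qed
  have arc: "energy A u = c * energy {0..<1} (\<lambda>s. u (frac (c * s + v)))" if "bdd_borel u" for u
    unfolding A_def by (rule energy_arc[OF that]) (use c in auto)
  have trigk: "trig of_int (\<kappa> ` F) d (frac (c * s + v)) = trig \<nu> F (\<lambda>m. d (\<kappa> m) * ee (of_int (\<kappa> m) * v)) s" for F d s
    unfolding trig_def sum.reindex[OF inj_on_subset[OF inj subset_UNIV]] o_def fr \<nu>_def
    by (simp only: ac_simps)
  have "approximable A of_int (range \<kappa>) u" if u: "bdd_borel u" for u
    unfolding approximable_def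
  proof (intro allI impI)
    fix e :: real assume e: "e > 0"
    have "bdd_borel (\<lambda>s. u (frac (c * s + v)))"
      by (rule bdd_borel_compose[OF u]) (unfold frac_def, measurable)
    then have "approximable {0..<1} \<nu> UNIV (\<lambda>s. u (frac (c * s + v)))" by (rule perturbed_trig_dense[OF \<nu>])
    moreover have "e / c > 0" using e c by simp
    ultimately obtain F d where F: "finite F" "energy {0..<1} (\<lambda>s. u (frac (c * s + v)) - trig \<nu> F d s) < e / c"
      unfolding approximable_def by blast
    \<comment> \<open>Removes the phase \<open>ee (k * v)\<close> that the rotation of the arc
      attaches to the frequency \<open>k\<close>.\<close>
    define d' where "d' k = d (inv \<kappa> k) * ee (- of_int k * v)" for k
    have "(\<lambda>m. d' (\<kappa> m) * ee (of_int (\<kappa> m) * v)) = d"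
      by (simp add: d'_def inv_f_f[OF inj] mult.assoc ee_add[symmetric] fun_eq_iff)
    then have "energy A (\<lambda>x. u x - trig of_int (\<kappa> ` F) d' x) = c * energy {0..<1} (\<lambda>s. u (frac (c * s + v)) - trig \<nu> F d s)"
      by (subst arc) (simp_all only: trigk bdd_borel_diff[OF u bdd_borel_trig])
    also have "\<dots> < e" using F(2) c by (simp add: field_simps)
    finally show "\<exists>F d. finite F \<and> F \<subseteq> range \<kappa> \<and> energy A (\<lambda>x. u x - trig of_int F d x) < e"
      using F(1) by (intro exI[of _ "\<kappa> ` F"] exI[of _ d']) auto
  qed
  moreover have "c / 4 * (\<Sum>k\<in>F. (cmod (d k))\<^sup>2) \<le> energy A (trig of_int F d)"
    if F: "finite F" "F \<subseteq> range \<kappa>" for F d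
  proof -
    obtain G where G: "F = \<kappa> ` G" using F(2) by (auto simp: subset_image_iff)
    then have finG: "finite G" using F(1) inj by (metis finite_imageD inj_on_subset subset_UNIV)
    have "(\<Sum>k\<in>F. (cmod (d k))\<^sup>2) = (\<Sum>m\<in>G. (cmod (d (\<kappa> m) * ee (of_int (\<kappa> m) * v)))\<^sup>2)"
      unfolding G sum.reindex[OF inj_on_subset[OF inj subset_UNIV]] by (simp add: norm_mult)
    moreover have "energy A (trig of_int F d) = c * energy {0..<1} (trig \<nu> G (\<lambda>m. d (\<kappa> m) * ee (of_int (\<kappa> m) * v)))"
      unfolding G by (subst arc[OF bdd_borel_trig]) (simp only: trigk)
    ultimately show ?thesis
      using perturbed_trig_lower[OF \<nu> finG, of "\<lambda>m. d (\<kappa> m) * ee (of_int (\<kappa> m) * v)"] c by simp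
  qed
  ultimately show ?thesis
    unfolding int_riesz_def A_def[symmetric] using c
    by (intro exI[of _ "range \<kappa>"] conjI exI[of _ "c / 4"]) auto
qed

lemma int_riesz_empty: "int_riesz {}"
proof -
  have "energy {} u = 0" for u by (simp add: energy_def set_lebesgue_integral_def)
  then show ?thesis unfolding int_riesz_def approximable_def
    by (intro exI[of _ "{}"] conjI exI[of _ 1]) (auto intro!: exI[of _ "{}"])
qed

lemma int_riesz_unit: "int_riesz {0..<1}"
  unfolding int_riesz_def
  by (intro exI[of _ UNIV] conjI exI[of _ 1]) (auto simp: trig_dense energy_trig_of_int)

subsection \<open>Step functions\<close>

text \<open>With floors in place of indicators of arcs, equally many jumps of both kinds make the
  function 1-periodic on the whole line, folding acts on the jump points alone, and arcs that wrap
  around need no separate treatment.\<close>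

definition step_fun :: "int \<Rightarrow> real set \<Rightarrow> real set \<Rightarrow> real \<Rightarrow> int" where
  "step_fun C U D x = C + (\<Sum>u\<in>U. \<lfloor>x - u\<rfloor>) - (\<Sum>d\<in>D. \<lfloor>x - d\<rfloor>)"

text \<open>Irrational differences imply that no two jumps coincide modulo 1 and, unlike that weaker
  property, persist under multiplication by every positive \<open>N\<close>.\<close>

definition generic :: "real set \<Rightarrow> real set \<Rightarrow> bool" where
  "generic U D \<longleftrightarrow> finite U \<and> finite D \<and> U \<inter> D = {} \<and> card U = card D \<and>
     (\<forall>p\<in>U \<union> D. \<forall>q\<in>U \<union> D. p \<noteq> q \<longrightarrow> p - q \<notin> \<rat>)"

lemma generic_irrational:
  assumes "generic U D" "p \<in> U \<union> D" "q \<in> U \<union> D" "p \<noteq> q"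
  shows "p - q \<notin> \<rat>"
proof -
  have "\<forall>p\<in>U \<union> D. \<forall>q\<in>U \<union> D. p \<noteq> q \<longrightarrow> p - q \<notin> \<rat>"
    using assms(1) unfolding generic_def by (elim conjE)
  then show ?thesis using assms(2-4) by simp
qed

text \<open>Raising \<open>m\<close> by 1 shifts the window of summation: the term
  \<open>m div N\<close> leaves and \<open>(m + N) div N\<close>, larger by one, enters.\<close>

lemma sum_int_div:
  assumes "N > 0" shows "(\<Sum>j<N. (m + int j) div int N) = m"
proof -
  have shift: "(\<Sum>j<N. (k + 1 + int j) div int N) = (\<Sum>j<N. (k + int j) div int N) + 1" for k
  proof -
    have "(\<Sum>j<Suc N. (k + int j) div int N) = k div int N + (\<Sum>j<N. (k + 1 + int j) div int N)"
      by (subst sum.lessThan_Suc_shift) (simp add: ac_simps)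
    moreover have "(k + int N) div int N = k div int N + 1" using assms by simp
    ultimately show ?thesis by simp
  qed
  show ?thesis
  proof (induction m rule: int_induct[where k=0])
    case base
    show ?case by (rule sum.neutral) auto
  next
    case (step1 i)
    then show ?case using shift[of i] by simp
  next
    case (step2 i)
    then show ?case using shift[of "i - 1"] by simp
  qed
qed

text \<open>Hermite's identity, obtained by turning the floors into integer divisions. It is the
  reason why folding multiplies every jump point by \<open>N\<close>.\<close>

lemma hermite_floor_sum:
  assumes "N > 0" shows "(\<Sum>j<N. \<lfloor>(x + real j) / real N - u\<rfloor>) = \<lfloor>x - real N * u\<rfloor>"
proof -
  have "\<lfloor>(x + real j) / real N - u\<rfloor> = (\<lfloor>x - real N * u\<rfloor> + int j) div int N" for j
  proof -
    have "(x + real j) / real N - u = (x - real N * u + of_int (int j)) / of_int (int N)"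
      using assms by (simp add: field_simps)
    then show ?thesis
      by (simp only: floor_divide_real_eq_div[OF of_nat_0_le_iff] floor_add_int[symmetric])
  qed
  then show ?thesis by (simp add: sum_int_div[OF assms])
qed

lemma step_fun_fold:
  assumes N: "N > 0"
  shows "(\<Sum>j<N. step_fun C U D ((x + real j) / real N)) =
    step_fun (int N * C) ((*) (real N) ` U) ((*) (real N) ` D) x"
proof -
  have inj: "inj_on ((*) (real N)) S" for S using N by (auto simp: inj_on_def)
  have "(\<Sum>j<N. \<Sum>u\<in>S. \<lfloor>(x + real j) / real N - u\<rfloor>) = (\<Sum>u\<in>(*) (real N) ` S. \<lfloor>x - u\<rfloor>)" for S
    by (subst sum.swap) (simp add: sum.reindex[OF inj] hermite_floor_sum[OF N])
  then show ?thesis by (simp add: step_fun_def sum.distrib sum_subtractf)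
qed

lemma generic_scale:
  assumes "generic U D" "N > 0"
  shows "generic ((*) (real N) ` U) ((*) (real N) ` D)"
proof -
  have inj: "inj_on ((*) (real N)) S" for S using assms by (auto simp: inj_on_def)
  have "real N * p - real N * q \<notin> \<rat>" if "p - q \<notin> \<rat>" for p q
  proof
    assume "real N * p - real N * q \<in> \<rat>"
    then have "(real N * p - real N * q) / real N \<in> \<rat>" by (intro Rats_divide) auto
    then show False using that assms(2) by (simp add: diff_divide_distrib)
  qed
  moreover have "(*) (real N) ` U \<inter> (*) (real N) ` D = {}"
    using assms unfolding generic_def by auto
  ultimately show ?thesis
    using assms unfolding generic_def by (auto simp: card_image[OF inj])
qed

lemma step_fun_period:
  assumes "finite U" "finite D"
  shows "step_fun C U D (x + of_int k) = step_fun C U D x + k * (int (card U) - int (card D))"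
proof -
  have "\<lfloor>x + of_int k - u\<rfloor> = \<lfloor>x - u\<rfloor> + k" for u
    using floor_add_int[of "x - u" k] by (simp add: algebra_simps)
  then show ?thesis by (simp add: step_fun_def sum.distrib algebra_simps)
qed

text \<open>The floor is right-continuous and locally constant, except that it drops by one
  immediately to the left of a point congruent to \<open>u\<close> modulo 1.\<close>

lemma floor_near:
  fixes x u :: real
  shows "\<forall>\<^sub>F y in at x. \<lfloor>y - u\<rfloor> = \<lfloor>x - u\<rfloor> - (if y < x \<and> x - u \<in> \<int> then 1 else 0)"
proof -
  define f where "f = \<lfloor>x - u\<rfloor>"
  have f: "of_int f \<le> x - u" "x - u < of_int f + 1" unfolding f_def by linarith+
  have lim: "((\<lambda>y. y) \<longlongrightarrow> x) (at x)" by (rule tendsto_ident_at)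
  have 1: "\<forall>\<^sub>F y in at x. y < u + of_int f + 1" by (rule order_tendstoD(2)[OF lim]) (use f in linarith)
  have 2: "\<forall>\<^sub>F y in at x. u + of_int f - 1 < y" by (rule order_tendstoD(1)[OF lim]) (use f in linarith)
  have 3: "\<forall>\<^sub>F y in at x. x - u \<notin> \<int> \<longrightarrow> u + of_int f < y"
  proof (cases "x - u \<in> \<int>")
    case False
    then have "x - u \<noteq> of_int f" by auto
    then have "u + of_int f < x" using f by linarith
    from order_tendstoD(1)[OF lim this] show ?thesis by simp
  qed simp
  from 1 2 3 show ?thesis
  proof eventually_elim
    case (elim y)
    show ?case
    proof (cases "y < x \<and> x - u \<in> \<int>")
      case True
      then have "x - u = of_int f" unfolding f_def by (auto elim!: Ints_cases)
      then have "\<lfloor>y - u\<rfloor> = f - 1" using elim True by (intro floor_unique) auto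
      then show ?thesis using True by (simp add: f_def)
    next
      case False
      have "of_int f \<le> y - u" using False elim f by fastforce
      then have "\<lfloor>y - u\<rfloor> = f" using elim by (intro floor_unique) auto
      then show ?thesis using False by (auto simp: f_def)
    qed
  qed
qed

text \<open>Both sides differ by a locally constant function: by genericity at most one jump occurs at a
  point, and it crosses the level \<open>n\<close> upwards iff the new value is \<open>n\<close>, downwards iff it is \<open>n - 1\<close>.\<close>

lemma step_fun_superlevel:
  fixes C n :: int
  assumes g: "generic U D"
  defines "f \<equiv> step_fun C U D"
  obtains C' where "\<And>x. (if n \<le> f x then 1 else 0) = step_fun C' {u\<in>U. f u = n} {d\<in>D. f d = n - 1} x"
    and "generic {u\<in>U. f u = n} {d\<in>D. f d = n - 1}"
proof -
  define U' where "U' = {u\<in>U. f u = n}"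
  define D' where "D' = {d\<in>D. f d = n - 1}"
  have fin: "finite U" "finite D" "finite U'" "finite D'" using g by (auto simp: generic_def U'_def D'_def)
  have sub: "U' \<subseteq> U" "D' \<subseteq> D" by (auto simp: U'_def D'_def)
  have irr: "p - q \<notin> \<rat>" if "p \<in> U \<union> D" "q \<in> U \<union> D" "p \<noteq> q" for p q
    by (rule generic_irrational[OF g that])
  define \<psi> :: "real \<Rightarrow> int" where "\<psi> x = (if n \<le> f x then 1 else 0)" for x
  define h where "h x = \<psi> x - step_fun 0 U' D' x" for x
  define s :: "real \<Rightarrow> real \<Rightarrow> int" where "s x u = (if x - u \<in> \<int> then 1 else 0)" for x u
  have per: "f (x + of_int k) = f x" for x k
    unfolding f_def using step_fun_period[OF fin(1,2)] g by (simp add: generic_def)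
  have local: "\<forall>\<^sub>F y in at x. h x = h y" for x
  proof -
    have "\<forall>\<^sub>F y in at x. \<forall>u\<in>U \<union> D. \<lfloor>y - u\<rfloor> = \<lfloor>x - u\<rfloor> - (if y < x \<and> x - u \<in> \<int> then 1 else 0)"
      using fin by (intro eventually_ball_finite ballI floor_near) auto
    then show ?thesis
    proof eventually_elim
      case (elim y)
      show ?case
      proof (cases "y < x")
        case False
        then have fl: "\<lfloor>y - u\<rfloor> = \<lfloor>x - u\<rfloor>" if "u \<in> U \<union> D" for u using elim that by simp
        have "step_fun c V W y = step_fun c V W x" if "V \<subseteq> U" "W \<subseteq> D" for c V W
          unfolding step_fun_def using that fl by (intro arg_cong2[where f="(-)"] arg_cong2[where f="(+)"] sum.cong) auto
        then show ?thesis using sub by (simp add: h_def \<psi>_def f_def)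
      next
        case True
        then have fl: "\<lfloor>y - u\<rfloor> = \<lfloor>x - u\<rfloor> - s x u" if "u \<in> U \<union> D" for u using elim that by (simp add: s_def)
        have st: "step_fun c V W y = step_fun c V W x - sum (s x) V + sum (s x) W" if "V \<subseteq> U" "W \<subseteq> D" for c V W
        proof -
          have "(\<Sum>u\<in>V. \<lfloor>y - u\<rfloor>) = (\<Sum>u\<in>V. \<lfloor>x - u\<rfloor> - s x u)" "(\<Sum>u\<in>W. \<lfloor>y - u\<rfloor>) = (\<Sum>u\<in>W. \<lfloor>x - u\<rfloor> - s x u)"
            using that fl by (auto intro!: sum.cong)
          then show ?thesis by (simp add: step_fun_def sum_subtractf)
        qed
        show ?thesis
        proof (cases "\<exists>p\<in>U \<union> D. x - p \<in> \<int>")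
          case False
          then have "sum (s x) V = 0" if "V \<subseteq> U \<union> D" for V using that by (intro sum.neutral) (auto simp: s_def)
          then have "step_fun c V W y = step_fun c V W x" if "V \<subseteq> U" "W \<subseteq> D" for c V W
            using st[OF that] that by (simp add: le_supI1 le_supI2)
          then show ?thesis using sub by (simp add: h_def \<psi>_def f_def)
        next
          case True
          then obtain p where "p \<in> U \<union> D" "x - p \<in> \<int>" by blast
          then obtain k where p: "p \<in> U \<union> D" "x - p = of_int k" by (metis Ints_cases)
          have fx: "f x = f p" using per[of p k] p(2) by (simp add: algebra_simps)
          have sp: "s x q = (if q = p then 1 else 0)" if q: "q \<in> U \<union> D" for q
          proof (cases "q = p")
            case False
            have "x - q \<notin> \<int>"
            proof
              assume "x - q \<in> \<int>"
              moreover have "x - p \<in> \<int>" using p(2) by simp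
              ultimately have "(x - q) - (x - p) \<in> \<int>" by (rule Ints_diff)
              moreover have "(x - q) - (x - p) = p - q" by simp
              ultimately have "p - q \<in> \<rat>" using Ints_subset_Rats by auto
              then show False using irr[OF p(1) q] False by auto
            qed
            then show ?thesis using False by (simp add: s_def)
          qed (use p in \<open>simp add: s_def\<close>)
          have sums: "sum (s x) V = (if p \<in> V then 1 else 0)" if "V \<subseteq> U \<union> D" "finite V" for V
          proof -
            have "sum (s x) V = (\<Sum>q\<in>V. if q = p then 1 else 0)" using that sp by (intro sum.cong) auto
            then show ?thesis using that by simp
          qed
          have su: "sum (s x) U = (if p \<in> U then 1 else 0)" "sum (s x) D = (if p \<in> D then 1 else 0)"
            "sum (s x) U' = (if p \<in> U' then 1 else 0)" "sum (s x) D' = (if p \<in> D' then 1 else 0)"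
            by (rule sums; use sub fin in auto)+
          have "p \<in> U \<and> p \<notin> D \<or> p \<in> D \<and> p \<notin> U" using p(1) g by (auto simp: generic_def)
          then show ?thesis
            using st[OF sub, of 0] st[OF order_refl order_refl, of C] fx
            unfolding h_def \<psi>_def f_def[symmetric] su by (auto simp: U'_def D'_def)
        qed
      qed
    qed
  qed
  have const: "h x = h 0" for x
    by (rule connected_local_const[of UNIV]) (use local in auto)
  have eq: "\<psi> x = step_fun (h 0) U' D' x" for x
    using const[of x] by (simp add: h_def step_fun_def)
  \<comment> \<open>Periodicity forces equal numbers of jumps, because a surplus of up-jumps would
    raise the value by that surplus over one period.\<close>
  have "step_fun (h 0) U' D' (0 + of_int 1) = step_fun (h 0) U' D' 0"
    unfolding eq[symmetric] \<psi>_def using per[of 0 1] by simp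
  then have "card U' = card D'" using step_fun_period[OF fin(3,4), of "h 0" 0 1] by simp
  moreover have "p - q \<notin> \<rat>" if "p \<in> U' \<union> D'" "q \<in> U' \<union> D'" "p \<noteq> q" for p q
    using irr[of p q] sub that by auto
  moreover have "U' \<inter> D' = {}" using g sub by (auto simp: generic_def)
  ultimately have gen: "generic U' D'" using fin by (simp add: generic_def)
  show ?thesis
  proof (rule that[of "h 0"])
    show "(if n \<le> f x then 1 else 0) = step_fun (h 0) {u\<in>U. f u = n} {d\<in>D. f d = n - 1} x" for x
      using eq[of x] by (simp only: U'_def D'_def \<psi>_def)
    show "generic {u\<in>U. f u = n} {d\<in>D. f d = n - 1}"
      using gen by (simp only: U'_def D'_def)
  qed
qed

text \<open>Up to an additive constant the function is the indicator of the arc from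
  \<open>u\<close> to \<open>d\<close>, whose length is \<open>frac (d - u)\<close>.\<close>

lemma int_riesz_one_jump:
  assumes \<theta>: "0 < frac (d - u)" "frac (d - u) \<le> 1 / 20"
    and vals: "\<And>x. step_fun C {u} {d} x \<in> {0, 1}"
  shows "int_riesz {x\<in>{0..<1}. step_fun C {u} {d} x = 1}"
proof -
  define t where "t = frac (d - u)"
  have t: "0 < t" "t < 1" using \<theta> by (auto simp: t_def frac_lt_1)
  define m where "m = \<lfloor>d - u\<rfloor>"
  have st: "step_fun C {u} {d} x = C + m + (if frac (x - u) < t then 1 else 0)" for x
  proof -
    have "x - d = (frac (x - u) - t) + of_int (\<lfloor>x - u\<rfloor> - m)"
      by (simp add: frac_def t_def m_def)
    then have "\<lfloor>x - d\<rfloor> = \<lfloor>frac (x - u) - t\<rfloor> + (\<lfloor>x - u\<rfloor> - m)" by (simp only: floor_add_int[symmetric])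
    moreover have "\<lfloor>y - t\<rfloor> = (if y < t then - 1 else 0)" if "0 \<le> y" "y < 1" for y
      using t that by (auto intro!: floor_unique)
    from this[OF frac_ge_0 frac_lt_1]
    have "\<lfloor>frac (x - u) - t\<rfloor> = (if frac (x - u) < t then - 1 else 0)" .
    ultimately show ?thesis by (simp add: step_fun_def)
  qed
  have "frac t = t" using t by (simp add: frac_eq)
  \<comment> \<open>The value is \<open>C + m + 1\<close> at the start \<open>u\<close> of the arc
    and \<open>C + m\<close> at its end \<open>u + t\<close>; both belong to
    \<open>{0, 1}\<close>.\<close>
  then have "C + m = 0" using vals[of u] vals[of "u + t"] t by (auto simp: st)
  then have "{x\<in>{0..<1}. step_fun C {u} {d} x = 1} = {x\<in>{0..<1}. frac (x - u) < t}"
    unfolding st by auto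
  then show ?thesis using int_riesz_arc[of t u] \<theta> by (simp add: t_def)
qed

subsection \<open>Jump sums\<close>

lemma fcoeff_add:
  assumes "bdd_borel u" "bdd_borel v"
  shows "fcoeff (\<lambda>x. u x + v x) k = fcoeff u k + fcoeff v k"
proof -
  have "set_integrable lborel {0..<1} (\<lambda>x. w x * ee (- of_int k * x))" if "bdd_borel w" for w
    by (intro set_integrable_bdd_borel unit_borel_unit bdd_borel_mult that bdd_borel_ee) measurable
  then show ?thesis
    unfolding fcoeff_def distrib_right using assms by (intro set_integral_add(2))
qed

lemma fcoeff_cmult: "fcoeff (\<lambda>x. a * u x) k = a * fcoeff u k"
  unfolding fcoeff_def mult.assoc by (rule set_integral_mult_right)

lemma fcoeff_sum:
  assumes "finite F" "\<And>i. i \<in> F \<Longrightarrow> bdd_borel (u i)"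
  shows "fcoeff (\<lambda>x. \<Sum>i\<in>F. u i x) k = (\<Sum>i\<in>F. fcoeff (u i) k)"
  using assms
proof (induction F rule: finite_induct)
  case empty
  then show ?case by (simp add: fcoeff_def set_lebesgue_integral_def)
next
  case (insert i F)
  then show ?case by (simp add: fcoeff_add bdd_borel_sum)
qed

lemma fcoeff_cong: "(\<And>x. x \<in> {0..<1} \<Longrightarrow> u x = v x) \<Longrightarrow> fcoeff u k = fcoeff v k"
  unfolding fcoeff_def by (rule set_lebesgue_integral_cong) auto

lemma fcoeff_const: "k \<noteq> 0 \<Longrightarrow> fcoeff (\<lambda>x. a) k = 0"
  using integral_ee_unit[of "- k"] by (simp add: fcoeff_def)

text \<open>On the unit interval each floor in a step function is a constant plus such a tail. A
  jump thus contributes \<open>ee (- k * v)\<close>, while the \<open>- 1\<close> cancels between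
  equally many up- and down-jumps.\<close>

lemma fcoeff_indicator_tail:
  assumes k: "k \<noteq> 0"
  shows "fcoeff (\<lambda>x. of_real (indicator {frac v..<1} x)) k = (ee (- of_int k * v) - 1) / (2 * pi * \<i> * k)"
proof -
  have "fcoeff (\<lambda>x. of_real (indicator {frac v..<1} x)) k = (LINT x:{frac v..<1}|lborel. ee ((- of_int k) * x))"
    unfolding fcoeff_def set_lebesgue_integral_def
    by (intro Bochner_Integration.integral_cong) (auto simp: indicator_def dest: order_trans[OF frac_ge_0])
  also have "\<dots> = (ee (- of_int k) - ee (- of_int k * frac v)) / (2 * pi * \<i> * of_real (- of_int k))"
    using k frac_lt_1[of v] by (intro integral_ee) (auto simp: less_imp_le)
  also have "ee (- of_int k :: real) = 1" using ee_of_int[of "- k"] by simp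
  also have "ee (- of_int k * frac v) = ee (- of_int k * v)"
  proof -
    have "- of_int k * frac v = - of_int k * v + of_int (k * \<lfloor>v\<rfloor>)" by (simp add: frac_def algebra_simps)
    then show ?thesis by (simp only: ee_add ee_of_int mult_1_right)
  qed
  finally show ?thesis using k by (simp add: field_simps)
qed

text \<open>The numerator of the \<open>k\<close>-th Fourier coefficient of a step function.
  Multiplying all jumps by \<open>N\<close> amounts to replacing \<open>k\<close> by
  \<open>k * N\<close>.\<close>

definition jump_sum :: "real set \<Rightarrow> real set \<Rightarrow> real \<Rightarrow> complex" where
  "jump_sum U D k = (\<Sum>u\<in>U. ee (- k * u)) - (\<Sum>d\<in>D. ee (- k * d))"

lemma jump_sum_uminus: "jump_sum U D (- k) = cnj (jump_sum U D k)"
  by (simp add: jump_sum_def ee_uminus)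

lemma floor_diff_unit:
  assumes "x \<in> {0..<1}"
  shows "\<lfloor>x - v\<rfloor> = - \<lfloor>v\<rfloor> - 1 + (if frac v \<le> x then 1 else 0)"
proof -
  have "x - v = (x - frac v) + of_int (- \<lfloor>v\<rfloor>)" by (simp add: frac_def)
  then have "\<lfloor>x - v\<rfloor> = \<lfloor>x - frac v\<rfloor> - \<lfloor>v\<rfloor>" by (simp only: floor_add_int[symmetric])
  moreover have "\<lfloor>x - y\<rfloor> = (if y \<le> x then 0 else - 1)" if "0 \<le> y" "y < 1" for y
    using that assms by (auto intro!: floor_unique)
  from this[OF frac_ge_0 frac_lt_1]
  have "\<lfloor>x - frac v\<rfloor> = (if frac v \<le> x then 0 else - 1)" .
  ultimately show ?thesis by simp
qed

lemma step_fun_measurable [measurable]: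
  "(\<lambda>x. real_of_int (step_fun C U D x)) \<in> borel_measurable borel"
  unfolding step_fun_def of_int_add of_int_diff of_int_sum by measurable

lemma fcoeff_step_fun:
  assumes fin: "finite U" "finite D" and card: "card U = card D" and k: "k \<noteq> 0"
  shows "fcoeff (\<lambda>x. of_int (step_fun C U D x)) k = jump_sum U D k / (2 * pi * \<i> * k)"
proof -
  define e where "e v = - \<lfloor>v\<rfloor> - 1" for v :: real
  define K where "K = C + sum e U - sum e D"
  let ?h = "\<lambda>v x. complex_of_real (indicator {frac v..<1} x)"
  have bh: "bdd_borel (?h v)" for v by (rule bdd_borel_indicator) simp
  have fl: "(of_int \<lfloor>x - v\<rfloor> :: complex) = of_int (e v) + ?h v x" if "x \<in> {0..<1}" for x v
    unfolding floor_diff_unit[OF that] using that by (auto simp: indicator_def e_def)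
  have "fcoeff (\<lambda>x. of_int (step_fun C U D x)) k =
    fcoeff (\<lambda>x. of_int K + ((\<Sum>u\<in>U. ?h u x) + (- 1) * (\<Sum>d\<in>D. ?h d x))) k"
  proof (rule fcoeff_cong)
    fix x :: real assume x: "x \<in> {0..<1}"
    have "(\<Sum>u\<in>V. of_int \<lfloor>x - u\<rfloor>) = (\<Sum>u\<in>V. of_int (e u)) + (\<Sum>u\<in>V. ?h u x)" for V
      by (simp only: fl[OF x] sum.distrib)
    then show "of_int (step_fun C U D x) = of_int K + ((\<Sum>u\<in>U. ?h u x) + (- 1) * (\<Sum>d\<in>D. ?h d x))"
      unfolding step_fun_def K_def of_int_add of_int_diff of_int_sum by simp
  qed
  also have "\<dots> = fcoeff (\<lambda>x. of_int K) k + (fcoeff (\<lambda>x. \<Sum>u\<in>U. ?h u x) k + fcoeff (\<lambda>x. (- 1) * (\<Sum>d\<in>D. ?h d x)) k)"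
    by (subst fcoeff_add, (intro bdd_borel_const bdd_borel_add bdd_borel_mult bdd_borel_sum bh)+,
        subst fcoeff_add, (intro bdd_borel_const bdd_borel_add bdd_borel_mult bdd_borel_sum bh)+) (rule refl)
  also have "\<dots> = (\<Sum>u\<in>U. fcoeff (?h u) k) - (\<Sum>d\<in>D. fcoeff (?h d) k)"
    by (simp only: fcoeff_const[OF k] fcoeff_cmult fcoeff_sum[OF fin(1) bh] fcoeff_sum[OF fin(2) bh]) simp
  also have "\<dots> = jump_sum U D k / (2 * pi * \<i> * k)"
    by (simp only: fcoeff_indicator_tail[OF k])
      (simp add: jump_sum_def sum_divide_distrib[symmetric] diff_divide_distrib[symmetric] sum_subtractf card)
  finally show ?thesis .
qed

text \<open>For values 0 and 1 the coefficient at 0 equals the energy \<open>a\<close>, so Bessel's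
  inequality leaves \<open>a - a\<^sup>2 \<le> 1 / 4\<close> for the coefficients at
  \<open>\<plusminus>1\<close> and \<open>\<plusminus>2\<close>, which have equal moduli in
  pairs.\<close>

lemma jump_sum_bound:
  assumes g: "generic U D" and vals: "\<And>x. step_fun C U D x \<in> {0, 1}"
  shows "(cmod (jump_sum U D 1))\<^sup>2 + (cmod (jump_sum U D 2))\<^sup>2 / 4 \<le> pi\<^sup>2 / 2"
proof -
  define \<psi> where "\<psi> x = (of_int (step_fun C U D x) :: complex)" for x
  have \<psi>: "\<psi> x = 0 \<or> \<psi> x = 1" for x using vals[of x] by (auto simp: \<psi>_def)
  have b: "bdd_borel \<psi>"
  proof (rule bdd_borelI)
    show "cmod (\<psi> x) \<le> 1" for x using \<psi>[of x] by auto
    have "\<psi> = (\<lambda>x. complex_of_real (real_of_int (step_fun C U D x)))" by (simp add: \<psi>_def fun_eq_iff)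
    moreover have "\<dots> \<in> borel_measurable borel" by measurable
    ultimately show "\<psi> \<in> borel_measurable borel" by (simp only:)
  qed
  define a where "a = energy {0..<1} \<psi>"
  have "fcoeff \<psi> 0 = (LINT x:{0..<1}|lborel. complex_of_real ((cmod (\<psi> x))\<^sup>2))"
    unfolding fcoeff_def
  proof (intro set_lebesgue_integral_cong)
    show "\<forall>x. x \<in> {0..<1} \<longrightarrow> \<psi> x * ee (- real_of_int 0 * x) = complex_of_real ((cmod (\<psi> x))\<^sup>2)"
    proof (intro allI impI)
      fix x show "\<psi> x * ee (- real_of_int 0 * x) = complex_of_real ((cmod (\<psi> x))\<^sup>2)" using \<psi>[of x] by auto
    qed
  qed simp
  then have 0: "fcoeff \<psi> 0 = of_real a" by (simp only: a_def energy_def set_integral_complex_of_real)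
  have fin: "finite U" "finite D" "card U = card D" using g by (auto simp: generic_def)
  have ck: "(cmod (fcoeff \<psi> k))\<^sup>2 = (cmod (jump_sum U D k))\<^sup>2 / (4 * pi\<^sup>2 * (of_int k)\<^sup>2)" if "k \<noteq> 0" for k
    using fcoeff_step_fun[OF fin that, of C] unfolding \<psi>_def
    by (simp add: norm_divide norm_mult power_divide power_mult_distrib)
  have cm: "cmod (jump_sum U D (- k)) = cmod (jump_sum U D k)" for k by (simp add: jump_sum_uminus)
  have "(\<Sum>k\<in>{0, 1, - 1, 2, - 2}. (cmod (fcoeff \<psi> k))\<^sup>2) \<le> a"
    unfolding a_def by (rule bessel_inequality[OF b]) simp
  then have "a\<^sup>2 + 2 * ((cmod (jump_sum U D 1))\<^sup>2 / (4 * pi\<^sup>2)) + 2 * ((cmod (jump_sum U D 2))\<^sup>2 / (4 * pi\<^sup>2 * 4)) \<le> a"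
    using cm[of 1] cm[of 2] by (simp add: 0 ck)
  moreover have "a - a\<^sup>2 \<le> 1 / 4"
    using zero_le_power2[of "a - 1 / 2"] by (simp add: power2_diff power_divide)
  ultimately have "((cmod (jump_sum U D 1))\<^sup>2 + (cmod (jump_sum U D 2))\<^sup>2 / 4) / (2 * pi\<^sup>2) \<le> 1 / 4"
    by (simp add: add_divide_distrib)
  then show ?thesis by (simp add: field_simps)
qed

text \<open>After expanding the square, the diagonal contributes \<open>card W\<close> for each
  \<open>n\<close>. The other pairs give geometric sums whose ratio has modulus 1 but is not 1,
  hence bounded independently of \<open>M\<close>.\<close>

lemma exponential_sum_average:
  fixes \<sigma> \<theta> :: "'a \<Rightarrow> real"
  assumes W: "finite W" and \<sigma>: "\<And>p. \<bar>\<sigma> p\<bar> = 1"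
    and \<theta>: "\<And>p q. p \<in> W \<Longrightarrow> q \<in> W \<Longrightarrow> p \<noteq> q \<Longrightarrow> \<theta> p - \<theta> q \<notin> \<int>"
  obtains K where "\<And>M. real M * real (card W) - K \<le>
    (\<Sum>n<M. (cmod (\<Sum>p\<in>W. \<sigma> p * ee (real (Suc n) * \<theta> p)))\<^sup>2)"
proof
  define r where "r = (\<lambda>(p, q). ee (\<theta> p - \<theta> q))"
  define X where "X = W \<times> W - Id_on W"
  have finX: "finite X" using W by (auto simp: X_def)
  fix M
  have sq: "complex_of_real ((cmod (\<Sum>p\<in>W. \<sigma> p * ee (real (Suc n) * \<theta> p)))\<^sup>2) =
    of_nat (card W) + (\<Sum>pq\<in>X. of_real (\<sigma> (fst pq) * \<sigma> (snd pq)) * r pq ^ Suc n)" for n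
  proof -
    have t: "\<sigma> p * ee (real (Suc n) * \<theta> p) * cnj (\<sigma> q * ee (real (Suc n) * \<theta> q)) =
      of_real (\<sigma> p * \<sigma> q) * r (p, q) ^ Suc n" for p q
      unfolding r_def case_prod_conv unfolding ee_mult_of_nat[symmetric] unfolding right_diff_distrib ee_diff
      by (simp only: complex_cnj_mult complex_cnj_complex_of_real of_real_mult ac_simps)
    have "complex_of_real ((cmod (\<Sum>p\<in>W. \<sigma> p * ee (real (Suc n) * \<theta> p)))\<^sup>2) =
      (\<Sum>pq\<in>W \<times> W. of_real (\<sigma> (fst pq) * \<sigma> (snd pq)) * r pq ^ Suc n)"
      unfolding complex_norm_square cnj_sum sum_product sum.cartesian_product
      by (intro sum.cong refl) (clarify, simp only: t fst_conv snd_conv)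
    also have "W \<times> W = Id_on W \<union> X" by (auto simp: X_def)
    also have "(\<Sum>pq\<in>Id_on W \<union> X. of_real (\<sigma> (fst pq) * \<sigma> (snd pq)) * r pq ^ Suc n) =
      (\<Sum>pq\<in>Id_on W. of_real (\<sigma> (fst pq) * \<sigma> (snd pq)) * r pq ^ Suc n) +
      (\<Sum>pq\<in>X. of_real (\<sigma> (fst pq) * \<sigma> (snd pq)) * r pq ^ Suc n)"
      using finX W finite_subset[of "Id_on W" "W \<times> W"]
      by (intro sum.union_disjoint) (auto simp: X_def)
    also have "(\<Sum>pq\<in>Id_on W. of_real (\<sigma> (fst pq) * \<sigma> (snd pq)) * r pq ^ Suc n) = (\<Sum>p\<in>W. 1)"
    proof -
      have I: "Id_on W = (\<lambda>p. (p, p)) ` W" by auto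
      have s: "\<sigma> p * \<sigma> p = 1" for p using \<sigma>[of p] by (metis abs_mult_self_eq mult_1)
      have "of_real (\<sigma> p * \<sigma> p) * r (p, p) ^ Suc n = 1" for p
        unfolding s by (simp add: r_def)
      then show ?thesis unfolding I by (subst sum.reindex) (auto simp: inj_on_def)
    qed
    finally show ?thesis by simp
  qed
  define T where "T = (\<Sum>pq\<in>X. of_real (\<sigma> (fst pq) * \<sigma> (snd pq)) * (\<Sum>n<M. r pq ^ Suc n))"
  have "complex_of_real (\<Sum>n<M. (cmod (\<Sum>p\<in>W. \<sigma> p * ee (real (Suc n) * \<theta> p)))\<^sup>2) = of_nat M * of_nat (card W) + T"
    unfolding of_real_sum sq T_def sum.distrib sum_distrib_left
    by (subst (2) sum.swap) simp
  then have "Re (complex_of_real (\<Sum>n<M. (cmod (\<Sum>p\<in>W. \<sigma> p * ee (real (Suc n) * \<theta> p)))\<^sup>2)) =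
    Re (of_nat M * of_nat (card W) + T)"
    by (rule arg_cong)
  then have "(\<Sum>n<M. (cmod (\<Sum>p\<in>W. \<sigma> p * ee (real (Suc n) * \<theta> p)))\<^sup>2) = real M * real (card W) + Re T"
    unfolding Re_complex_of_real by simp
  moreover have "cmod T \<le> (\<Sum>pq\<in>X. 2 / cmod (1 - r pq))"
    unfolding T_def
  proof (rule sum_norm_le)
    fix pq assume "pq \<in> X"
    then obtain p q where pq: "pq = (p, q)" "p \<in> W" "q \<in> W" "p \<noteq> q" by (auto simp: X_def Id_on_def)
    have r1: "r pq \<noteq> 1" using \<theta>[OF pq(2-4)] by (simp add: pq r_def ee_eq_1_iff)
    have nr: "cmod (r pq) = 1" by (simp add: r_def split_beta)
    have "(\<Sum>n<M. r pq ^ Suc n) = r pq * ((1 - r pq ^ M) / (1 - r pq))"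
      using r1 by (simp add: sum_distrib_left[symmetric] sum_gp_strict)
    then have "cmod (\<Sum>n<M. r pq ^ Suc n) = cmod (1 - r pq ^ M) / cmod (1 - r pq)"
      by (simp add: norm_mult norm_divide nr)
    also have "\<dots> \<le> 2 / cmod (1 - r pq)"
      using norm_triangle_ineq4[of 1 "r pq ^ M"] by (intro divide_right_mono) (auto simp: norm_power nr)
    finally show "cmod (of_real (\<sigma> (fst pq) * \<sigma> (snd pq)) * (\<Sum>n<M. r pq ^ Suc n)) \<le> 2 / cmod (1 - r pq)"
      by (simp only: norm_mult norm_of_real abs_mult \<sigma> mult_1)
  qed
  moreover have "- cmod T \<le> Re T" using abs_Re_le_cmod[of T] by linarith
  ultimately show "real M * real (card W) - (\<Sum>pq\<in>X. 2 / cmod (1 - r pq)) \<le>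
    (\<Sum>n<M. (cmod (\<Sum>p\<in>W. \<sigma> p * ee (real (Suc n) * \<theta> p)))\<^sup>2)" by linarith
qed

text \<open>The mean over \<open>N\<close> of the right-hand side is \<open>2 * card U * 5 / 4 \<ge> 5\<close>, which exceeds \<open>pi\<^sup>2 / 2\<close>.\<close>

lemma exists_large_jump_sum:
  assumes g: "generic U D" and L: "card U \<ge> 2"
  obtains N :: nat where "N > 0"
    "pi\<^sup>2 / 2 < (cmod (jump_sum U D (real N)))\<^sup>2 + (cmod (jump_sum U D (2 * real N)))\<^sup>2 / 4"
proof -
  have fin: "finite U" "finite D" "U \<inter> D = {}" "card U = card D" using g by (auto simp: generic_def)
  define \<sigma> :: "real \<Rightarrow> real" where "\<sigma> p = (if p \<in> U then 1 else - 1)" for p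
  have cW: "real (card (U \<union> D)) \<ge> 4" using fin L by (simp add: card_Un_disjoint)
  have js: "jump_sum U D (real N * l) = (\<Sum>p\<in>U \<union> D. \<sigma> p * ee (real N * (- l * p)))" for l N
  proof -
    have "(\<Sum>p\<in>U \<union> D. \<sigma> p * ee (real N * (- l * p))) =
      (\<Sum>p\<in>U. \<sigma> p * ee (real N * (- l * p))) + (\<Sum>p\<in>D. \<sigma> p * ee (real N * (- l * p)))"
      using fin by (intro sum.union_disjoint)
    also have "(\<Sum>p\<in>U. \<sigma> p * ee (real N * (- l * p))) = (\<Sum>p\<in>U. ee (- (real N * l) * p))"
      by (intro sum.cong) (auto simp: \<sigma>_def mult.assoc)
    also have "(\<Sum>p\<in>D. \<sigma> p * ee (real N * (- l * p))) = - (\<Sum>p\<in>D. ee (- (real N * l) * p))"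
      unfolding sum_negf[symmetric] using fin(3) by (intro sum.cong) (auto simp: \<sigma>_def mult.assoc)
    finally show ?thesis by (simp add: jump_sum_def)
  qed
  have avg: "\<exists>K. \<forall>M. real M * 4 - K \<le> (\<Sum>n<M. (cmod (jump_sum U D (real (Suc n) * l)))\<^sup>2)"
    if l: "l \<in> {1, 2}" for l :: real
  proof -
    have irr: "- l * p - - l * q \<notin> \<int>" if "p \<in> U \<union> D" "q \<in> U \<union> D" "p \<noteq> q" for p q
    proof
      assume "- l * p - - l * q \<in> \<int>"
      then have "(- l * p - - l * q) / (- l) \<in> \<rat>"
        using l Ints_subset_Rats by (intro Rats_divide) auto
      moreover have "(- l * p - - l * q) / (- l) = p - q" using l by (auto simp: field_simps)
      ultimately show False using generic_irrational[OF g that] by metis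
    qed
    have finUD: "finite (U \<union> D)" and \<sigma>1: "\<And>p. \<bar>\<sigma> p\<bar> = 1" using fin by (auto simp: \<sigma>_def)
    obtain K where K: "\<And>M. real M * real (card (U \<union> D)) - K \<le>
        (\<Sum>n<M. (cmod (\<Sum>p\<in>U \<union> D. \<sigma> p * ee (real (Suc n) * (- l * p))))\<^sup>2)"
      by (rule exponential_sum_average[of "U \<union> D" \<sigma> "\<lambda>p. - l * p", OF finUD \<sigma>1 irr], assumption+, rule that)
    have "real M * 4 - K \<le> (\<Sum>n<M. (cmod (jump_sum U D (real (Suc n) * l)))\<^sup>2)" for M
      using K[of M] mult_left_mono[OF cW, of "real M"] unfolding js by linarith
    then show ?thesis by blast
  qed
  obtain K1 where K1: "\<And>M. real M * 4 - K1 \<le> (\<Sum>n<M. (cmod (jump_sum U D (real (Suc n) * 1)))\<^sup>2)"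
    using avg[of 1] by auto
  obtain K2 where K2: "\<And>M. real M * 4 - K2 \<le> (\<Sum>n<M. (cmod (jump_sum U D (real (Suc n) * 2)))\<^sup>2)"
    using avg[of 2] by auto
  \<comment> \<open>4.95 lies strictly between \<open>pi\<^sup>2 / 2\<close> and the mean 5.\<close>
  have pi2: "pi\<^sup>2 / 2 \<le> 4.95"
  proof -
    have "pi\<^sup>2 \<le> 3.1416\<^sup>2" using pi_approx by (intro power_mono) auto
    then show ?thesis by (simp add: power2_eq_square)
  qed
  have "\<exists>N>0. pi\<^sup>2 / 2 < (cmod (jump_sum U D (real N)))\<^sup>2 + (cmod (jump_sum U D (2 * real N)))\<^sup>2 / 4"
  proof (rule ccontr)
    assume none: "\<not> ?thesis"
    have small: "(cmod (jump_sum U D (real (Suc n) * 1)))\<^sup>2 + (cmod (jump_sum U D (real (Suc n) * 2)))\<^sup>2 / 4 \<le> 4.95" for n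
    proof -
      have "\<not> pi\<^sup>2 / 2 < (cmod (jump_sum U D (real (Suc n))))\<^sup>2 + (cmod (jump_sum U D (2 * real (Suc n))))\<^sup>2 / 4"
        using none zero_less_Suc[of n] by blast
      then show ?thesis using pi2 unfolding mult_1_right mult.commute[of _ "2 :: real"] by linarith
    qed
    \<comment> \<open>The surplus \<open>5 - 4.95 = 1 / 20\<close> per term must outweigh the
      bounded loss \<open>K1 + K2 / 4\<close>.\<close>
    obtain M where M: "20 * (K1 + K2 / 4) < real M" using reals_Archimedean2 by blast
    have "real M * 4 - K1 + (real M * 4 - K2) / 4 \<le>
      (\<Sum>n<M. (cmod (jump_sum U D (real (Suc n) * 1)))\<^sup>2) + (\<Sum>n<M. (cmod (jump_sum U D (real (Suc n) * 2)))\<^sup>2) / 4"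
      by (intro add_mono divide_right_mono K1 K2) simp
    also have "\<dots> = (\<Sum>n<M. (cmod (jump_sum U D (real (Suc n) * 1)))\<^sup>2 + (cmod (jump_sum U D (real (Suc n) * 2)))\<^sup>2 / 4)"
      by (simp only: sum.distrib sum_divide_distrib)
    also have "\<dots> \<le> (\<Sum>n<M. 4.95)" by (rule sum_mono) (rule small)
    also have "\<dots> = real M * 4.95" by simp
    finally show False using M by (simp add: field_simps)
  qed
  then show ?thesis using that by blast
qed

subsection \<open>Induction on the number of jumps\<close>

lemma unit_borel_step_fun: "unit_borel {x\<in>{0..<1}. step_fun C U D x = 1}"
proof -
  have "{x\<in>{0..<1}. step_fun C U D x = 1} = {x\<in>{0..<1}. real_of_int (step_fun C U D x) = 1}" by simp
  also have "\<dots> \<in> sets borel" by measurable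
  finally show ?thesis by (auto simp: unit_borel_def)
qed

text \<open>Counting fibre points in the set gives a step function with all jumps multiplied by
  \<open>N\<close>. Having more than \<open>n\<close> of them is the superlevel condition at
  \<open>n + 1\<close>, and a superlevel set inherits only some of the jumps.\<close>

lemma layer_step_fun:
  assumes g: "generic U D" and vals: "\<And>x. step_fun C U D x \<in> {0, 1}" and N: "N > 0"
  defines "f \<equiv> step_fun (int N * C) ((*) (real N) ` U) ((*) (real N) ` D)"
  obtains C' U' D' where "U' \<subseteq> (*) (real N) ` U" "D' \<subseteq> (*) (real N) ` D" "generic U' D'"
    "\<And>x. step_fun C' U' D' x \<in> {0, 1}"
    "folding.layer {x\<in>{0..<1}. step_fun C U D x = 1} N n = {x\<in>{0..<1}. step_fun C' U' D' x = 1}"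
proof -
  define A where "A = {x\<in>{0..<1}. step_fun C U D x = 1}"
  interpret folding A N by unfold_locales (unfold A_def, rule unit_borel_step_fun, rule N)
  have card_hits: "int (card (hits x)) = f x" if x: "x \<in> {0..<1}" for x
  proof -
    have "step_fun C U D ((x + real j) / real N) = (if j \<in> hits x then 1 else 0)" if j: "j \<in> {..<N}" for j
    proof -
      have "x + real j < real N" using x j by auto
      then have "(x + real j) / real N \<in> {0..<1}" using x N by simp
      moreover have jhits: "j \<in> hits x \<longleftrightarrow> (x + real j) / real N \<in> A" using j by (simp add: hits_def)
      ultimately show ?thesis unfolding jhits using vals[of "(x + real j) / real N"] by (auto simp: A_def)
    qed
    then have "f x = (\<Sum>j<N. if j \<in> hits x then 1 else 0)"
      unfolding f_def step_fun_fold[OF N, symmetric] by (intro sum.cong) auto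
    also have "\<dots> = int (card (hits x))"
      using hits_subset[of x] by (simp add: sum.If_cases Int_absorb1)
    finally show ?thesis by simp
  qed
  have gN: "generic ((*) (real N) ` U) ((*) (real N) ` D)" by (rule generic_scale[OF g N])
  obtain C' where C': "\<And>x. (if int n + 1 \<le> f x then 1 else 0) =
      step_fun C' {u\<in>(*) (real N) ` U. f u = int n + 1} {d\<in>(*) (real N) ` D. f d = int n + 1 - 1} x"
    and gen: "generic {u\<in>(*) (real N) ` U. f u = int n + 1} {d\<in>(*) (real N) ` D. f d = int n + 1 - 1}"
    by (rule step_fun_superlevel[OF gN, where C="int N * C" and n="int n + 1", folded f_def], rule that)
  show ?thesis
  proof (rule that[OF _ _ gen, of C'])
    show "step_fun C' {u\<in>(*) (real N) ` U. f u = int n + 1} {d\<in>(*) (real N) ` D. f d = int n + 1 - 1} x \<in> {0, 1}" for x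
      unfolding C'[symmetric] by simp
    have "layer n = {x\<in>{0..<1}. (if int n + 1 \<le> f x then 1 else 0) = (1 :: int)}"
    proof -
      have "n < card (hits x) \<longleftrightarrow> (if int n + 1 \<le> f x then 1 else 0) = (1 :: int)" if "x \<in> {0..<1}" for x
        unfolding card_hits[OF that, symmetric] by auto
      then show ?thesis unfolding layer_def by blast
    qed
    then show "folding.layer {x\<in>{0..<1}. step_fun C U D x = 1} N n =
      {x\<in>{0..<1}. step_fun C' {u\<in>(*) (real N) ` U. f u = int n + 1} {d\<in>(*) (real N) ` D. f d = int n + 1 - 1} x = 1}"
      unfolding C' A_def .
  qed auto
qed

theorem int_riesz_step_fun:
  assumes "generic U D" "\<And>x. step_fun C U D x \<in> {0, 1}"
  shows "int_riesz {x\<in>{0..<1}. step_fun C U D x = 1}"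
  using assms
proof (induction "card U" arbitrary: C U D rule: less_induct)
  case less
  note g = less.prems(1) and vals = less.prems(2)
  have fin: "finite U" "finite D" "card U = card D" "U \<inter> D = {}" using g by (auto simp: generic_def)
  \<comment> \<open>The induction hypothesis settles the layers with fewer up-jumps, so only layers
    keeping all of them remain to be treated, for a suitable \<open>N\<close>.\<close>
  have fold: "int_riesz {x\<in>{0..<1}. step_fun C U D x = 1}" if N: "N > 0"
    and ly: "\<And>C' U' D'. U' \<subseteq> (*) (real N) ` U \<Longrightarrow> D' \<subseteq> (*) (real N) ` D \<Longrightarrow> generic U' D' \<Longrightarrow>
      (\<And>x. step_fun C' U' D' x \<in> {0, 1}) \<Longrightarrow> card U' = card U \<Longrightarrow> int_riesz {x\<in>{0..<1}. step_fun C' U' D' x = 1}"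
    for N
  proof -
    interpret folding "{x\<in>{0..<1}. step_fun C U D x = 1}" N
      by unfold_locales (rule unit_borel_step_fun, rule N)
    show ?thesis
    proof (rule int_riesz_folding)
      fix n
      show "int_riesz (layer n)"
      proof (rule layer_step_fun[OF g vals N, of n])
        fix C' U' D'
        assume a: "U' \<subseteq> (*) (real N) ` U" "D' \<subseteq> (*) (real N) ` D" "generic U' D'"
          "\<And>x. step_fun C' U' D' x \<in> {0, 1}"
          "layer n = {x\<in>{0..<1}. step_fun C' U' D' x = 1}"
        have "card U' \<le> card U"
          using card_mono[OF _ a(1)] card_image_le[OF fin(1), of "(*) (real N)"] fin(1) by simp
        then consider "card U' < card U" | "card U' = card U" by linarith
        then have "int_riesz {x\<in>{0..<1}. step_fun C' U' D' x = 1}"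
        proof cases
          case 1
          then show ?thesis using a(3,4) by (rule less.hyps)
        next
          case 2
          with a(1-4) show ?thesis by (rule ly)
        qed
        then show ?thesis unfolding a(5) .
      qed
    qed
  qed
  have card_scale: "card ((*) (real N) ` V) = card V" if "N > 0" for N V
    using that by (intro card_image) (auto simp: inj_on_def)
  consider "card U = 0" | "card U = 1" | "card U \<ge> 2" by linarith
  then show ?case
  proof cases
    case 1
    then have "U = {}" "D = {}" using fin by auto
    then have "{x\<in>{0..<1}. step_fun C U D x = 1} = (if C = 1 then {0..<1} else {})"
      by (auto simp: step_fun_def)
    then show ?thesis by (simp add: int_riesz_empty int_riesz_unit)
  next
    case 2
    then obtain u d where ud: "U = {u}" "D = {d}" using fin(3) by (metis card_1_singletonE)
    have irr: "d - u \<notin> \<rat>" using generic_irrational[OF g, of d u] fin(4) by (auto simp: ud)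
    \<comment> \<open>Multiples of the irrational \<open>d - u\<close> have arbitrarily small
      fractional parts; \<open>1 / 20\<close> is the arc length that
      \<open>int_riesz_one_jump\<close> admits.\<close>
    obtain k :: nat where k: "k > 0" "\<bar>frac (real k * (d - u)) - 0\<bar> < 1 / 20"
      using Kronecker_approx_1_explicit[OF irr, of 0 "1 / 20"] by auto
    show ?thesis
    proof (rule fold[OF k(1)])
      fix C' U' D'
      assume a: "U' \<subseteq> (*) (real k) ` U" "D' \<subseteq> (*) (real k) ` D" "generic U' D'"
          "\<And>x. step_fun C' U' D' x \<in> {0, 1}" "card U' = card U"
      have c: "card U' = 1" "card D' = 1" using a(3,5) 2 by (auto simp: generic_def)
      then have U': "U' = {real k * u}" "D' = {real k * d}"
        using a(1,2) by (auto simp: ud card_1_singleton_iff)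
      have "real k * d - real k * u \<notin> \<int>"
      proof
        assume "real k * d - real k * u \<in> \<int>"
        then have "(real k * d - real k * u) / real k \<in> \<rat>" using Ints_subset_Rats by (intro Rats_divide) auto
        then show False using irr k(1) by (simp add: diff_divide_distrib)
      qed
      then have "0 < frac (real k * d - real k * u)" by simp
      moreover have "frac (real k * d - real k * u) \<le> 1 / 20" using k(2) by (simp add: right_diff_distrib)
      ultimately show "int_riesz {x\<in>{0..<1}. step_fun C' U' D' x = 1}"
        using a(4) unfolding U' by (rule int_riesz_one_jump)
    qed
  next
    case 3
    obtain N :: nat where N: "N > 0"
      "pi\<^sup>2 / 2 < (cmod (jump_sum U D (real N)))\<^sup>2 + (cmod (jump_sum U D (2 * real N)))\<^sup>2 / 4"
      by (rule exists_large_jump_sum[OF g 3])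
    show ?thesis
    proof (rule fold[OF N(1)])
      fix C' U' D'
      assume a: "U' \<subseteq> (*) (real N) ` U" "D' \<subseteq> (*) (real N) ` D" "generic U' D'"
          "\<And>x. step_fun C' U' D' x \<in> {0, 1}" "card U' = card U"
      have "U' = (*) (real N) ` U"
        using a(1,5) fin(1) card_scale[OF N(1)] by (intro card_subset_eq) auto
      moreover have "D' = (*) (real N) ` D"
        using a(2,3,5) fin card_scale[OF N(1)] by (intro card_subset_eq) (auto simp: generic_def)
      moreover have "jump_sum ((*) (real N) ` U) ((*) (real N) ` D) l = jump_sum U D (l * real N)" for l
      proof -
        have "inj_on ((*) (real N)) V" for V using N(1) by (auto simp: inj_on_def)
        then show ?thesis by (simp add: jump_sum_def sum.reindex mult.assoc)
      qed
      \<comment> \<open>A layer keeping all jumps would have, at 1 and 2, the jump sums of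
        \<open>U\<close> and \<open>D\<close> at \<open>N\<close> and \<open>2 * N\<close>, and
        these are too large for \<open>jump_sum_bound\<close>.\<close>
      ultimately have False using jump_sum_bound[OF a(3,4)] N(2) by simp
      then show "int_riesz {x\<in>{0..<1}. step_fun C' U' D' x = 1}" ..
    qed
  qed
qed

subsection \<open>From the unit interval to finite unions of intervals\<close>

text \<open>Almost everywhere \<open>f\<close> agrees with a Borel function, whose truncations are
  bounded and converge to \<open>f\<close> by dominated convergence.\<close>

lemma space_L2_approx:
  assumes S: "S \<in> sets borel" and f: "f \<in> space_L2 S" and e: "\<epsilon> > 0"
  obtains g where "bdd_borel g"
    "integrable (lebesgue_on S) (\<lambda>x. (cmod (f x - g x))\<^sup>2)"
    "(LINT x|lebesgue_on S. (cmod (f x - g x))\<^sup>2) < \<epsilon>"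
proof -
  have SL: "S \<in> sets lebesgue" "S \<inter> space lebesgue \<in> sets lebesgue" using S by auto
  define f0 where "f0 x = (if x \<in> S then f x else 0)" for x
  have fm: "f \<in> borel_measurable (lebesgue_on S)" and fi: "integrable (lebesgue_on S) (\<lambda>x. (cmod (f x))\<^sup>2)"
    using f by (auto simp: space_L2_def)
  have f0m: "f0 \<in> borel_measurable lebesgue"
    unfolding f0_def using borel_measurable_if[OF SL(1)] fm by blast
  obtain gr where gr: "gr \<in> borel_measurable lborel" "AE x in lborel. Re (f0 x) = gr x"
    using completion_ex_borel_measurable_real[of "\<lambda>x. Re (f0 x)" lborel] f0m by auto
  obtain gi where gi: "gi \<in> borel_measurable lborel" "AE x in lborel. Im (f0 x) = gi x"
    using completion_ex_borel_measurable_real[of "\<lambda>x. Im (f0 x)" lborel] f0m by auto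
  define g where "g x = Complex (gr x) (gi x)" for x
  have gm: "g \<in> borel_measurable borel"
    using gr(1) gi(1) unfolding g_def Complex_eq by measurable
  have gf: "AE x in lebesgue. f0 x = g x"
    unfolding AE_completion_iff using gr(2) gi(2)
    by eventually_elim (simp add: g_def complex_eq_iff)
  have gf: "AE x in lebesgue_on S. f x = g x"
    unfolding AE_restrict_space_iff[OF SL(2)] using gf by eventually_elim (auto simp: f0_def)
  \<comment> \<open>Large values are replaced by 0, so almost everywhere the error is either 0 or
    \<open>f\<close> itself and is dominated by \<open>f\<close>.\<close>
  define h where "h n x = (if x \<in> {x. cmod (g x) \<le> real n} then g x else 0)" for n :: nat and x
  have hm: "h n \<in> borel_measurable borel" for n
    unfolding h_def using gm by measurable
  have hb: "bdd_borel (h n)" for n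
    by (rule bdd_borelI[OF hm, of n "real n"]) (auto simp: h_def)
  have hL: "h n \<in> borel_measurable (lebesgue_on S)" for n
    using hm[of n] by (intro measurable_restrict_space1 measurable_completion) simp
  have dom: "AE x in lebesgue_on S. norm ((cmod (f x - h n x))\<^sup>2) \<le> (cmod (f x))\<^sup>2" for n
    using gf by eventually_elim (auto simp: h_def)
  have meas: "(\<lambda>x. (cmod (f x - h n x))\<^sup>2) \<in> borel_measurable (lebesgue_on S)" for n
    using fm hL[of n] by measurable
  have lim: "AE x in lebesgue_on S. (\<lambda>n. (cmod (f x - h n x))\<^sup>2) \<longlonglongrightarrow> 0"
    using gf
  proof eventually_elim
    case (elim x)
    obtain m where "cmod (g x) \<le> real m" using real_arch_simple by blast
    then have "\<forall>\<^sub>F n in sequentially. (cmod (f x - h n x))\<^sup>2 = 0"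
      by (intro eventually_sequentiallyI[of m]) (auto simp: h_def elim)
    then show ?case by (rule tendsto_eventually)
  qed
  have "(\<lambda>n. LINT x|lebesgue_on S. (cmod (f x - h n x))\<^sup>2) \<longlonglongrightarrow> (LINT x|lebesgue_on S. 0)"
    by (rule integral_dominated_convergence[OF _ meas fi lim dom]) simp
  then have "(\<lambda>n. LINT x|lebesgue_on S. (cmod (f x - h n x))\<^sup>2) \<longlonglongrightarrow> 0" by simp
  then have "\<forall>\<^sub>F n in sequentially. (LINT x|lebesgue_on S. (cmod (f x - h n x))\<^sup>2) < \<epsilon>"
    using e by (rule order_tendstoD)
  then obtain n where n: "(LINT x|lebesgue_on S. (cmod (f x - h n x))\<^sup>2) < \<epsilon>"
    by (auto simp: eventually_sequentially)
  have "integrable (lebesgue_on S) (\<lambda>x. (cmod (f x - h n x))\<^sup>2)"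
    by (rule Bochner_Integration.integrable_bound[OF fi meas]) (use dom[of n] in simp)
  then show ?thesis using that[OF hb] n by blast
qed

lemma exponential_eq_ee: "exponential l x = ee (l * x)"
  by (simp add: exponential_def ee_def cis_conv_exp ac_simps)

text \<open>Under \<open>x = s * t + \<tau>\<close> integer frequencies become multiples of
  \<open>s\<close> and squared norms are divided by \<open>s\<close>, while the shift only adds
  phases of modulus 1 to the coefficients. The Riesz constants \<open>a\<close> and 1 thus become
  \<open>a / s\<close> and \<open>1 / s\<close>.\<close>

lemma riesz_basis_affine:
  fixes S A :: "real set"
  assumes S: "S \<in> sets borel" and A: "unit_borel A" and s: "s > 0" and rb: "int_riesz A"
    and ae: "AE t in lborel. t \<in> S \<longleftrightarrow> s * t + \<tau> \<in> A"
  shows "\<exists>\<Lambda>. riesz_basis_L2 S \<Lambda> exponential"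
proof -
  have SL: "S \<inter> space lebesgue \<in> sets lebesgue" using S by auto
  have norm_eq: "(norm_L2 S g)\<^sup>2 = energy A (\<lambda>x. g ((x - \<tau>) / s)) / s"
    and int_g: "integrable (lebesgue_on S) (\<lambda>t. (cmod (g t))\<^sup>2)" if g: "bdd_borel g" for g
  proof -
    note [measurable] = bdd_borel_measurable[OF g] S unit_borelD[OF A]
    have bu: "bdd_borel (\<lambda>x. g ((x - \<tau>) / s))" by (rule bdd_borel_compose[OF g]) measurable
    have iu: "integrable lborel (\<lambda>x. indicator A x * (cmod (g ((x - \<tau>) / s)))\<^sup>2)"
      using set_integrable_energy[OF A bu] by (simp add: set_integrable_def)
    have iA: "integrable lborel (\<lambda>t. indicator A (s * t + \<tau>) * (cmod (g t))\<^sup>2)"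
      using lborel_integrable_real_affine[OF iu, of s \<tau>] s by (simp add: add.commute)
    have aeS: "AE t in lborel. indicator A (s * t + \<tau>) * (cmod (g t))\<^sup>2 = indicator S t * (cmod (g t))\<^sup>2"
      using ae by eventually_elim (auto simp: indicator_def)
    have iS: "integrable lborel (\<lambda>t. indicator S t * (cmod (g t))\<^sup>2)"
      using iA by (rule integrable_cong_AE_imp) (measurable, use aeS in \<open>auto elim: eventually_mono\<close>)
    have iSL: "integrable lebesgue (\<lambda>t. indicator S t * (cmod (g t))\<^sup>2)"
      using iS by (rule integrable_completion[THEN iffD2, rotated]) measurable
    then show "integrable (lebesgue_on S) (\<lambda>t. (cmod (g t))\<^sup>2)"
      unfolding integrable_restrict_space[OF SL] by simp
    have "(norm_L2 S g)\<^sup>2 = (LINT t|lebesgue_on S. (cmod (g t))\<^sup>2)"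
      unfolding norm_L2_def by (simp add: integral_nonneg_AE)
    also have "\<dots> = (LINT t|lebesgue. indicator S t * (cmod (g t))\<^sup>2)"
      by (simp add: integral_restrict_space[OF SL])
    also have "\<dots> = (LINT t|lborel. indicator S t * (cmod (g t))\<^sup>2)"
      by (rule integral_completion) measurable
    also have "\<dots> = (LINT t|lborel. indicator A (s * t + \<tau>) * (cmod (g t))\<^sup>2)"
      by (rule integral_cong_AE) (measurable, use aeS in \<open>auto elim: eventually_mono\<close>)
    also have "\<dots> = \<bar>1 / s\<bar> *\<^sub>R (LINT x|lborel. indicator A (s * (- \<tau> / s + 1 / s * x) + \<tau>) * (cmod (g (- \<tau> / s + 1 / s * x)))\<^sup>2)"
      using s by (intro lborel_integral_real_affine) auto
    also have "\<dots> = energy A (\<lambda>x. g ((x - \<tau>) / s)) / s"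
    proof -
      have "s * (- \<tau> / s + 1 / s * x) + \<tau> = x" "- \<tau> / s + 1 / s * x = (x - \<tau>) / s" for x
        using s by (simp_all add: field_simps)
      then show ?thesis using s by (simp only: energy_def set_lebesgue_integral_def) simp
    qed
    finally show "(norm_L2 S g)\<^sup>2 = energy A (\<lambda>x. g ((x - \<tau>) / s)) / s" .
  qed
  from rb[unfolded int_riesz_def] obtain \<Lambda>0 :: "int set" where
    "(\<forall>u. bdd_borel u \<longrightarrow> approximable A of_int \<Lambda>0 u) \<and> (\<exists>a>0. \<forall>F c. finite F \<longrightarrow> F \<subseteq> \<Lambda>0 \<longrightarrow>
        a * (\<Sum>k\<in>F. (cmod (c k))\<^sup>2) \<le> energy A (trig of_int F c))" ..
  then have dense: "\<And>u. bdd_borel u \<Longrightarrow> approximable A of_int \<Lambda>0 u"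
    and ex: "\<exists>a. a > 0 \<and> (\<forall>F c. finite F \<longrightarrow> F \<subseteq> \<Lambda>0 \<longrightarrow>
        a * (\<Sum>k\<in>F. (cmod (c k))\<^sup>2) \<le> energy A (trig of_int F c))"
    by simp_all
  from ex obtain a where "a > 0 \<and> (\<forall>F c. finite F \<longrightarrow> F \<subseteq> \<Lambda>0 \<longrightarrow>
        a * (\<Sum>k\<in>F. (cmod (c k))\<^sup>2) \<le> energy A (trig of_int F c))" ..
  then have a: "a > 0" and lower: "\<And>F c. finite F \<Longrightarrow> F \<subseteq> \<Lambda>0 \<Longrightarrow>
        a * (\<Sum>k\<in>F. (cmod (c k))\<^sup>2) \<le> energy A (trig of_int F c)"
    by simp_all
  define \<kappa> where "\<kappa> k = s * of_int k" for k :: int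
  have inj: "inj \<kappa>" using s by (auto simp: inj_def \<kappa>_def)
  define \<Lambda> where "\<Lambda> = \<kappa> ` \<Lambda>0"
  have bexp: "bdd_borel (exponential l)" for l
    unfolding exponential_eq_ee[abs_def] by (rule bdd_borel_ee) measurable
  have bsum: "bdd_borel (\<lambda>t. \<Sum>l\<in>F. c l * exponential l t)" for F c
    by (intro bdd_borel_sum bdd_borel_mult bdd_borel_const bexp)
  have sum_trig: "(\<Sum>l\<in>\<kappa> ` G. c l * exponential l ((x - \<tau>) / s)) =
      trig of_int G (\<lambda>k. c (\<kappa> k) * ee (- of_int k * \<tau>)) x" for G c x
  proof -
    have "exponential (\<kappa> k) ((x - \<tau>) / s) = ee (- of_int k * \<tau>) * ee (of_int k * x)" for k
    proof -
      have "\<kappa> k * ((x - \<tau>) / s) = - of_int k * \<tau> + of_int k * x"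
        using s by (simp add: \<kappa>_def field_simps)
      then show ?thesis by (simp only: exponential_eq_ee ee_add)
    qed
    then show ?thesis
      unfolding trig_def by (subst sum.reindex[OF inj_on_subset[OF inj subset_UNIV]]) (simp add: mult.assoc)
  qed
  have bounds: "a / s * (\<Sum>l\<in>F. (cmod (c l))\<^sup>2) \<le> (norm_L2 S (\<lambda>t. \<Sum>l\<in>F. c l * exponential l t))\<^sup>2 \<and>
     (norm_L2 S (\<lambda>t. \<Sum>l\<in>F. c l * exponential l t))\<^sup>2 \<le> 1 / s * (\<Sum>l\<in>F. (cmod (c l))\<^sup>2)"
    if F: "finite F" "F \<subseteq> \<Lambda>" for F c
  proof -
    obtain G where G: "G \<subseteq> \<Lambda>0" "F = \<kappa> ` G" using F(2) unfolding \<Lambda>_def by (auto simp: subset_image_iff)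
    have finG: "finite G" using F(1) G(2) inj by (metis finite_imageD inj_on_subset subset_UNIV)
    define d where "d k = c (\<kappa> k) * ee (- of_int k * \<tau>)" for k
    have "(\<Sum>l\<in>F. (cmod (c l))\<^sup>2) = (\<Sum>k\<in>G. (cmod (d k))\<^sup>2)"
      unfolding G(2) by (subst sum.reindex[OF inj_on_subset[OF inj subset_UNIV]]) (simp add: d_def norm_mult)
    moreover have "(norm_L2 S (\<lambda>t. \<Sum>l\<in>F. c l * exponential l t))\<^sup>2 = energy A (trig of_int G d) / s"
      unfolding norm_eq[OF bsum] unfolding G(2) sum_trig d_def ..
    ultimately show ?thesis
      using lower[OF finG G(1), of d] energy_trig_of_int_le[OF finG A, of d] s
      by (simp add: field_simps)
  qed
  have complete: "\<exists>F c. finite F \<and> F \<subseteq> \<Lambda> \<and> norm_L2 S (\<lambda>t. f t - (\<Sum>l\<in>F. c l * exponential l t)) < \<epsilon>"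
    if f: "f \<in> space_L2 S" and e: "\<epsilon> > 0" for f \<epsilon>
  proof -
    have e4: "\<epsilon>\<^sup>2 / 4 > 0" using e by simp
    obtain g where g: "bdd_borel g" "integrable (lebesgue_on S) (\<lambda>x. (cmod (f x - g x))\<^sup>2)"
      "(LINT x|lebesgue_on S. (cmod (f x - g x))\<^sup>2) < \<epsilon>\<^sup>2 / 4"
      by (rule space_L2_approx[OF S f e4])
    have bu: "bdd_borel (\<lambda>x. g ((x - \<tau>) / s))" by (rule bdd_borel_compose[OF g(1)]) measurable
    have se: "s * (\<epsilon>\<^sup>2 / 4) > 0" using s e4 by simp
    obtain G d where G: "finite G" "G \<subseteq> \<Lambda>0"
      "energy A (\<lambda>x. g ((x - \<tau>) / s) - trig of_int G d x) < s * (\<epsilon>\<^sup>2 / 4)"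
      using dense[OF bu, unfolded approximable_def, rule_format, OF se] by blast
    \<comment> \<open>Inverts the change of coefficients in \<open>sum_trig\<close>: the added phase
      cancels the one coming from \<open>\<tau>\<close>.\<close>
    define c where "c l = d (inv \<kappa> l) * ee (of_int (inv \<kappa> l) * \<tau>)" for l
    have cd: "c (\<kappa> k) * ee (- of_int k * \<tau>) = d k" for k
      by (simp add: c_def inv_f_f[OF inj] mult.assoc ee_add[symmetric])
    let ?p = "\<lambda>t. \<Sum>l\<in>\<kappa> ` G. c l * exponential l t"
    have bgp: "bdd_borel (\<lambda>t. g t - ?p t)" by (intro bdd_borel_diff g(1) bsum)
    have "(norm_L2 S (\<lambda>t. g t - ?p t))\<^sup>2 = energy A (\<lambda>x. g ((x - \<tau>) / s) - trig of_int G d x) / s"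
      unfolding norm_eq[OF bgp] sum_trig cd ..
    also have "\<dots> < \<epsilon>\<^sup>2 / 4" using G(3) s by (simp add: field_simps)
    finally have gp: "(LINT t|lebesgue_on S. (cmod (g t - ?p t))\<^sup>2) < \<epsilon>\<^sup>2 / 4"
      unfolding norm_L2_def by (simp add: integral_nonneg_AE)
    have "(LINT t|lebesgue_on S. (cmod (f t - ?p t))\<^sup>2) \<le>
      (LINT t|lebesgue_on S. 2 * (cmod (f t - g t))\<^sup>2 + 2 * (cmod (g t - ?p t))\<^sup>2)"
    proof (rule integral_mono')
      show "integrable (lebesgue_on S) (\<lambda>t. 2 * (cmod (f t - g t))\<^sup>2 + 2 * (cmod (g t - ?p t))\<^sup>2)"
        by (intro Bochner_Integration.integrable_add integrable_mult_right g(2) int_g[OF bgp])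
      show "(cmod (f t - ?p t))\<^sup>2 \<le> 2 * (cmod (f t - g t))\<^sup>2 + 2 * (cmod (g t - ?p t))\<^sup>2" for t
        using norm_add_sq_le[of 1 "f t - g t" "g t - ?p t"] by simp
    qed simp
    also have "\<dots> = 2 * (LINT t|lebesgue_on S. (cmod (f t - g t))\<^sup>2) + 2 * (LINT t|lebesgue_on S. (cmod (g t - ?p t))\<^sup>2)"
      using g(2) int_g[OF bgp] by simp
    also have "\<dots> < \<epsilon>\<^sup>2" using g(3) gp by simp
    finally have "norm_L2 S (\<lambda>t. f t - ?p t) < \<epsilon>"
      unfolding norm_L2_def using e by (simp add: real_less_lsqrt real_sqrt_less_iff real_sqrt_unique sqrt_le_D)
    then show ?thesis using G(1,2) by (intro exI[of _ "\<kappa> ` G"] exI[of _ c]) (auto simp: \<Lambda>_def)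
  qed
  have mem: "exponential l \<in> space_L2 S" for l
  proof -
    have "exponential l \<in> borel_measurable (lebesgue_on S)"
      using bdd_borel_measurable[OF bexp] by (intro measurable_restrict_space1 measurable_completion) simp
    then show ?thesis using int_g[OF bexp] by (simp add: space_L2_def)
  qed
  have "riesz_basis_L2 S \<Lambda> exponential"
    unfolding riesz_basis_L2_def complete_system_L2_def
    using mem complete bounds a s by (intro conjI exI[of _ "a / s"] exI[of _ "1 / s"]) auto
  then show ?thesis ..
qed

text \<open>Each pair of distinct points excludes only countably many values of \<open>s\<close>, so
  an interval of small positive values is not exhausted.\<close>

lemma ex_irrational_scaling:
  fixes P :: "real set"
  assumes "finite P"
  obtains s where "s > 0" "\<And>p. p \<in> P \<Longrightarrow> \<bar>s * p\<bar> < 1 / 2"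
    "\<And>p q. p \<in> P \<Longrightarrow> q \<in> P \<Longrightarrow> p \<noteq> q \<Longrightarrow> s * p - s * q \<notin> \<rat>"
proof -
  define R where "R = (\<Sum>p\<in>P. \<bar>p\<bar>) + 1"
  have R: "R > 0" unfolding R_def by (simp add: sum_nonneg add_nonneg_pos)
  have PR: "\<bar>p\<bar> < R" if "p \<in> P" for p
    using member_le_sum[of p P abs] that assms unfolding R_def by simp
  define bad where "bad = (\<Union>(p, q)\<in>P \<times> P. (\<lambda>r. r / (p - q)) ` \<rat>)"
  have "countable bad"
    unfolding bad_def using assms by (intro countable_UN) (auto simp: countable_rat intro: countable_finite)
  moreover have "uncountable {0<..<1 / (2 * R)}" using R by (simp add: uncountable_open_interval)
  ultimately have "\<not> {0<..<1 / (2 * R)} \<subseteq> bad" using countable_subset by blast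
  then obtain s where "s \<in> {0<..<1 / (2 * R)}" "s \<notin> bad" by blast
  then have s: "0 < s" "s < 1 / (2 * R)" "s \<notin> bad" by simp_all
  show ?thesis
  proof (rule that[OF s(1)])
    fix p assume "p \<in> P"
    then have "\<bar>s * p\<bar> \<le> s * R" using PR[of p] s(1) by (simp add: abs_mult)
    also have "\<dots> < 1 / 2" using s(2) R by (simp add: field_simps)
    finally show "\<bar>s * p\<bar> < 1 / 2" .
  next
    fix p q assume pq: "p \<in> P" "q \<in> P" "p \<noteq> q"
    show "s * p - s * q \<notin> \<rat>"
    proof
      assume "s * p - s * q \<in> \<rat>"
      moreover have "s = (s * p - s * q) / (p - q)" using pq(3) by (simp add: field_simps)
      ultimately have "s \<in> bad" unfolding bad_def using pq by blast
      then show False using s(3) by simp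
    qed
  qed
qed

text \<open>Intervals may share endpoints; such a common point is both an up-jump and a down-jump and
  cancels, which is what makes the remaining jump points pairwise distinct.\<close>

lemma riesz_basis_intervals:
  fixes I :: "'i set" and a b :: "'i \<Rightarrow> real"
  assumes I: "finite I" and ab: "\<And>i. i \<in> I \<Longrightarrow> a i < b i"
    and disj: "\<And>i j. i \<in> I \<Longrightarrow> j \<in> I \<Longrightarrow> i \<noteq> j \<Longrightarrow> {a i<..<b i} \<inter> {a j<..<b j} = {}"
    and S: "S \<in> sets borel" and ae: "AE t in lborel. t \<in> S \<longleftrightarrow> t \<in> (\<Union>i\<in>I. {a i..<b i})"
  shows "\<exists>\<Lambda>. riesz_basis_L2 S \<Lambda> exponential"
proof -
  have eq: "i = j" if "i \<in> I" "j \<in> I" "max (a i) (a j) < min (b i) (b j)" for i j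
  proof (rule ccontr)
    assume "i \<noteq> j"
    define m where "m = (max (a i) (a j) + min (b i) (b j)) / 2"
    have "m \<in> {a i<..<b i} \<inter> {a j<..<b j}" using that(3) by (auto simp: m_def max_def min_def)
    then show False using disj[OF that(1,2) \<open>i \<noteq> j\<close>] by blast
  qed
  have inja: "inj_on a I"
  proof (rule inj_onI)
    fix i j assume *: "i \<in> I" "j \<in> I" "a i = a j"
    then show "i = j" using ab[of i] ab[of j] by (intro eq) auto
  qed
  have injb: "inj_on b I"
  proof (rule inj_onI)
    fix i j assume *: "i \<in> I" "j \<in> I" "b i = b j"
    then show "i = j" using ab[of i] ab[of j] by (intro eq) auto
  qed
  obtain s where s: "s > 0" "\<And>p. p \<in> a ` I \<union> b ` I \<Longrightarrow> \<bar>s * p\<bar> < 1 / 2"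
    "\<And>p q. p \<in> a ` I \<union> b ` I \<Longrightarrow> q \<in> a ` I \<union> b ` I \<Longrightarrow> p \<noteq> q \<Longrightarrow> s * p - s * q \<notin> \<rat>"
    using ex_irrational_scaling[of "a ` I \<union> b ` I"] I by blast
  \<comment> \<open>Shifting by \<open>1 / 2\<close> places all scaled endpoints strictly inside the
    unit interval, so no interval wraps around.\<close>
  define \<phi> where "\<phi> t = s * t + 1 / 2" for t
  have \<phi>: "\<phi> x \<le> \<phi> y \<longleftrightarrow> x \<le> y" "\<phi> x < \<phi> y \<longleftrightarrow> x < y" "\<phi> x = \<phi> y \<longleftrightarrow> x = y" for x y
    using s(1) by (auto simp: \<phi>_def)
  have injf: "inj \<phi>" by (simp add: inj_def \<phi>)
  have u01: "0 < \<phi> p" "\<phi> p < 1" if "p \<in> a ` I \<union> b ` I" for p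
    using s(2)[OF that] unfolding \<phi>_def by linarith+
  define U where "U = \<phi> ` (a ` I)"
  define D where "D = \<phi> ` (b ` I)"
  have fin: "finite U" "finite D" using I by (auto simp: U_def D_def)
  have cUD: "card U = card D"
    unfolding U_def D_def using inja injb inj_on_subset[OF injf subset_UNIV] by (simp add: card_image)
  have irr: "p - q \<notin> \<rat>" if pq: "p \<in> U \<union> D" "q \<in> U \<union> D" "p \<noteq> q" for p q
  proof -
    obtain p' q' where "p' \<in> a ` I \<union> b ` I" "q' \<in> a ` I \<union> b ` I" "p = \<phi> p'" "q = \<phi> q'"
      using pq(1,2) unfolding U_def D_def by blast
    then show ?thesis using s(3)[of p' q'] pq(3) by (auto simp: \<phi>_def)
  qed
  have gen: "generic (U - D) (D - U)"
  proof -
    have "card (U - D) = card (D - U)"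
      using fin cUD by (simp add: card_Diff_subset_Int Int_commute)
    moreover have "\<forall>p\<in>(U - D) \<union> (D - U). \<forall>q\<in>(U - D) \<union> (D - U). p \<noteq> q \<longrightarrow> p - q \<notin> \<rat>"
      using irr by blast
    ultimately show ?thesis using fin by (auto simp: generic_def)
  qed
  have cancel: "step_fun 0 (U - D) (D - U) x = (\<Sum>i\<in>I. \<lfloor>x - \<phi> (a i)\<rfloor> - \<lfloor>x - \<phi> (b i)\<rfloor>)" for x
  proof -
    have "step_fun 0 (U - D) (D - U) x = (\<Sum>u\<in>U. \<lfloor>x - u\<rfloor>) - (\<Sum>d\<in>D. \<lfloor>x - d\<rfloor>)"
      using sum.Int_Diff[OF fin(1), of "\<lambda>u. \<lfloor>x - u\<rfloor>" D] sum.Int_Diff[OF fin(2), of "\<lambda>u. \<lfloor>x - u\<rfloor>" U]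
      by (simp add: step_fun_def Int_commute)
    also have "(\<Sum>u\<in>U. \<lfloor>x - u\<rfloor>) = (\<Sum>i\<in>I. \<lfloor>x - \<phi> (a i)\<rfloor>)"
      unfolding U_def using inja inj_on_subset[OF injf subset_UNIV] by (simp add: sum.reindex)
    also have "(\<Sum>u\<in>D. \<lfloor>x - u\<rfloor>) = (\<Sum>i\<in>I. \<lfloor>x - \<phi> (b i)\<rfloor>)"
      unfolding D_def using injb inj_on_subset[OF injf subset_UNIV] by (simp add: sum.reindex)
    finally show ?thesis by (simp add: sum_subtractf)
  qed
  have unit: "step_fun 0 (U - D) (D - U) x = (if \<exists>i\<in>I. \<phi> (a i) \<le> x \<and> x < \<phi> (b i) then 1 else 0)"
    if x: "x \<in> {0..<1}" for x
  proof -
    have fl: "\<lfloor>x - \<phi> p\<rfloor> = (if \<phi> p \<le> x then 0 else - 1)" if "p \<in> a ` I \<union> b ` I" for p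
      using u01[OF that] x by (auto intro!: floor_unique)
    have "\<lfloor>x - \<phi> (a i)\<rfloor> - \<lfloor>x - \<phi> (b i)\<rfloor> = (if \<phi> (a i) \<le> x \<and> x < \<phi> (b i) then 1 else 0)" if "i \<in> I" for i
    proof -
      have "\<phi> (a i) < \<phi> (b i)" using ab[OF that] by (simp add: \<phi>)
      then show ?thesis using that by (subst fl, simp, subst fl, simp) auto
    qed
    then have sum: "step_fun 0 (U - D) (D - U) x = (\<Sum>i\<in>I. if \<phi> (a i) \<le> x \<and> x < \<phi> (b i) then 1 else 0)"
      unfolding cancel by (intro sum.cong) auto
    show ?thesis
    proof (cases "\<exists>i\<in>I. \<phi> (a i) \<le> x \<and> x < \<phi> (b i)")
      case True
      then obtain i where i: "i \<in> I" "\<phi> (a i) \<le> x" "x < \<phi> (b i)" by blast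
      have uniq: "j = i" if j: "j \<in> I" "\<phi> (a j) \<le> x" "x < \<phi> (b j)" for j
      proof -
        have "\<phi> (max (a i) (a j)) < \<phi> (min (b i) (b j))" using i j by (auto simp: max_def min_def)
        then show ?thesis using eq[OF i(1) j(1)] by (simp add: \<phi>)
      qed
      have "(\<Sum>j\<in>I. if \<phi> (a j) \<le> x \<and> x < \<phi> (b j) then 1 else 0) = (\<Sum>j\<in>I. if j = i then 1 else (0 :: int))"
      proof (intro sum.cong refl)
        fix j assume j: "j \<in> I"
        have "\<phi> (a j) \<le> x \<and> x < \<phi> (b j) \<longleftrightarrow> j = i"
          using uniq[OF j] i(2,3) by metis
        then show "(if \<phi> (a j) \<le> x \<and> x < \<phi> (b j) then 1 else 0) = (if j = i then 1 else (0 :: int))"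
          by simp
      qed
      also have "\<dots> = 1" using i(1) I by simp
      finally show ?thesis using sum True by simp
    next
      case False
      then have "(\<Sum>i\<in>I. if \<phi> (a i) \<le> x \<and> x < \<phi> (b i) then 1 else 0) = (0 :: int)"
        by (intro sum.neutral) auto
      then show ?thesis using sum False by simp
    qed
  qed
  \<comment> \<open>The explicit formula holds on the unit interval only; periodicity extends the
    conclusion to the line, as \<open>int_riesz_step_fun\<close> requires.\<close>
  have vals: "step_fun 0 (U - D) (D - U) x \<in> {0, 1}" for x
  proof -
    have "step_fun 0 (U - D) (D - U) (frac x + of_int \<lfloor>x\<rfloor>) = step_fun 0 (U - D) (D - U) (frac x)"
      using gen fin by (subst step_fun_period) (auto simp: generic_def)
    then have "step_fun 0 (U - D) (D - U) x = step_fun 0 (U - D) (D - U) (frac x)" by (simp add: frac_def)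
    then show ?thesis using unit[of "frac x"] by (simp add: frac_lt_1)
  qed
  define A where "A = {x\<in>{0..<1}. step_fun 0 (U - D) (D - U) x = 1}"
  have "AE t in lborel. t \<in> S \<longleftrightarrow> s * t + 1 / 2 \<in> A"
    using ae
  proof eventually_elim
    case (elim t)
    have "\<phi> t \<in> A \<longleftrightarrow> (\<exists>i\<in>I. a i \<le> t \<and> t < b i)"
    proof
      assume "\<phi> t \<in> A"
      then show "\<exists>i\<in>I. a i \<le> t \<and> t < b i" using unit[of "\<phi> t"] by (auto simp: A_def \<phi> split: if_splits)
    next
      assume "\<exists>i\<in>I. a i \<le> t \<and> t < b i"
      then obtain i where i: "i \<in> I" "a i \<le> t" "t < b i" by blast
      have "\<phi> (a i) \<le> \<phi> t" "\<phi> t < \<phi> (b i)" using i by (simp_all add: \<phi>)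
      then have "\<phi> t \<in> {0..<1}" using u01[of "a i"] u01[of "b i"] i(1) by auto
      then show "\<phi> t \<in> A" using unit[of "\<phi> t"] i by (auto simp: A_def \<phi>)
    qed
    then show ?case using elim by (auto simp: \<phi>_def)
  qed
  moreover have "unit_borel A" unfolding A_def by (rule unit_borel_step_fun)
  moreover have "int_riesz A" unfolding A_def by (rule int_riesz_step_fun[OF gen vals])
  ultimately show ?thesis using riesz_basis_affine[OF S _ s(1)] by blast
qed

text \<open>The given intervals may be open, closed or half-open. Replacing each by
  \<open>[Inf J, Sup J)\<close> changes \<open>S\<close> only at endpoints, which form a finite null
  set.\<close>

theorem theorem1:
  fixes S :: "real set" and \<J> :: "real set set" and \<alpha> \<beta> :: real
  assumes "finite \<J>"
    and "\<And>J. J \<in> \<J> \<Longrightarrow> is_interval J \<and> bounded J"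
    and "pairwise disjnt \<J>"
    and "S = \<Union>\<J>"
    and "\<And>J. J \<in> \<J> \<Longrightarrow> \<exists>n m :: int. measure lebesgue J = of_int n * \<alpha> + of_int m * \<beta>"
  shows "\<exists>\<Lambda> :: real set. riesz_basis_L2 S \<Lambda> exponential"
proof -
  \<comment> \<open>Empty and one-point intervals are discarded, as they carry no measure and would
    break \<open>Inf J < Sup J\<close>; for the empty set \<open>Inf\<close> and \<open>Sup\<close>
    say nothing.\<close>
  define I where "I = {J\<in>\<J>. J \<noteq> {} \<and> Inf J < Sup J}"
  have bdd: "bdd_above J" "bdd_below J" if "J \<in> \<J>" for J
    using assms(2)[OF that] by (auto intro: bounded_imp_bdd_above bounded_imp_bdd_below)
  have inside: "{Inf J<..<Sup J} \<subseteq> J" if "J \<in> I" for J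
  proof
    fix x assume x: "x \<in> {Inf J<..<Sup J}"
    have J: "J \<in> \<J>" "J \<noteq> {}" using that by (auto simp: I_def)
    obtain y where y: "y \<in> J" "y < x" using x J cInf_lessD[of J x] by auto
    obtain z where z: "z \<in> J" "x < z" using x J less_cSupD[of J x] by auto
    show "x \<in> J" using assms(2)[OF J(1)] y z mem_is_interval_1_I[of J y z x] by auto
  qed
  have bounds: "Inf J \<le> x \<and> x \<le> Sup J" if "J \<in> \<J>" "x \<in> J" for J x
    using that bdd[OF that(1)] by (auto intro: cInf_lower cSup_upper)
  have SB: "S \<in> sets borel"
    unfolding assms(4) using assms(1,2) by (intro sets.finite_Union) (auto intro: real_interval_borel_measurable)
  show ?thesis
  proof (rule riesz_basis_intervals[where I=I and a=Inf and b=Sup])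
    show "finite I" using assms(1) by (simp add: I_def)
    show "Inf J < Sup J" if "J \<in> I" for J using that by (simp add: I_def)
    show "{Inf J<..<Sup J} \<inter> {Inf K<..<Sup K} = {}" if "J \<in> I" "K \<in> I" "J \<noteq> K" for J K
    proof -
      have "J \<inter> K = {}" using assms(3) that by (auto simp: I_def pairwise_def disjnt_def)
      then show ?thesis using inside[OF that(1)] inside[OF that(2)] by blast
    qed
    define E where "E = Inf ` \<J> \<union> Sup ` \<J>"
    have "AE t in lborel. t \<notin> E"
      using assms(1) by (intro AE_not_in countable_imp_null_set_lborel countable_finite) (simp add: E_def)
    then show "AE t in lborel. t \<in> S \<longleftrightarrow> t \<in> (\<Union>J\<in>I. {Inf J..<Sup J})"
    proof eventually_elim
      case (elim t)
      show ?case
      proof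
        assume "t \<in> S"
        then obtain J where J: "J \<in> \<J>" "t \<in> J" using assms(4) by blast
        then have "t \<noteq> Inf J" "t \<noteq> Sup J" using elim by (auto simp: E_def)
        then have "Inf J < t" "t < Sup J" using bounds[OF J] by auto
        moreover have "J \<in> I" using J calculation by (auto simp: I_def)
        ultimately show "t \<in> (\<Union>J\<in>I. {Inf J..<Sup J})" by force
      next
        assume "t \<in> (\<Union>J\<in>I. {Inf J..<Sup J})"
        then obtain J where J: "J \<in> I" "Inf J \<le> t" "t < Sup J" by auto
        then have "t \<noteq> Inf J" using elim by (auto simp: E_def I_def)
        then have "t \<in> J" using inside[OF J(1)] J by auto
        then show "t \<in> S" using J(1) assms(4) by (auto simp: I_def)
      qed
    qed
  qed (rule SB)
qed

end
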